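(* Let $G$ be a countable group, and let $\mu$, $\{\mu_k\}_{k\ge 1}$ be non-degenerate probability measures on $G$ with finite entropy. Assume that $\lim_{k\to\infty}\mu_k(g)=\mu(g)$ for each $g\in G$ and that $\lim_{k\to\infty}H(\mu_k)=H(\mu)$. Suppose that there is a Polish space $X$ on which $G$ acts by continuous transformations, and Borel probability measures $\nu$, $\{\nu_k\}_{k\ge 1}$ on $X$ such that $(X,\nu)$ is the Poisson boundary of $(G,\mu)$ and, for each $k\ge 1$, $(X,\nu_k)$ is the Poisson boundary of $(G,\mu_k)$. If the sequence $\{\nu_k\}_{k\ge 1}$ converges weakly to $\nu$, then $\lim_{k\to\infty}h(\mu_k)=h(\mu)$. In particular, the conclusion $\lim_{k\to\infty}h(\mu_k)=h(\mu)$ holds whenever, in addition to the assumptions preceding the weak convergence hypothesis, $X$ is compact and admits a unique $\mu$-stationary probability measure.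
   Context: For a probability measure $\mu$ on a countable group $G$: $H(\mu)=-\sum_{g\in G}\mu(g)\log\mu(g)$ is the Shannon entropy ("finite entropy" means $H(\mu)<\infty$), $\mu^{*n}$ is the $n$-th convolution power, and $h(\mu)=\lim_{n\to\infty}H(\mu^{*n})/n$ is the asymptotic entropy. The measure $\mu$ is non-degenerate if the semigroup generated by its support is $G$. A Polish space is a separable completely metrizable space. A Borel probability measure $\nu$ on a space $X$ with a $G$-action is $\mu$-stationary if $\nu=\mu*\nu=\sum_{g\in G}\mu(g)\,g_*\nu$. The $\mu$-random walk is $w_n=g_1\cdots g_n$ with $g_i$ i.i.d. of law $\mu$, and its law on trajectories in $G^{\mathbb{Z}_{+}}$ is $\mathbb{P}$. Poisson boundary: declare two trajectories $(w_n)$, $(w_n')$ equivalent if there are $p,N\ge 0$ with $w_n=w'_{n+p}$ for all $n>N$; the quotient measure space associated with the $\sigma$-algebra of measurable sets which are unions of equivalence classes up to $\mathbb{P}$-null sets, with the image of $\mathbb{P}$ and the induced $G$-action, is the Poisson boundary of $(G,\mu)$. Equivalently, it is the $G$-space with $\mu$-stationary probability measure, unique up to $G$-equivariant measure space isomorphism, such that $f\mapsto \big(g\mapsto\int f\,d(g_*\nu)\big)$ is an isomorphism from its $L^\infty$ space onto the space of bounded $\mu$-harmonic functions on $G$ (those $\varphi$ with $\varphi(g)=\sum_{h}\varphi(gh)\mu(h)$). Saying that $(X,\nu)$ is the Poisson boundary means that it is isomorphic to it as a measured $G$-space. *)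

theory Defs
  imports "HOL-Probability.Probability" "HOL-Algebra.Group_Action"
begin

text \<open>
  A probability measure on a countable group \<open>G\<close> is a \<open>pmf\<close> whose support is contained in
  \<open>carrier G\<close>.
\<close>

subsection \<open>Entropy and convolution\<close>

text \<open>
  The summands \<open>-\<mu>(g) ln \<mu>(g)\<close> are nonnegative (and \<open>0 * ln 0 = 0\<close>), so summability is
  the same as finiteness of the sum; \<open>shannon_entropy\<close> is only meaningful in that case.
\<close>

definition finite_entropy :: "('g, 'b) monoid_scheme \<Rightarrow> 'g pmf \<Rightarrow> bool" where
  "finite_entropy G \<mu> \<longleftrightarrow> (\<lambda>g. - (pmf \<mu> g * ln (pmf \<mu> g))) summable_on carrier G"

definition shannon_entropy :: "('g, 'b) monoid_scheme \<Rightarrow> 'g pmf \<Rightarrow> real" where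
  "shannon_entropy G \<mu> = (\<Sum>\<^sub>\<infinity>g\<in>carrier G. - (pmf \<mu> g * ln (pmf \<mu> g)))"

definition convolution_pmf :: "('g, 'b) monoid_scheme \<Rightarrow> 'g pmf \<Rightarrow> 'g pmf \<Rightarrow> 'g pmf" where
  "convolution_pmf G \<mu> \<mu>' = map_pmf (\<lambda>(g, h). g \<otimes>\<^bsub>G\<^esub> h) (pair_pmf \<mu> \<mu>')"

primrec convolution_power :: "('g, 'b) monoid_scheme \<Rightarrow> 'g pmf \<Rightarrow> nat \<Rightarrow> 'g pmf" where
  "convolution_power G \<mu> 0 = return_pmf \<one>\<^bsub>G\<^esub>"
| "convolution_power G \<mu> (Suc n) = convolution_pmf G (convolution_power G \<mu> n) \<mu>"

definition asymptotic_entropy :: "('g, 'b) monoid_scheme \<Rightarrow> 'g pmf \<Rightarrow> real" where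
  "asymptotic_entropy G \<mu> = lim (\<lambda>n. shannon_entropy G (convolution_power G \<mu> n) / real n)"

inductive_set generated_semigroup :: "('g, 'b) monoid_scheme \<Rightarrow> 'g set \<Rightarrow> 'g set"
  for G :: "('g, 'b) monoid_scheme" and S :: "'g set" where
  incl: "s \<in> S \<Longrightarrow> s \<in> generated_semigroup G S"
| mult: "s \<in> generated_semigroup G S \<Longrightarrow> t \<in> generated_semigroup G S \<Longrightarrow>
    s \<otimes>\<^bsub>G\<^esub> t \<in> generated_semigroup G S"

definition nondegenerate :: "('g, 'b) monoid_scheme \<Rightarrow> 'g pmf \<Rightarrow> bool" where
  "nondegenerate G \<mu> \<longleftrightarrow> generated_semigroup G (set_pmf \<mu>) = carrier G"

subsection \<open>Continuous actions, stationarity, weak convergence\<close>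

definition continuous_action ::
    "('g, 'b) monoid_scheme \<Rightarrow> ('g \<Rightarrow> 'x::topological_space \<Rightarrow> 'x) \<Rightarrow> bool" where
  "continuous_action G act \<longleftrightarrow>
     group_action G UNIV act \<and> (\<forall>g\<in>carrier G. continuous_on UNIV (act g))"

definition borel_probability :: "'x::topological_space measure \<Rightarrow> bool" where
  "borel_probability \<nu> \<longleftrightarrow> prob_space \<nu> \<and> sets \<nu> = sets borel"

definition stationary ::
    "('g, 'b) monoid_scheme \<Rightarrow> ('g \<Rightarrow> 'x::topological_space \<Rightarrow> 'x) \<Rightarrow> 'g pmf \<Rightarrow> 'x measure \<Rightarrow> bool" where
  "stationary G act \<mu> \<nu> \<longleftrightarrow>
     (\<forall>B\<in>sets borel. measure \<nu> B =
        (\<Sum>\<^sub>\<infinity>g\<in>carrier G. pmf \<mu> g * measure (distr \<nu> borel (act g)) B))"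

definition weakly_converges :: "(nat \<Rightarrow> 'x::topological_space measure) \<Rightarrow> 'x measure \<Rightarrow> bool" where
  "weakly_converges \<nu>s \<nu> \<longleftrightarrow>
     (\<forall>f :: 'x \<Rightarrow> real. continuous_on UNIV f \<and> bounded (range f) \<longrightarrow>
        (\<lambda>k. \<integral>x. f x \<partial>\<nu>s k) \<longlonglongrightarrow> (\<integral>x. f x \<partial>\<nu>))"

subsection \<open>Random walk and Poisson boundary\<close>

definition path_space :: "('g, 'b) monoid_scheme \<Rightarrow> (nat \<Rightarrow> 'g) measure" where
  "path_space G = (\<Pi>\<^sub>M n\<in>UNIV. count_space (carrier G))"

text \<open>The increment \<open>g\<^sub>i\<close> is \<open>x (i - 1)\<close>, and the walk starts at \<open>w\<^sub>0 = \<one>\<close>.\<close>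

primrec walk :: "('g, 'b) monoid_scheme \<Rightarrow> (nat \<Rightarrow> 'g) \<Rightarrow> nat \<Rightarrow> 'g" where
  "walk G x 0 = \<one>\<^bsub>G\<^esub>"
| "walk G x (Suc n) = walk G x n \<otimes>\<^bsub>G\<^esub> x n"

text \<open>
  The restriction to \<open>carrier G\<close> loses no mass; it is needed because the type of group elements
  may be uncountable, in which case \<open>walk G\<close> need not be measurable on all sequences of that type.
\<close>

definition path_measure :: "('g, 'b) monoid_scheme \<Rightarrow> 'g pmf \<Rightarrow> (nat \<Rightarrow> 'g) measure" where
  "path_measure G \<mu> =
     distr (\<Pi>\<^sub>M i\<in>UNIV. restrict_space (measure_pmf \<mu>) (carrier G)) (path_space G) (walk G)"

text \<open>The second disjunct makes the relation symmetric; the result is an equivalence relation.\<close>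

definition path_equiv :: "(nat \<Rightarrow> 'g) \<Rightarrow> (nat \<Rightarrow> 'g) \<Rightarrow> bool" where
  "path_equiv w w' \<longleftrightarrow>
     (\<exists>p N. \<forall>n>N. w n = w' (n + p)) \<or> (\<exists>p N. \<forall>n>N. w' n = w (n + p))"

definition boundary_sets :: "('g, 'b) monoid_scheme \<Rightarrow> 'g pmf \<Rightarrow> (nat \<Rightarrow> 'g) set set" where
  "boundary_sets G \<mu> = {A \<in> sets (path_space G). \<exists>U\<in>sets (path_space G).
     (\<forall>w\<in>U. \<forall>w'\<in>space (path_space G). path_equiv w w' \<longrightarrow> w' \<in> U) \<and>
     (AE w in path_measure G \<mu>. w \<in> A \<longleftrightarrow> w \<in> U)}"

text \<open>
  The quotient of a probability space by a \<open>\<sigma>\<close>-algebra of measurable sets is understood, as usual,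
  as a standard measure space together with a projection onto it that carries the measure to the
  measure and pulls the measurable sets back to the given \<open>\<sigma>\<close>-algebra, modulo null sets.  Hence
  \<open>(X, \<nu>)\<close> is isomorphic to the quotient of the path space by \<open>boundary_sets\<close>, as a measured
  \<open>G\<close>-space, iff the path space has a projection \<open>bnd\<close> of this kind to \<open>X\<close> that intertwines the
  action \<open>(g w)\<^sub>n = g w\<^sub>n\<close> on paths with the action on \<open>X\<close>.

  Requiring \<open>bnd\<close> to be constant on equivalence classes everywhere, not just almost everywhere, is a
  choice of version.  It is what makes the equivariance condition meaningful: translates of
  the path measure are singular to the path measure, so \<open>bnd (g w)\<close> would otherwise depend on
  the values of \<open>bnd\<close> on a null set.
\<close>

definition poisson_boundary ::
    "('g, 'b) monoid_scheme \<Rightarrow> ('g \<Rightarrow> 'x::topological_space \<Rightarrow> 'x) \<Rightarrow> 'g pmf \<Rightarrow> 'x measure \<Rightarrow> bool" where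
  "poisson_boundary G act \<mu> \<nu> \<longleftrightarrow>
     (\<exists>bnd \<in> path_space G \<rightarrow>\<^sub>M borel.
        (\<forall>w\<in>space (path_space G). \<forall>w'\<in>space (path_space G). path_equiv w w' \<longrightarrow> bnd w = bnd w') \<and>
        distr (path_measure G \<mu>) borel bnd = \<nu> \<and>
        (\<forall>A\<in>boundary_sets G \<mu>. \<exists>B\<in>sets borel.
           AE w in path_measure G \<mu>. w \<in> A \<longleftrightarrow> bnd w \<in> B) \<and>
        (\<forall>g\<in>carrier G. AE w in path_measure G \<mu>. bnd (\<lambda>n. g \<otimes>\<^bsub>G\<^esub> w n) = act g (bnd w)))"

end

theory Submission
  imports Defs "HOL-Complex_Analysis.Great_Picard"
begin

text \<open>
  Write \<open>h\<close> for asymptotic entropy, \<open>H\<close> for Shannon entropy and \<open>KL\<close> for relative entropy.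

  Upper semicontinuity of \<open>h\<close> is a matter of convolution powers.  Subadditivity gives
  \<open>h(\<mu>) = inf H(\<mu>\<^sup>n) / n\<close>, and each \<open>H(\<mu>\<^sup>n)\<close> is continuous along the sequence, because the entropy of
  an image measure is dominated by the entropy of the original one
  (\<open>pmf_entropy_map_tendsto\<close>).

  Lower semicontinuity comes from writing \<open>h\<close> as a supremum of quantities that are weakly
  continuous in \<open>\<nu>\<close>.  For a group element \<open>g\<close> and a bounded continuous \<open>\<psi>\<close> on \<open>X\<close>, the gain
  \<open>J(g, \<psi>, \<nu>) = \<integral>\<psi> d(g\<nu>) - \<integral>exp \<psi> d\<nu> + 1\<close> is a Donsker-Varadhan lower bound for \<open>KL(g\<nu> | \<nu>)\<close>.
  Two facts are needed.

  \<^item> If \<open>\<nu>\<close> is \<open>\<mu>\<close>-stationary, then \<open>\<Sum>g\<in>S. \<mu>(g) J(g, \<psi>\<^sub>g, \<nu>) \<le> h(\<mu>)\<close> for every finite \<open>S\<close>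
    (\<open>sum_boundary_gain_le_asymptotic_entropy\<close>).  The kernel \<open>y \<mapsto> y\<nu>\<close> carries \<open>g\<mu>\<^sup>n\<close> to \<open>g\<nu>\<close> and
    \<open>\<mu>\<^sup>n\<^sup>+\<^sup>1\<close> to \<open>\<nu>\<close>, so by Jensen's inequality the gain is at most \<open>KL(g\<mu>\<^sup>n | \<mu>\<^sup>n\<^sup>+\<^sup>1)\<close>, and the
    \<open>\<mu>\<close>-average of the latter is \<open>H(\<mu>\<^sup>n\<^sup>+\<^sup>1) - H(\<mu>\<^sup>n)\<close>.  Summation over \<open>n\<close> yields the bound.

  \<^item> If \<open>(X, \<nu>)\<close> is the Poisson boundary, these sums come arbitrarily close to \<open>h(\<mu>)\<close>
    (\<open>asymptotic_entropy_le_sum_boundary_gain\<close>).  Averages \<open>m\<close> of \<open>n\<close> consecutive convolution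
    powers are almost invariant, and for a suitable position of the window
    \<open>H(\<mu> * m) - H(m)\<close>, the \<open>\<mu>\<close>-average of \<open>KL(gm | \<mu> * m)\<close>, is almost \<open>h(\<mu>)\<close>.  With \<open>T\<close> the truncated
    logarithm of the density of \<open>gm\<close> with respect to \<open>\<mu> * m\<close>, the functions \<open>\<gamma> \<mapsto> \<integral>T d(\<gamma>m)\<close> and \<open>\<gamma> \<mapsto> \<integral>exp T d(\<gamma>m)\<close>
    are almost harmonic.  Subsequential limits \<open>u\<close> and \<open>v\<close> are harmonic and satisfy \<open>exp u \<le> v\<close>.
    The boundary function \<open>\<Psi>\<close> that represents \<open>u\<close> satisfies \<open>\<integral>exp \<Psi> d\<nu> \<le> v(1)\<close>, so its gain at \<open>g\<close>
    is at least \<open>u(g) - v(1) + 1\<close>, which is at least the limit of \<open>KL(gm | \<mu> * m)\<close> up to the truncation error.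
    The average over times is what makes these limits harmonic: a limit taken with \<open>\<mu>\<^sup>n\<close> itself would only be
    space-time harmonic.

  Weak convergence passes to the gains of a fixed finite family, which bounds \<open>liminf h(\<mu>\<^sub>k)\<close> from
  below by \<open>h(\<mu>) - \<epsilon>\<close>.  In the compact case every weak limit point of \<open>\<nu>\<^sub>k\<close> is \<open>\<mu>\<close>-stationary, hence
  equal to \<open>\<nu>\<close>, so weak convergence is automatic.  Sequential weak compactness is reduced to Helly's
  theorem on the line by a Cantor coding of \<open>X\<close>.
\<close>

section \<open>Expectations with respect to discrete distributions\<close>

text \<open>
  Dominated convergence with dominating functions that vary with \<open>k\<close>: apply Fatou's lemma to the
  nonnegative functions \<open>D k + F k\<close> and \<open>D k - F k\<close>, whose first summands have convergent integrals.
\<close>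

lemma convergent_dominated_integrals:
  fixes F :: "nat \<Rightarrow> 'a \<Rightarrow> real"
  assumes D: "\<And>k. integrable M (D k)" "integrable M D'"
    and F: "\<And>k. F k \<in> borel_measurable M" "F' \<in> borel_measurable M"
    and dom: "\<And>k x. x \<in> space M \<Longrightarrow> \<bar>F k x\<bar> \<le> D k x"
    and D_lim: "\<And>x. x \<in> space M \<Longrightarrow> (\<lambda>k. D k x) \<longlonglongrightarrow> D' x"
    and F_lim: "\<And>x. x \<in> space M \<Longrightarrow> (\<lambda>k. F k x) \<longlonglongrightarrow> F' x"
    and int_lim: "(\<lambda>k. \<integral>x. D k x \<partial>M) \<longlonglongrightarrow> (\<integral>x. D' x \<partial>M)"
  shows "integrable M F'" "(\<lambda>k. \<integral>x. F k x \<partial>M) \<longlonglongrightarrow> (\<integral>x. F' x \<partial>M)"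
proof -
  have [measurable]: "\<And>k. D k \<in> borel_measurable M" "D' \<in> borel_measurable M" "\<And>k. F k \<in> borel_measurable M"
      "F' \<in> borel_measurable M"
    using D F by auto
  have dom': "\<bar>F' x\<bar> \<le> D' x" if "x \<in> space M" for x
    using dom[OF that] by (intro LIMSEQ_le[OF tendsto_rabs[OF F_lim] D_lim] that) auto
  have Fk: "integrable M (F k)" for k
    by (rule Bochner_Integration.integrable_bound[OF D(1)[of k]]) (use dom in \<open>auto intro!: AE_I2 order_trans[OF dom]\<close>)
  show F': "integrable M F'"
    by (rule Bochner_Integration.integrable_bound[OF D(2)]) (use dom' in \<open>auto intro!: AE_I2 order_trans[OF dom']\<close>)
  have fatou: "eventually (\<lambda>k. c < (\<integral>x. D k x + s * F k x \<partial>M)) sequentially"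
    if s: "s = 1 \<or> s = -1" and c: "c < (\<integral>x. D' x + s * F' x \<partial>M)" for s c :: real
  proof -
    have "(\<integral>\<^sup>+x. ennreal (D' x + s * F' x) \<partial>M) = (\<integral>\<^sup>+x. liminf (\<lambda>k. ennreal (D k x + s * F k x)) \<partial>M)"
      by (intro nn_integral_cong lim_imp_Liminf[symmetric] tendsto_ennrealI tendsto_intros D_lim F_lim) auto
    also have "\<dots> \<le> liminf (\<lambda>k. \<integral>\<^sup>+x. ennreal (D k x + s * F k x) \<partial>M)"
      by (intro nn_integral_liminf) auto
    also have "(\<lambda>k. \<integral>\<^sup>+x. ennreal (D k x + s * F k x) \<partial>M) = (\<lambda>k. ennreal (\<integral>x. D k x + s * F k x \<partial>M))"
      using s dom by (intro ext nn_integral_eq_integral) (auto intro!: D Fk AE_I2 simp: abs_le_iff dest!: dom)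
    finally have "(\<integral>\<^sup>+x. ennreal (D' x + s * F' x) \<partial>M) \<le> liminf (\<lambda>k. ennreal (\<integral>x. D k x + s * F k x \<partial>M))" .
    also have "(\<integral>\<^sup>+x. ennreal (D' x + s * F' x) \<partial>M) = ennreal (\<integral>x. D' x + s * F' x \<partial>M)"
      using s dom' by (intro nn_integral_eq_integral) (auto intro!: D F' AE_I2 simp: abs_le_iff dest!: dom')
    finally have *: "ennreal (\<integral>x. D' x + s * F' x \<partial>M) \<le> liminf (\<lambda>k. ennreal (\<integral>x. D k x + s * F k x \<partial>M))" .
    have nn: "0 \<le> (\<integral>x. D k x + s * F k x \<partial>M)" for k
      using s dom by (intro integral_nonneg_AE) (auto intro!: AE_I2 simp: abs_le_iff dest!: dom)
    show ?thesis
    proof (cases "c < 0")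
      case True
      then show ?thesis using nn by (intro always_eventually allI less_le_trans[OF True])
    next
      case False
      then have "ennreal c < ennreal (\<integral>x. D' x + s * F' x \<partial>M)"
        using c by (simp add: ennreal_less_iff)
      then have "eventually (\<lambda>k. ennreal c < ennreal (\<integral>x. D k x + s * F k x \<partial>M)) sequentially"
        using * by (intro less_LiminfD) (rule less_le_trans)
      then show ?thesis using False by (simp add: ennreal_less_iff)
    qed
  qed
  have sum_eq: "(\<integral>x. D k x + s * F k x \<partial>M) = (\<integral>x. D k x \<partial>M) + s * (\<integral>x. F k x \<partial>M)" for k s
    by (simp add: D Fk)
  have sum_eq': "(\<integral>x. D' x + s * F' x \<partial>M) = (\<integral>x. D' x \<partial>M) + s * (\<integral>x. F' x \<partial>M)" for s
    by (simp add: D F')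
  show "(\<lambda>k. \<integral>x. F k x \<partial>M) \<longlonglongrightarrow> (\<integral>x. F' x \<partial>M)"
  proof (rule order_tendstoI)
    fix a assume a: "a < (\<integral>x. F' x \<partial>M)"
    define e where "e = ((\<integral>x. F' x \<partial>M) - a) / 2"
    have e: "e > 0" using a by (simp add: e_def)
    have "eventually (\<lambda>k. (\<integral>x. D' x \<partial>M) + (\<integral>x. F' x \<partial>M) - e < (\<integral>x. D k x + 1 * F k x \<partial>M)) sequentially"
      using e by (intro fatou) (simp_all only: sum_eq', auto)
    moreover have "eventually (\<lambda>k. (\<integral>x. D k x \<partial>M) < (\<integral>x. D' x \<partial>M) + e) sequentially"
      using order_tendstoD(2)[OF int_lim, of "(\<integral>x. D' x \<partial>M) + e"] e by simp
    ultimately show "eventually (\<lambda>k. a < (\<integral>x. F k x \<partial>M)) sequentially"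
      by eventually_elim (simp only: sum_eq, simp add: e_def field_simps)
  next
    fix a assume a: "a > (\<integral>x. F' x \<partial>M)"
    define e where "e = (a - (\<integral>x. F' x \<partial>M)) / 2"
    have e: "e > 0" using a by (simp add: e_def)
    have "eventually (\<lambda>k. (\<integral>x. D' x \<partial>M) - (\<integral>x. F' x \<partial>M) - e < (\<integral>x. D k x + (-1) * F k x \<partial>M)) sequentially"
      using e by (intro fatou) (simp_all only: sum_eq', auto)
    moreover have "eventually (\<lambda>k. (\<integral>x. D k x \<partial>M) < (\<integral>x. D' x \<partial>M) + e) sequentially"
      using order_tendstoD(2)[OF int_lim, of "(\<integral>x. D' x \<partial>M) + e"] e by simp
    ultimately show "eventually (\<lambda>k. (\<integral>x. F k x \<partial>M) < a) sequentially"
      by eventually_elim (simp only: sum_eq, simp add: e_def field_simps)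
  qed
qed

abbreviation expect :: "'a pmf \<Rightarrow> ('a \<Rightarrow> real) \<Rightarrow> real" where
  "expect p f \<equiv> measure_pmf.expectation p f"

lemma expectation_pmf_count_space:
  "expect p f = (\<integral>x. pmf p x * f x \<partial>count_space UNIV)" for f :: "'a \<Rightarrow> real"
  unfolding measure_pmf_eq_density by (subst integral_density) auto

lemma integrable_pmf_count_space:
  "integrable (measure_pmf p) f \<longleftrightarrow> integrable (count_space UNIV) (\<lambda>x. pmf p x * f x)" for f :: "'a \<Rightarrow> real"
  unfolding measure_pmf_eq_density by (subst integrable_density) auto

lemma integrable_pmf_bounded:
  fixes f :: "'a \<Rightarrow> real"
  assumes "\<And>x. x \<in> set_pmf p \<Longrightarrow> \<bar>f x\<bar> \<le> B"
  shows "integrable (measure_pmf p) f"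
  by (rule measure_pmf.integrable_const_bound[where B=B]) (use assms in \<open>auto simp: AE_measure_pmf_iff\<close>)

lemma expectation_pmf_mono:
  fixes f g :: "'a \<Rightarrow> real"
  assumes "integrable (measure_pmf p) f" "integrable (measure_pmf p) g" "\<And>x. x \<in> set_pmf p \<Longrightarrow> f x \<le> g x"
  shows "expect p f \<le> expect p g"
  by (rule integral_mono_AE) (use assms in \<open>auto simp: AE_measure_pmf_iff\<close>)

lemma abs_expectation_pmf_le:
  fixes f :: "'a \<Rightarrow> real"
  assumes "\<And>x. x \<in> set_pmf p \<Longrightarrow> \<bar>f x\<bar> \<le> B"
  shows "\<bar>expect p f\<bar> \<le> B"
proof -
  obtain x where "x \<in> set_pmf p" using set_pmf_not_empty by fast
  with assms have "0 \<le> B" using abs_ge_zero order_trans by blast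
  have "\<bar>expect p f\<bar> \<le> expect p (\<lambda>x. \<bar>f x\<bar>)"
    by (rule integral_abs_bound)
  also have "\<dots> \<le> expect p (\<lambda>x. B)"
    using assms \<open>0 \<le> B\<close> by (intro expectation_pmf_mono integrable_pmf_bounded[where B=B]) auto
  finally show ?thesis by simp
qed

lemma expectation_bind_pmf:
  fixes f :: "'b \<Rightarrow> real"
  assumes "\<And>a x. a \<in> set_pmf A \<Longrightarrow> x \<in> set_pmf (K a) \<Longrightarrow> \<bar>f x\<bar> \<le> B"
  shows "expect (bind_pmf A K) f = expect A (\<lambda>a. expect (K a) f)"
proof -
  obtain a where a: "a \<in> set_pmf A" using set_pmf_not_empty by fast
  obtain x where "x \<in> set_pmf (K a)" using set_pmf_not_empty by fast
  with a assms have B: "0 \<le> B" using abs_ge_zero order_trans by blast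
  define g where "g x = max (-B) (min B (f x)) + B" for x
  have g: "0 \<le> g x" "g x \<le> 2 * B" for x using B by (auto simp: g_def)
  have fg: "f x = g x - B" if "a \<in> set_pmf A" "x \<in> set_pmf (K a)" for a x
    using assms[OF that] by (auto simp: g_def)
  have ig: "integrable (measure_pmf p) g" for p
    using g B by (intro integrable_pmf_bounded[where B="2*B"]) auto
  have Eg: "0 \<le> expect p g" "expect p g \<le> 2 * B" for p
    using g B abs_expectation_pmf_le[of p g "2*B"] by (auto intro!: integral_nonneg_AE)
  have iE: "integrable (measure_pmf A) (\<lambda>a. expect (K a) g)"
    using Eg B by (intro integrable_pmf_bounded[where B="2*B"]) auto
  have "ennreal (expect (bind_pmf A K) g) = (\<integral>\<^sup>+x. ennreal (g x) \<partial>bind_pmf A K)"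
    using g by (intro nn_integral_eq_integral[symmetric] ig) auto
  also have "\<dots> = (\<integral>\<^sup>+a. ennreal (expect (K a) g) \<partial>A)"
    using g by (simp add: nn_integral_eq_integral ig)
  also have "\<dots> = ennreal (expect A (\<lambda>a. expect (K a) g))"
    using Eg by (intro nn_integral_eq_integral iE) auto
  finally have *: "expect (bind_pmf A K) g = expect A (\<lambda>a. expect (K a) g)"
    using Eg by (subst (asm) ennreal_inj) (auto intro!: integral_nonneg_AE)
  have "expect (bind_pmf A K) f = expect (bind_pmf A K) (\<lambda>x. g x - B)"
    using fg by (intro integral_cong_AE) (auto simp: AE_measure_pmf_iff)
  also have "\<dots> = expect A (\<lambda>a. expect (K a) g) - B"
    using * ig by simp
  also have "\<dots> = expect A (\<lambda>a. expect (K a) g - B)"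
    using iE by simp
  also have "\<dots> = expect A (\<lambda>a. expect (K a) (\<lambda>x. g x - B))"
    using ig by simp
  also have "\<dots> = expect A (\<lambda>a. expect (K a) f)"
    using fg by (intro integral_cong_AE) (auto simp: AE_measure_pmf_iff intro!: integral_cong_AE)
  finally show ?thesis .
qed

section \<open>Shannon entropy\<close>

text \<open>
  Entropy as the expected information content: in this form it behaves well under images, products
  and mixtures.
\<close>

definition pmf_entropy :: "'a pmf \<Rightarrow> real" where
  "pmf_entropy p = expect p (\<lambda>x. - ln (pmf p x))"

definition pmf_finite_entropy :: "'a pmf \<Rightarrow> bool" where
  "pmf_finite_entropy p \<longleftrightarrow> integrable (measure_pmf p) (\<lambda>x. - ln (pmf p x))"

lemma neg_ln_pmf_nonneg: "0 \<le> - ln (pmf p x)"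
  by (cases "pmf p x = 0") (auto simp: pmf_le_1 less_le)

lemma pmf_entropy_nonneg: "0 \<le> pmf_entropy p"
  unfolding pmf_entropy_def by (intro integral_nonneg_AE AE_I2 neg_ln_pmf_nonneg)

lemma
  assumes "set_pmf p \<subseteq> carrier G"
  shows finite_entropy_iff: "finite_entropy G p \<longleftrightarrow> pmf_finite_entropy p"
    and shannon_entropy_eq: "shannon_entropy G p = pmf_entropy p"
proof -
  let ?f = "\<lambda>g. - (pmf p g * ln (pmf p g))"
  have nn: "0 \<le> ?f g" for g
    using mult_nonneg_nonneg[OF pmf_nonneg[of p g] neg_ln_pmf_nonneg[of p g]] by simp
  have out: "?f g = 0" if "g \<notin> carrier G" for g
    using that assms by (auto simp: pmf_eq_0_set_pmf subset_iff)
  have "finite_entropy G p \<longleftrightarrow> ?f summable_on UNIV"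
    unfolding finite_entropy_def using out by (intro summable_on_cong_neutral) auto
  also have "\<dots> \<longleftrightarrow> Infinite_Sum.abs_summable_on ?f UNIV"
    by (rule summable_on_iff_abs_summable_on_real)
  finally have A: "finite_entropy G p \<longleftrightarrow> Infinite_Sum.abs_summable_on ?f UNIV" .
  then show B: "finite_entropy G p \<longleftrightarrow> pmf_finite_entropy p"
    unfolding abs_summable_equivalent abs_summable_on_def pmf_finite_entropy_def
    by (subst integrable_pmf_count_space) simp
  have C: "shannon_entropy G p = infsum ?f UNIV"
    unfolding shannon_entropy_def using out by (intro infsum_cong_neutral) auto
  have D: "pmf_entropy p = (\<integral>x. ?f x \<partial>count_space UNIV)"
    unfolding pmf_entropy_def by (subst expectation_pmf_count_space) simp
  show "shannon_entropy G p = pmf_entropy p"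
  proof (cases "finite_entropy G p")
    case True
    show ?thesis
      unfolding C D infsetsum_def[symmetric] by (rule infsetsum_infsum[OF True[unfolded A abs_summable_equivalent], symmetric])
  next
    case False
    have "\<not> ?f summable_on UNIV"
    proof
      assume "?f summable_on UNIV"
      from iffD1[OF summable_on_iff_abs_summable_on_real this] show False
        by (rule False[unfolded A, THEN notE])
    qed
    moreover have "\<not> integrable (count_space UNIV) ?f"
      by (rule False[unfolded A abs_summable_equivalent abs_summable_on_def])
    ultimately show ?thesis
      unfolding C D by (simp add: infsum_not_exists not_integrable_integral_eq)
  qed
qed

lemma pmf_le_pmf_map: "pmf p x \<le> pmf (map_pmf f p) (f x)"
proof -
  have "pmf p x = measure (measure_pmf p) {x}" by (simp add: pmf.rep_eq)
  also have "\<dots> \<le> measure (measure_pmf p) (f -` {f x})"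
    by (intro measure_pmf.finite_measure_mono) auto
  finally show ?thesis by (simp add: pmf_map)
qed

lemma neg_ln_pmf_map_le:
  assumes "x \<in> set_pmf p"
  shows "- ln (pmf (map_pmf f p) (f x)) \<le> - ln (pmf p x)"
  using assms pmf_le_pmf_map[of p x f] pmf_positive[OF assms] by (simp add: ln_le_cancel_iff)

lemma
  assumes "pmf_finite_entropy p"
  shows pmf_finite_entropy_map: "pmf_finite_entropy (map_pmf f p)"
    and pmf_entropy_map_le: "pmf_entropy (map_pmf f p) \<le> pmf_entropy p"
proof -
  have 1: "integrable (measure_pmf p) (\<lambda>x. - ln (pmf (map_pmf f p) (f x)))"
    by (rule Bochner_Integration.integrable_bound[OF assms[unfolded pmf_finite_entropy_def]])
      (use neg_ln_pmf_map_le in \<open>auto simp: AE_measure_pmf_iff abs_of_nonpos neg_ln_pmf_nonneg[simplified]\<close>)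
  then show "pmf_finite_entropy (map_pmf f p)"
    unfolding pmf_finite_entropy_def by (simp add: integrable_map_pmf_eq)
  show "pmf_entropy (map_pmf f p) \<le> pmf_entropy p"
    unfolding pmf_entropy_def integral_map_pmf
    using 1 assms[unfolded pmf_finite_entropy_def] neg_ln_pmf_map_le by (intro expectation_pmf_mono) auto
qed

lemma
  assumes "inj_on f (set_pmf p)"
  shows pmf_finite_entropy_map_inj: "pmf_finite_entropy (map_pmf f p) \<longleftrightarrow> pmf_finite_entropy p"
    and pmf_entropy_map_inj: "pmf_entropy (map_pmf f p) = pmf_entropy p"
proof -
  have eq: "pmf (map_pmf f p) (f x) = pmf p x" if "x \<in> set_pmf p" for x
    using pmf_map_inj[OF assms that] .
  show "pmf_finite_entropy (map_pmf f p) \<longleftrightarrow> pmf_finite_entropy p"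
    unfolding pmf_finite_entropy_def integrable_map_pmf_eq
    using eq by (intro integrable_cong_AE) (auto simp: AE_measure_pmf_iff)
  show "pmf_entropy (map_pmf f p) = pmf_entropy p"
    unfolding pmf_entropy_def integral_map_pmf
    using eq by (intro integral_cong_AE) (auto simp: AE_measure_pmf_iff)
qed

lemma
  assumes p: "pmf_finite_entropy p" and q: "pmf_finite_entropy q"
  shows pmf_finite_entropy_pair: "pmf_finite_entropy (pair_pmf p q)"
    and pmf_entropy_pair: "pmf_entropy (pair_pmf p q) = pmf_entropy p + pmf_entropy q"
proof -
  let ?P = "measure_pmf (pair_pmf p q)"
  have 1: "integrable ?P (\<lambda>x. - ln (pmf p (fst x)))"
    using p unfolding pmf_finite_entropy_def by (subst integrable_map_pmf_eq[symmetric, where f=fst and g="\<lambda>x. - ln (pmf p x)"]) (simp only: map_fst_pair_pmf)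
  have 2: "integrable ?P (\<lambda>x. - ln (pmf q (snd x)))"
    using q unfolding pmf_finite_entropy_def by (subst integrable_map_pmf_eq[symmetric, where f=snd and g="\<lambda>x. - ln (pmf q x)"]) (simp only: map_snd_pair_pmf)
  have eq: "- ln (pmf (pair_pmf p q) x) = - ln (pmf p (fst x)) + - ln (pmf q (snd x))" if "x \<in> set_pmf (pair_pmf p q)" for x
    using that by (cases x) (auto simp: pmf_pair ln_mult_pos pmf_positive)
  have AE: "AE x in ?P. - ln (pmf (pair_pmf p q) x) = - ln (pmf p (fst x)) + - ln (pmf q (snd x))"
    using eq unfolding AE_measure_pmf_iff by blast
  show "pmf_finite_entropy (pair_pmf p q)"
    unfolding pmf_finite_entropy_def
    using Bochner_Integration.integrable_add[OF 1 2] by (subst integrable_cong_AE[OF _ _ AE]) auto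
  have "pmf_entropy (pair_pmf p q) = expect (pair_pmf p q) (\<lambda>x. - ln (pmf p (fst x)) + - ln (pmf q (snd x)))"
    unfolding pmf_entropy_def by (rule integral_cong_AE[OF _ _ AE]) auto
  also have "\<dots> = pmf_entropy p + pmf_entropy q"
    unfolding pmf_entropy_def
    by (subst Bochner_Integration.integral_add[OF 1 2], subst expectation_pair_pmf_fst, subst expectation_pair_pmf_snd) simp
  finally show "pmf_entropy (pair_pmf p q) = pmf_entropy p + pmf_entropy q" .
qed

lemma tendsto_neg_xlnx:
  fixes a :: "nat \<Rightarrow> real"
  assumes "a \<longlonglongrightarrow> b" "\<And>k. 0 \<le> a k"
  shows "(\<lambda>k. - (a k * ln (a k))) \<longlonglongrightarrow> - (b * ln b)"
proof (cases "b = 0")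
  case False
  then show ?thesis using assms by (intro tendsto_intros) auto
next
  case True
  have "((\<lambda>x::real. x * ln x) \<longlongrightarrow> 0) (at_right 0)" by real_asymp
  then have *: "((\<lambda>x::real. x * ln x) \<longlongrightarrow> 0) (at 0 within {0<..})" by simp
  have "continuous (at 0 within {0..}) (\<lambda>x::real. x * ln x)"
    unfolding continuous_within using *
    by (auto simp: Lim_within) (metis greaterThan_iff)
  then have "(\<lambda>k. a k * ln (a k)) \<longlonglongrightarrow> 0 * ln 0"
    using assms True by (intro continuous_within_tendsto_compose[of 0 "{0..}" "\<lambda>x. x * ln x"]) auto
  from tendsto_minus[OF this] True show ?thesis by simp
qed

text \<open>
  Pointwise convergence of the weights is enough, since their limit again has total mass one; the
  weights themselves serve as varying dominating functions.
\<close>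

lemma expectation_pmf_tendsto:
  fixes f :: "nat \<Rightarrow> 'a \<Rightarrow> real"
  assumes p: "\<And>x. (\<lambda>k. pmf (p k) x) \<longlonglongrightarrow> pmf q x"
    and f: "\<And>x. x \<in> set_pmf q \<Longrightarrow> (\<lambda>k. f k x) \<longlonglongrightarrow> f' x" and B: "\<And>k x. \<bar>f k x\<bar> \<le> B"
  shows "(\<lambda>k. expect (p k) (f k)) \<longlonglongrightarrow> expect q f'"
  unfolding expectation_pmf_count_space
proof (rule convergent_dominated_integrals(2)[where D="\<lambda>k x. B * pmf (p k) x" and D'="\<lambda>x. B * pmf q x"])
  show "\<bar>pmf (p k) x * f k x\<bar> \<le> B * pmf (p k) x" for k x
    using mult_right_mono[OF B[of k x] pmf_nonneg[of "p k" x]] by (simp add: abs_mult mult.commute)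
  show "(\<lambda>k. pmf (p k) x * f k x) \<longlonglongrightarrow> pmf q x * f' x" for x
  proof (cases "x \<in> set_pmf q")
    case True
    then show ?thesis by (intro tendsto_intros p f)
  next
    case False
    then have q0: "pmf q x = 0" by (simp add: set_pmf_iff)
    have "(\<lambda>k. \<bar>pmf (p k) x * f k x\<bar>) \<longlonglongrightarrow> 0"
    proof (rule tendsto_sandwich[OF _ _ tendsto_const])
      show "(\<lambda>k. B * pmf (p k) x) \<longlonglongrightarrow> 0"
        using tendsto_mult_left[OF p[of x], of B] q0 by simp
      show "\<forall>\<^sub>F k in sequentially. \<bar>pmf (p k) x * f k x\<bar> \<le> B * pmf (p k) x"
        by (intro always_eventually allI, subst mult.commute) (simp add: abs_mult mult_right_mono[OF B pmf_nonneg])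
    qed auto
    then show ?thesis unfolding q0 by (simp add: tendsto_rabs_zero_iff)
  qed
qed (auto intro!: tendsto_intros p integrable_pmf simp: integral_pmf)

lemma pmf_map_tendsto:
  assumes "\<And>x. (\<lambda>k. pmf (p k) x) \<longlonglongrightarrow> pmf q x"
  shows "(\<lambda>k. pmf (map_pmf f (p k)) y) \<longlonglongrightarrow> pmf (map_pmf f q) y"
proof -
  have "pmf (map_pmf f r) y = expect r (indicator (f -` {y}))" for r
    by (simp add: pmf_map)
  then show ?thesis
    using expectation_pmf_tendsto[of p q "\<lambda>_. indicator (f -` {y})" "indicator (f -` {y})" 1, OF assms]
    by (simp add: indicator_def)
qed

text \<open>
  The information content of \<open>f x\<close> under the image measure never exceeds that of \<open>x\<close>, so the summands
  of the entropy of the image are dominated by the summands of the entropy of \<open>p k\<close>, whose sums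
  converge by assumption.  Applied to the multiplication map this gives continuity of the entropy of convolutions.
\<close>

lemma pmf_entropy_map_tendsto:
  assumes p: "\<And>x. (\<lambda>k. pmf (p k) x) \<longlonglongrightarrow> pmf q x"
    and fin: "\<And>k. pmf_finite_entropy (p k)" "pmf_finite_entropy q"
    and H: "(\<lambda>k. pmf_entropy (p k)) \<longlonglongrightarrow> pmf_entropy q"
  shows "(\<lambda>k. pmf_entropy (map_pmf f (p k))) \<longlonglongrightarrow> pmf_entropy (map_pmf f q)"
  unfolding pmf_entropy_def integral_map_pmf
  unfolding expectation_pmf_count_space[of "p _"] expectation_pmf_count_space[of q]
proof (rule convergent_dominated_integrals(2)[where D="\<lambda>k x. pmf (p k) x * - ln (pmf (p k) x)" and D'="\<lambda>x. pmf q x * - ln (pmf q x)"])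
  show dom: "\<bar>pmf (p k) x * - ln (pmf (map_pmf f (p k)) (f x))\<bar> \<le> pmf (p k) x * - ln (pmf (p k) x)" for k x
  proof (cases "x \<in> set_pmf (p k)")
    case True
    then show ?thesis
      using neg_ln_pmf_map_le[OF True, of f] neg_ln_pmf_nonneg[of "map_pmf f (p k)" "f x"] 
      by (subst abs_of_nonneg) (auto intro!: mult_left_mono mult_nonneg_nonpos)
  qed (simp add: set_pmf_iff)
  show D_lim: "(\<lambda>k. pmf (p k) x * - ln (pmf (p k) x)) \<longlonglongrightarrow> pmf q x * - ln (pmf q x)" for x
    using tendsto_neg_xlnx[OF p[of x]] by simp
  show "(\<lambda>k. pmf (p k) x * - ln (pmf (map_pmf f (p k)) (f x))) \<longlonglongrightarrow> pmf q x * - ln (pmf (map_pmf f q) (f x))" for x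
  proof (cases "x \<in> set_pmf q")
    case True
    then have "pmf (map_pmf f q) (f x) \<noteq> 0" by (simp add: set_pmf_iff[symmetric])
    then show ?thesis by (intro tendsto_intros p pmf_map_tendsto)
  next
    case False
    then have q0: "pmf q x = 0" by (simp add: set_pmf_iff)
    have "(\<lambda>k. \<bar>pmf (p k) x * - ln (pmf (map_pmf f (p k)) (f x))\<bar>) \<longlonglongrightarrow> 0"
    proof (rule tendsto_sandwich[OF _ _ tendsto_const])
      show "(\<lambda>k. pmf (p k) x * - ln (pmf (p k) x)) \<longlonglongrightarrow> 0"
        using D_lim[of x] q0 by simp
    qed (use dom in auto)
    then show ?thesis unfolding q0 tendsto_rabs_zero_iff by simp
  qed
qed (use fin H in \<open>auto simp: pmf_finite_entropy_def pmf_entropy_def integrable_pmf_count_space expectation_pmf_count_space simp del: mult_minus_right\<close>)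


section \<open>Relative entropy\<close>

definition relative_entropy :: "'a pmf \<Rightarrow> 'a pmf \<Rightarrow> real" where
  "relative_entropy q m = expect q (\<lambda>x. ln (pmf q x) - ln (pmf m x))"

text \<open>
  The bound \<open>c q \<le> m\<close> holds for a component \<open>q\<close> of weight \<open>c\<close> of a mixture \<open>m\<close>.  It bounds the relative
  entropy of \<open>q\<close> with respect to \<open>m\<close> by \<open>- ln c\<close>.
\<close>

locale dominated_pmf =
  fixes q m :: "'a pmf" and c :: real
  assumes c: "0 < c" and dominated: "\<And>x. c * pmf q x \<le> pmf m x"
begin

lemma pos: "0 < pmf q x" "0 < pmf m x" if "x \<in> set_pmf q" for x
  using pmf_positive[OF that] dominated[of x] c by (auto intro: less_le_trans[of 0 "c * pmf q x"])

lemma log_ratio_le: "ln (pmf q x) - ln (pmf m x) \<le> - ln c" if "x \<in> set_pmf q" for x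
proof -
  have "ln (c * pmf q x) \<le> ln (pmf m x)"
    using dominated[of x] pos[OF that] c by (subst ln_le_cancel_iff) auto
  then show ?thesis using pos[OF that] c by (simp add: ln_mult_pos)
qed

lemma nn_integral_ratio_le: "(\<integral>\<^sup>+x. ennreal (f x * pmf m x / pmf q x) \<partial>measure_pmf q) \<le> (\<integral>\<^sup>+x. ennreal (f x) \<partial>measure_pmf m)"
  if f: "\<And>x. 0 \<le> f x"
proof -
  have "(\<integral>\<^sup>+x. ennreal (f x * pmf m x / pmf q x) \<partial>measure_pmf q)
      = (\<integral>\<^sup>+x. ennreal (pmf q x) * ennreal (f x * pmf m x / pmf q x) \<partial>count_space UNIV)"
    by (rule nn_integral_measure_pmf)
  also have "\<dots> \<le> (\<integral>\<^sup>+x. ennreal (pmf m x) * ennreal (f x) \<partial>count_space UNIV)"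
    using f by (intro nn_integral_mono) (auto simp: ennreal_mult'[symmetric] intro!: ennreal_leI)
  also have "\<dots> = (\<integral>\<^sup>+x. ennreal (f x) \<partial>measure_pmf m)"
    by (rule nn_integral_measure_pmf[symmetric])
  finally show ?thesis .
qed

lemma
  assumes f: "\<And>x. 0 \<le> f x" "\<And>x. f x \<le> B"
  shows integrable_ratio: "integrable (measure_pmf q) (\<lambda>x. f x * pmf m x / pmf q x)"
    and expectation_ratio_le: "expect q (\<lambda>x. f x * pmf m x / pmf q x) \<le> expect m f"
proof -
  have int_f: "integrable (measure_pmf m) f"
    using f by (intro integrable_pmf_bounded[where B=B]) auto
  have *: "(\<integral>\<^sup>+x. ennreal (f x * pmf m x / pmf q x) \<partial>measure_pmf q) \<le> ennreal (expect m f)"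
    using nn_integral_ratio_le[of f, OF f(1)] f(1) by (subst (asm) nn_integral_eq_integral[OF int_f]) auto
  show int: "integrable (measure_pmf q) (\<lambda>x. f x * pmf m x / pmf q x)"
  proof (rule integrableI_nonneg)
    show "(\<integral>\<^sup>+x. ennreal (f x * pmf m x / pmf q x) \<partial>measure_pmf q) < \<infinity>"
      using * by (rule le_less_trans) simp
  qed (use f in auto)
  have "ennreal (expect q (\<lambda>x. f x * pmf m x / pmf q x)) \<le> ennreal (expect m f)"
    using * f by (subst (asm) nn_integral_eq_integral[OF int]) auto
  then show "expect q (\<lambda>x. f x * pmf m x / pmf q x) \<le> expect m f"
    using f by (subst (asm) ennreal_le_iff) (auto intro!: integral_nonneg_AE)
qed

lemma log_ratio_ge:
  assumes x: "x \<in> set_pmf q"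
  shows "T + 1 - exp T * pmf m x / pmf q x \<le> ln (pmf q x) - ln (pmf m x)"
proof -
  let ?r = "exp T * pmf m x / pmf q x"
  have "ln ?r \<le> ?r - 1" using pos[OF x] by (intro ln_le_minus_one) auto
  moreover have "ln ?r = T + ln (pmf m x) - ln (pmf q x)"
    using pos[OF x] by (simp add: ln_div ln_mult_pos)
  ultimately show ?thesis by linarith
qed

lemma integrable_log_ratio: "integrable (measure_pmf q) (\<lambda>x. ln (pmf q x) - ln (pmf m x))"
proof (rule Bochner_Integration.integrable_bound)
  show "integrable (measure_pmf q) (\<lambda>x. \<bar>ln c\<bar> + 1 * pmf m x / pmf q x)"
    using integrable_ratio[of "\<lambda>_. 1" 1] by (intro Bochner_Integration.integrable_add) auto
  show "AE x in measure_pmf q. norm (ln (pmf q x) - ln (pmf m x)) \<le> norm (\<bar>ln c\<bar> + 1 * pmf m x / pmf q x)"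
  proof (unfold AE_measure_pmf_iff, intro ballI)
    fix x assume x: "x \<in> set_pmf q"
    define r where "r = pmf m x / pmf q x"
    have "0 \<le> r" by (simp add: r_def)
    moreover have "ln (pmf q x) - ln (pmf m x) \<le> - ln c" "1 - r \<le> ln (pmf q x) - ln (pmf m x)"
      using log_ratio_le[OF x] log_ratio_ge[OF x, of 0] by (simp_all add: r_def)
    ultimately show "norm (ln (pmf q x) - ln (pmf m x)) \<le> norm (\<bar>ln c\<bar> + 1 * pmf m x / pmf q x)"
      unfolding mult_1 r_def[symmetric] real_norm_def by linarith
  qed
qed simp

text \<open>
  The Donsker-Varadhan inequality in its version without normalisation: the logarithm \<open>ln z\<close>
  is at least \<open>T + 1 - exp T / z\<close> for every real \<open>T\<close>.
\<close>

lemma relative_entropy_ge: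
  assumes T: "\<And>x. \<bar>T x\<bar> \<le> B"
  shows "expect q T - expect m (\<lambda>x. exp (T x)) + 1 \<le> relative_entropy q m"
proof -
  have iT: "integrable (measure_pmf q) T"
    using T by (intro integrable_pmf_bounded[where B=B]) auto
  have eB: "exp (T x) \<le> exp B" for x using T[of x] by auto
  note ir = integrable_ratio[of "\<lambda>x. exp (T x)", OF _ eB, simplified]
  have "expect q T - expect m (\<lambda>x. exp (T x)) + 1
      \<le> expect q T - expect q (\<lambda>x. exp (T x) * pmf m x / pmf q x) + 1"
    using expectation_ratio_le[of "\<lambda>x. exp (T x)", OF _ eB] by simp
  also have "\<dots> = expect q (\<lambda>x. T x + 1 - exp (T x) * pmf m x / pmf q x)"
    using iT ir by (simp add: Bochner_Integration.integral_diff)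
  also have "\<dots> \<le> relative_entropy q m"
    unfolding relative_entropy_def
    by (intro expectation_pmf_mono integrable_log_ratio Bochner_Integration.integrable_diff
        Bochner_Integration.integrable_add iT ir log_ratio_ge) auto
  finally show ?thesis .
qed

lemma relative_entropy_nonneg: "0 \<le> relative_entropy q m"
  using relative_entropy_ge[of "\<lambda>_. 0" 0] by simp

lemma relative_entropy_le_ln: "relative_entropy q m \<le> - ln c"
proof -
  have "relative_entropy q m \<le> expect q (\<lambda>x. - ln c)"
    unfolding relative_entropy_def
    by (intro expectation_pmf_mono integrable_log_ratio log_ratio_le) auto
  then show ?thesis by simp
qed

lemma c_le_1: "c \<le> 1"
  using relative_entropy_nonneg relative_entropy_le_ln c by (metis le_zero_eq linorder_not_less ln_gt_zero neg_less_0_iff_less order.trans order_less_le_trans)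

text \<open>
  The optimal test function in the preceding inequality is the logarithmic density; cutting it off at
  \<open>-M\<close> makes it bounded, with bounds that do not depend on \<open>q\<close> and \<open>m\<close> except through \<open>c\<close>, and costs at
  most \<open>exp (-M)\<close>.
\<close>

lemma relative_entropy_le_truncation:
  fixes M :: real
  assumes M: "0 \<le> M"
  defines "T \<equiv> \<lambda>x. if x \<in> set_pmf q then max (-M) (ln (pmf q x) - ln (pmf m x)) else - M"
  shows "\<bar>T x\<bar> \<le> max M (- ln c)"
    and "relative_entropy q m \<le> expect q T - expect m (\<lambda>x. exp (T x)) + 1 + exp (-M)"
proof -
  have "0 \<le> - ln c" using c c_le_1 by simp
  then show TB: "\<bar>T x\<bar> \<le> max M (- ln c)" for x
    using log_ratio_le[of x] M by (auto simp: T_def)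
  have iT: "integrable (measure_pmf q) T"
    using TB by (intro integrable_pmf_bounded) auto
  have eB: "exp (T x) \<le> exp (max M (- ln c))" for x using TB[of x] by (simp add: abs_le_iff)
  have A: "relative_entropy q m \<le> expect q T"
    unfolding relative_entropy_def
    by (intro expectation_pmf_mono integrable_log_ratio iT) (auto simp: T_def)
  have "ennreal (expect m (\<lambda>x. exp (T x))) = (\<integral>\<^sup>+x. ennreal (exp (T x)) \<partial>measure_pmf m)"
    using eB by (intro nn_integral_eq_integral[symmetric] integrable_pmf_bounded[where B="exp (max M (- ln c))"]) auto
  also have "\<dots> = (\<integral>\<^sup>+x. ennreal (pmf m x) * ennreal (exp (T x)) \<partial>count_space UNIV)"
    by (rule nn_integral_measure_pmf)
  also have "\<dots> \<le> (\<integral>\<^sup>+x. ennreal (exp (-M) * pmf m x) + ennreal (pmf q x) \<partial>count_space UNIV)"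
  proof (rule nn_integral_mono)
    fix x
    have "pmf m x * exp (T x) \<le> exp (-M) * pmf m x + pmf q x"
    proof (cases "x \<in> set_pmf q \<and> T x \<noteq> - M")
      case True
      then have "exp (T x) = pmf q x / pmf m x"
        using pos[of x] by (auto simp: T_def exp_diff max_def split: if_splits)
      then show ?thesis using pos[of x] True by simp
    next
      case False
      then have "T x = - M" by (auto simp: T_def)
      then show ?thesis by simp
    qed
    then show "ennreal (pmf m x) * ennreal (exp (T x)) \<le> ennreal (exp (-M) * pmf m x) + ennreal (pmf q x)"
      by (simp add: ennreal_mult'[symmetric] ennreal_plus[symmetric] del: ennreal_plus)
  qed
  also have "\<dots> = ennreal (exp (-M)) * (\<integral>\<^sup>+x. ennreal (pmf m x) \<partial>count_space UNIV) + (\<integral>\<^sup>+x. ennreal (pmf q x) \<partial>count_space UNIV)"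
    by (subst nn_integral_add) (auto simp: ennreal_mult' nn_integral_cmult)
  also have "\<dots> = ennreal (exp (-M) + 1)"
    by (simp add: nn_integral_pmf)
  finally have "expect m (\<lambda>x. exp (T x)) \<le> exp (-M) + 1"
    by (subst (asm) ennreal_le_iff) auto
  with A show "relative_entropy q m \<le> expect q T - expect m (\<lambda>x. exp (T x)) + 1 + exp (-M)"
    by linarith
qed

end

lemma dominated_pmf_bind:
  assumes "a \<in> set_pmf A"
  shows "dominated_pmf (K a) (bind_pmf A K) (pmf A a)"
proof
  show "0 < pmf A a" using assms by (rule pmf_positive)
  show "pmf A a * pmf (K a) x \<le> pmf (bind_pmf A K) x" for x
  proof -
    have "pmf A a * pmf (K a) x = expect A (\<lambda>b. indicator {a} b * pmf (K a) x)"
      by (simp add: measure_pmf_single)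
    also have "\<dots> = expect A (\<lambda>b. indicator {a} b * pmf (K b) x)"
      by (intro Bochner_Integration.integral_cong) (auto simp: indicator_def)
    also have "\<dots> \<le> expect A (\<lambda>b. pmf (K b) x)"
      by (intro expectation_pmf_mono integrable_pmf_bounded[where B=1])
        (auto simp: indicator_def pmf_le_1)
    finally show ?thesis by (simp add: pmf_bind)
  qed
qed

text \<open>
  The chain rule for entropy, for a mixture whose components all have the same entropy \<open>H\<close>: the
  information of the mixture is the information of the component plus the logarithmic density, averaged
  over the components.
\<close>

lemma
  assumes fin: "pmf_finite_entropy (bind_pmf A K)"
    and K: "\<And>a. a \<in> set_pmf A \<Longrightarrow> pmf_finite_entropy (K a)" "\<And>a. a \<in> set_pmf A \<Longrightarrow> pmf_entropy (K a) = H"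
  shows integrable_relative_entropy: "integrable (measure_pmf A) (\<lambda>a. relative_entropy (K a) (bind_pmf A K))"
    and pmf_entropy_bind:
      "pmf_entropy (bind_pmf A K) = H + expect A (\<lambda>a. relative_entropy (K a) (bind_pmf A K))"
proof -
  let ?m = "bind_pmf A K" and ?D = "\<lambda>a. relative_entropy (K a) (bind_pmf A K)"
  obtain a0 where a0: "a0 \<in> set_pmf A" using set_pmf_not_empty by fast
  have H: "0 \<le> H" using K(2)[OF a0] pmf_entropy_nonneg[of "K a0"] by simp
  have D: "0 \<le> ?D a" if "a \<in> set_pmf A" for a
    by (rule dominated_pmf.relative_entropy_nonneg[OF dominated_pmf_bind[OF that]])
  have inner: "(\<integral>\<^sup>+x. ennreal (- ln (pmf ?m x)) \<partial>measure_pmf (K a)) = ennreal (H + ?D a)" if a: "a \<in> set_pmf A" for a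
  proof -
    interpret dominated_pmf "K a" ?m "pmf A a" by (rule dominated_pmf_bind[OF a])
    have i1: "integrable (measure_pmf (K a)) (\<lambda>x. - ln (pmf (K a) x))"
      using K(1)[OF a] by (simp add: pmf_finite_entropy_def)
    have int: "integrable (measure_pmf (K a)) (\<lambda>x. - ln (pmf (K a) x) + (ln (pmf (K a) x) - ln (pmf ?m x)))"
      by (intro Bochner_Integration.integrable_add i1 integrable_log_ratio)
    have "(\<integral>\<^sup>+x. ennreal (- ln (pmf ?m x)) \<partial>measure_pmf (K a)) = ennreal (expect (K a) (\<lambda>x. - ln (pmf ?m x)))"
      using int neg_ln_pmf_nonneg[of ?m] by (intro nn_integral_eq_integral) auto
    also have "expect (K a) (\<lambda>x. - ln (pmf ?m x))
        = expect (K a) (\<lambda>x. - ln (pmf (K a) x) + (ln (pmf (K a) x) - ln (pmf ?m x)))"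
      by simp
    also have "\<dots> = H + ?D a"
      unfolding Bochner_Integration.integral_add[OF i1 integrable_log_ratio] relative_entropy_def
      using K(2)[OF a] by (simp add: pmf_entropy_def)
    finally show ?thesis .
  qed
  have "ennreal (pmf_entropy ?m) = (\<integral>\<^sup>+x. ennreal (- ln (pmf ?m x)) \<partial>measure_pmf ?m)"
    unfolding pmf_entropy_def using fin neg_ln_pmf_nonneg[of ?m]
    by (intro nn_integral_eq_integral[symmetric]) (auto simp: pmf_finite_entropy_def)
  also have "\<dots> = (\<integral>\<^sup>+a. (\<integral>\<^sup>+x. ennreal (- ln (pmf ?m x)) \<partial>measure_pmf (K a)) \<partial>measure_pmf A)"
    by (rule nn_integral_bind_pmf)
  also have "\<dots> = (\<integral>\<^sup>+a. ennreal (H + ?D a) \<partial>measure_pmf A)"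
    using inner by (intro nn_integral_cong_AE) (auto simp: AE_measure_pmf_iff)
  finally have eq: "(\<integral>\<^sup>+a. ennreal (H + ?D a) \<partial>measure_pmf A) = ennreal (pmf_entropy ?m)" by simp
  have int: "integrable (measure_pmf A) (\<lambda>a. H + ?D a)"
    using D H eq by (intro integrableI_nonneg) (auto simp: AE_measure_pmf_iff)
  from Bochner_Integration.integrable_diff[OF int, of "\<lambda>_. H"] show int': "integrable (measure_pmf A) ?D" by simp
  have nn: "0 \<le> expect A ?D"
    using D by (intro integral_nonneg_AE) (auto simp: AE_measure_pmf_iff)
  have "(\<integral>\<^sup>+a. ennreal (H + ?D a) \<partial>measure_pmf A) = ennreal (expect A (\<lambda>a. H + ?D a))"
    using D H by (intro nn_integral_eq_integral int) (auto simp: AE_measure_pmf_iff)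
  also have "expect A (\<lambda>a. H + ?D a) = H + expect A ?D"
    using int' by simp
  finally show "pmf_entropy ?m = H + expect A ?D"
    unfolding eq using H nn pmf_entropy_nonneg[of ?m] by (subst (asm) ennreal_inj) auto
qed

lemma pmf_finite_entropy_mixture:
  assumes A: "finite (set_pmf A)" and K: "\<And>a. a \<in> set_pmf A \<Longrightarrow> pmf_finite_entropy (K a)"
  shows "pmf_finite_entropy (bind_pmf A K)"
proof -
  let ?m = "bind_pmf A K"
  have inner: "(\<integral>\<^sup>+x. ennreal (- ln (pmf ?m x)) \<partial>measure_pmf (K a)) < \<infinity>" if a: "a \<in> set_pmf A" for a
  proof -
    interpret dominated_pmf "K a" ?m "pmf A a" by (rule dominated_pmf_bind[OF a])
    have i1: "integrable (measure_pmf (K a)) (\<lambda>x. - ln (pmf (K a) x))"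
      using K(1)[OF a] by (simp add: pmf_finite_entropy_def)
    have int: "integrable (measure_pmf (K a)) (\<lambda>x. - ln (pmf (K a) x) + (ln (pmf (K a) x) - ln (pmf ?m x)))"
      by (intro Bochner_Integration.integrable_add i1 integrable_log_ratio)
    then have "integrable (measure_pmf (K a)) (\<lambda>x. - ln (pmf ?m x))" by simp
    then show ?thesis
      using neg_ln_pmf_nonneg[of ?m] by (subst nn_integral_eq_integral) auto
  qed
  have "(\<integral>\<^sup>+x. ennreal (- ln (pmf ?m x)) \<partial>measure_pmf ?m) = (\<integral>\<^sup>+a. (\<integral>\<^sup>+x. ennreal (- ln (pmf ?m x)) \<partial>measure_pmf (K a)) \<partial>measure_pmf A)"
    by (rule nn_integral_bind_pmf)
  also have "\<dots> = (\<Sum>a\<in>set_pmf A. (\<integral>\<^sup>+x. ennreal (- ln (pmf ?m x)) \<partial>measure_pmf (K a)) * pmf A a)"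
    by (rule nn_integral_measure_pmf_finite[OF A]) simp
  also have "\<dots> < \<infinity>"
    using inner A by (auto simp: ennreal_mult_less_top)
  finally show ?thesis
    unfolding pmf_finite_entropy_def using neg_ln_pmf_nonneg[of ?m] by (intro integrableI_nonneg) auto
qed


section \<open>Convolution powers and asymptotic entropy\<close>

text \<open>
  Fekete's lemma.
\<close>

lemma subadditive_quotient_tendsto:
  fixes a :: "nat \<Rightarrow> real"
  assumes nonneg: "\<And>n. 0 \<le> a n" and subadd: "\<And>m n. a (m + n) \<le> a m + a n"
  obtains L where "(\<lambda>n. a n / real n) \<longlonglongrightarrow> L" "\<And>n. real n * L \<le> a n"
proof -
  define L where "L = (INF n\<in>{1..}. a n / real n)"
  have bdd: "bdd_below ((\<lambda>n. a n / real n) ` {1..})"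
    using nonneg by (intro bdd_belowI[of _ 0]) auto
  have L_le: "L \<le> a n / real n" if "n \<ge> 1" for n
    unfolding L_def using that bdd by (intro cINF_lower) auto
  have L: "real n * L \<le> a n" for n
    using L_le[of n] nonneg[of 0] by (cases "n = 0") (auto simp: field_simps)
  \<comment> \<open>Division with remainder by \<open>m\<close>, where \<open>a m / m\<close> is close to the infimum.\<close>
  have mult: "a (q * m + r) \<le> real q * a m + a r" for q m r
  proof (induction q)
    case (Suc q)
    have "a (Suc q * m + r) = a (m + (q * m + r))" by (simp add: algebra_simps)
    also have "\<dots> \<le> a m + a (q * m + r)" by (rule subadd)
    finally show ?case using Suc by (simp add: algebra_simps)
  qed simp
  have "(\<lambda>n. a n / real n) \<longlonglongrightarrow> L"
  proof (rule order_tendstoI)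
    fix c assume "c < L"
    then show "\<forall>\<^sub>F n in sequentially. c < a n / real n"
      using L_le by (intro eventually_sequentiallyI[of 1]) (auto intro: less_le_trans)
  next
    fix c assume "L < c"
    then obtain m where m: "m \<ge> 1" "a m / real m < c"
      unfolding L_def using bdd by (subst (asm) cINF_less_iff) auto
    define C where "C = Max (a ` {..<m})"
    have C: "a r \<le> C" if "r < m" for r
      unfolding C_def using that by (intro Max_ge) auto
    have "(\<lambda>n. a m / real m + C / real n) \<longlonglongrightarrow> a m / real m + 0"
      by (intro tendsto_intros real_tendsto_divide_at_top[OF tendsto_const] filterlim_real_sequentially)
    then have "\<forall>\<^sub>F n in sequentially. a m / real m + C / real n < c"
      using m by (intro order_tendstoD(2)) auto
    then show "\<forall>\<^sub>F n in sequentially. a n / real n < c"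
      using eventually_ge_at_top[of 1]
    proof eventually_elim
      case (elim n)
      have "a n = a ((n div m) * m + n mod m)" by simp
      also have "\<dots> \<le> real (n div m) * a m + C"
        using mult[of "n div m" m "n mod m"] C[of "n mod m"] m by auto
      also have "\<dots> \<le> (real n / real m) * a m + C"
      proof (intro add_right_mono mult_right_mono nonneg)
        have "real (n div m) * real m \<le> real n"
          unfolding of_nat_mult[symmetric] of_nat_le_iff by (rule div_times_less_eq_dividend)
        then show "real (n div m) \<le> real n / real m" using m by (simp add: le_divide_eq)
      qed
      finally have "a n / real n \<le> ((real n / real m) * a m + C) / real n"
        using elim by (intro divide_right_mono) auto
      also have "\<dots> = a m / real m + C / real n"
        using elim m by (simp add: field_simps)
      finally show ?case using elim by linarith
    qed
  qed
  with L show thesis using that by blast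
qed

lemma convolution_pmf_bind: "convolution_pmf G p q = bind_pmf p (\<lambda>g. map_pmf (\<lambda>h. g \<otimes>\<^bsub>G\<^esub> h) q)"
  unfolding convolution_pmf_def pair_pmf_def by (simp add: map_bind_pmf map_pmf_def bind_assoc_pmf bind_return_pmf)

context group
begin

lemma set_convolution_subset:
  assumes "set_pmf p \<subseteq> carrier G" "set_pmf q \<subseteq> carrier G"
  shows "set_pmf (convolution_pmf G p q) \<subseteq> carrier G"
  using assms by (auto simp: convolution_pmf_def)

lemma convolution_assoc:
  assumes "set_pmf p \<subseteq> carrier G" "set_pmf q \<subseteq> carrier G" "set_pmf r \<subseteq> carrier G"
  shows "convolution_pmf G (convolution_pmf G p q) r = convolution_pmf G p (convolution_pmf G q r)"
proof -
  have "convolution_pmf G (convolution_pmf G p q) r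
      = bind_pmf p (\<lambda>g. bind_pmf q (\<lambda>h. map_pmf (\<lambda>k. (g \<otimes> h) \<otimes> k) r))"
    by (simp add: convolution_pmf_bind bind_assoc_pmf bind_map_pmf)
  also have "\<dots> = bind_pmf p (\<lambda>g. bind_pmf q (\<lambda>h. map_pmf (\<lambda>k. g \<otimes> (h \<otimes> k)) r))"
    using assms by (intro bind_pmf_cong refl map_pmf_cong m_assoc) auto
  also have "\<dots> = convolution_pmf G p (convolution_pmf G q r)"
    by (simp add: convolution_pmf_bind map_bind_pmf pmf.map_comp o_def)
  finally show ?thesis .
qed

lemma convolution_one:
  assumes "set_pmf p \<subseteq> carrier G"
  shows "convolution_pmf G p (return_pmf \<one>) = p" "convolution_pmf G (return_pmf \<one>) p = p"
proof -
  have "convolution_pmf G p (return_pmf \<one>) = map_pmf (\<lambda>g. g \<otimes> \<one>) p"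
    by (simp add: convolution_pmf_bind map_pmf_def[of _ p] bind_return_pmf)
  also have "\<dots> = map_pmf id p" using assms by (intro map_pmf_cong) auto
  finally show "convolution_pmf G p (return_pmf \<one>) = p" by simp
  have "convolution_pmf G (return_pmf \<one>) p = map_pmf (\<lambda>g. \<one> \<otimes> g) p"
    by (simp add: convolution_pmf_bind bind_return_pmf)
  also have "\<dots> = map_pmf id p" using assms by (intro map_pmf_cong) auto
  finally show "convolution_pmf G (return_pmf \<one>) p = p" by simp
qed

lemma expectation_convolution:
  fixes f :: "'a \<Rightarrow> real"
  assumes p: "set_pmf p \<subseteq> carrier G" and q: "set_pmf q \<subseteq> carrier G"
    and f: "\<And>g. g \<in> carrier G \<Longrightarrow> \<bar>f g\<bar> \<le> B"
  shows "expect (convolution_pmf G p q) f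
    = expect p (\<lambda>g. expect q (\<lambda>h. f (g \<otimes> h)))"
  unfolding convolution_pmf_bind
  using p q f by (subst expectation_bind_pmf[where B=B]) (auto simp: subset_iff)

lemma pmf_finite_entropy_convolution:
  "pmf_finite_entropy p \<Longrightarrow> pmf_finite_entropy q \<Longrightarrow> pmf_finite_entropy (convolution_pmf G p q)"
  unfolding convolution_pmf_def by (intro pmf_finite_entropy_map pmf_finite_entropy_pair)

lemma pmf_entropy_convolution_le:
  "pmf_finite_entropy p \<Longrightarrow> pmf_finite_entropy q \<Longrightarrow> pmf_entropy (convolution_pmf G p q) \<le> pmf_entropy p + pmf_entropy q"
  unfolding convolution_pmf_def
  using pmf_entropy_map_le[OF pmf_finite_entropy_pair] pmf_entropy_pair by metis

text \<open>
  A convolution is a mixture of left translates of its second factor, and translates have equal entropy.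
\<close>

lemma
  assumes p: "set_pmf p \<subseteq> carrier G" "pmf_finite_entropy p"
    and q: "set_pmf q \<subseteq> carrier G" "pmf_finite_entropy q"
  defines "D \<equiv> \<lambda>g. relative_entropy (map_pmf (\<lambda>h. g \<otimes> h) q) (convolution_pmf G p q)"
  shows integrable_relative_entropy_convolution: "integrable (measure_pmf p) D"
    and pmf_entropy_convolution: "pmf_entropy (convolution_pmf G p q) = pmf_entropy q + expect p D"
proof -
  have inj: "inj_on (\<lambda>h. g \<otimes> h) (set_pmf q)" if "g \<in> set_pmf p" for g
    using that p q by (intro inj_onI) (auto simp: subset_iff)
  show "integrable (measure_pmf p) D" "pmf_entropy (convolution_pmf G p q) = pmf_entropy q + expect p D"
    unfolding D_def convolution_pmf_bind
    using pmf_finite_entropy_convolution[OF p(2) q(2)] q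
    by (auto intro!: integrable_relative_entropy pmf_entropy_bind simp: convolution_pmf_bind inj
        pmf_finite_entropy_map_inj pmf_entropy_map_inj)
qed

lemma dominated_convolution:
  assumes "g \<in> set_pmf p"
  shows "dominated_pmf (map_pmf (\<lambda>h. g \<otimes> h) q) (convolution_pmf G p q) (pmf p g)"
  unfolding convolution_pmf_bind by (rule dominated_pmf_bind[OF assms])

lemma pmf_entropy_convolution_ge:
  assumes p: "set_pmf p \<subseteq> carrier G" "pmf_finite_entropy p"
    and q: "set_pmf q \<subseteq> carrier G" "pmf_finite_entropy q"
  shows "pmf_entropy q \<le> pmf_entropy (convolution_pmf G p q)"
  unfolding pmf_entropy_convolution[OF assms]
  by (auto intro!: integral_nonneg_AE dominated_pmf.relative_entropy_nonneg[OF dominated_convolution]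
      simp: AE_measure_pmf_iff)

end

locale group_pmf = group G for G (structure) +
  fixes \<mu> :: "'a pmf"
  assumes countable_carrier: "countable (carrier G)"
    and support: "set_pmf \<mu> \<subseteq> carrier G"
begin

abbreviation pow :: "nat \<Rightarrow> 'a pmf" where "pow \<equiv> convolution_power G \<mu>"

lemma set_pow: "set_pmf (pow n) \<subseteq> carrier G"
  by (induction n) (auto simp del: convolution_power.simps(2) simp: convolution_power.simps(2)[of G \<mu>]
      dest!: set_convolution_subset[OF _ support])

lemma pow_add: "convolution_pmf G (pow m) (pow n) = pow (m + n)"
  by (induction n) (simp_all add: convolution_one set_pow convolution_assoc[symmetric] support)

lemma pow_1: "pow 1 = \<mu>"
  by (simp add: convolution_one support)

lemma pow_Suc_left: "convolution_pmf G \<mu> (pow n) = pow (Suc n)"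
  using pow_add[of 1 n] pow_1 by simp

lemma expectation_pow_Suc:
  fixes f :: "'a \<Rightarrow> real"
  assumes "\<And>g. g \<in> carrier G \<Longrightarrow> \<bar>f g\<bar> \<le> B"
  shows "expect (pow (Suc n)) f = expect (pow n) (\<lambda>g. expect \<mu> (\<lambda>h. f (g \<otimes> h)))"
  using expectation_convolution[OF set_pow support assms] by simp

end

locale group_pmf_finite_entropy = group_pmf G \<mu> for G (structure) and \<mu> +
  assumes fin: "pmf_finite_entropy \<mu>"
begin

lemma fin_pow: "pmf_finite_entropy (pow n)"
proof (induction n)
  case 0
  have "(\<lambda>x. - ln (pmf (return_pmf \<one>) x)) = (\<lambda>x. 0)"
    by (auto simp: fun_eq_iff pmf_return indicator_def)
  then show ?case by (simp add: pmf_finite_entropy_def)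
next
  case (Suc n)
  then show ?case by (simp add: pmf_finite_entropy_convolution fin)
qed

lemma
  shows asymptotic_entropy_tendsto: "(\<lambda>n. pmf_entropy (pow n) / real n) \<longlonglongrightarrow> asymptotic_entropy G \<mu>"
    and asymptotic_entropy_le: "real n * asymptotic_entropy G \<mu> \<le> pmf_entropy (pow n)"
proof -
  have "pmf_entropy (pow (m + n)) \<le> pmf_entropy (pow m) + pmf_entropy (pow n)" for m n
    using pmf_entropy_convolution_le[OF fin_pow fin_pow, of m n] by (simp add: pow_add)
  then obtain L where L: "(\<lambda>n. pmf_entropy (pow n) / real n) \<longlonglongrightarrow> L" "\<And>n. real n * L \<le> pmf_entropy (pow n)"
    using subadditive_quotient_tendsto[of "\<lambda>n. pmf_entropy (pow n)"] pmf_entropy_nonneg by metis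
  moreover have "asymptotic_entropy G \<mu> = L"
    unfolding asymptotic_entropy_def shannon_entropy_eq[OF set_pow] using L(1) by (rule limI)
  ultimately show "(\<lambda>n. pmf_entropy (pow n) / real n) \<longlonglongrightarrow> asymptotic_entropy G \<mu>"
    "real n * asymptotic_entropy G \<mu> \<le> pmf_entropy (pow n)" by auto
qed

lemma asymptotic_entropy_ge:
  assumes "\<And>n. c \<le> pmf_entropy (pow (Suc n)) - pmf_entropy (pow n)"
  shows "c \<le> asymptotic_entropy G \<mu>"
proof (rule LIMSEQ_le_const[OF asymptotic_entropy_tendsto])
  have *: "real n * c \<le> pmf_entropy (pow n)" for n
  proof (induction n)
    case 0
    then show ?case by (simp add: pmf_entropy_nonneg)
  next
    case (Suc n)
    then show ?case using assms[of n] by (simp add: algebra_simps)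
  qed
  show "\<exists>N. \<forall>n\<ge>N. c \<le> pmf_entropy (pow n) / real n"
    using * by (intro exI[of _ 1]) (auto simp: field_simps)
qed

text \<open>
  The law of the walk at a uniformly chosen time among \<open>j, \<dots>, j + n - 1\<close>.  The length \<open>n\<close> controls the
  invariance, independently of the position \<open>j\<close>, which is then free to be chosen such that the
  entropy increment is large.
\<close>

definition window :: "nat \<Rightarrow> nat \<Rightarrow> 'a pmf" where
  "window n j = bind_pmf (pmf_of_set {..<n}) (\<lambda>i. pow (i + j))"

lemma set_window: "set_pmf (window n j) \<subseteq> carrier G"
  using set_pow by (auto simp: window_def)

lemma window_shift: "convolution_pmf G (window n 0) (pow j) = window n j"
  unfolding window_def convolution_pmf_bind[of G "bind_pmf _ _"] bind_assoc_pmf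
  unfolding convolution_pmf_bind[symmetric] pow_add by simp

lemma window_Suc: "convolution_pmf G \<mu> (window n j) = window n (Suc j)"
  unfolding window_def convolution_pmf_bind map_bind_pmf
  by (subst bind_commute_pmf) (simp add: convolution_pmf_bind[symmetric] pow_Suc_left del: convolution_power.simps)

lemma fin_window: "n > 0 \<Longrightarrow> pmf_finite_entropy (window n j)"
  unfolding window_def by (intro pmf_finite_entropy_mixture fin_pow) (auto simp: lessThan_empty_iff)

lemma expectation_window:
  fixes f :: "'a \<Rightarrow> real"
  assumes "n > 0" and f: "\<And>g. g \<in> carrier G \<Longrightarrow> \<bar>f g\<bar> \<le> B"
  shows "expect (window n j) f = (\<Sum>i<n. expect (pow (i + j)) f) / real n"
  unfolding window_def using assms set_pow
  by (subst expectation_bind_pmf[where B=B]) (auto simp: integral_pmf_of_set lessThan_empty_iff subset_iff)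

text \<open>
  Convolution with \<open>\<mu>\<close> shifts the window by one, so all but two of the terms cancel.
\<close>

lemma window_almost_invariant:
  fixes f :: "'a \<Rightarrow> real"
  assumes n: "n > 0" and f: "\<And>g. g \<in> carrier G \<Longrightarrow> \<bar>f g\<bar> \<le> B"
  shows "\<bar>expect (convolution_pmf G \<mu> (window n j)) f - expect (window n j) f\<bar> \<le> 2 * B / real n"
proof -
  let ?a = "\<lambda>i. expect (pow (i + j)) f"
  have "(\<Sum>i<n. expect (pow (i + Suc j)) f) - (\<Sum>i<n. ?a i) = ?a n - ?a 0"
    using sum_lessThan_telescope[of ?a n] by (simp add: sum_subtractf)
  then have "expect (convolution_pmf G \<mu> (window n j)) f - expect (window n j) f
      = (?a n - ?a 0) / real n"
    unfolding window_Suc using expectation_window[where f=f and B=B, OF n f]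
    by (simp add: diff_divide_distrib[symmetric] del: convolution_power.simps)
  moreover have "\<bar>?a i\<bar> \<le> B" for i
    using f set_pow by (intro abs_expectation_pmf_le) auto
  from this[of n] this[of 0] have "\<bar>?a n - ?a 0\<bar> \<le> 2 * B" by linarith
  ultimately show ?thesis using n by (simp add: divide_right_mono)
qed

text \<open>
  Were all increments below \<open>h - e\<close>, the entropy of the window at position \<open>j\<close> would be at most
  a constant plus \<open>j (h - e)\<close>; but it is at least \<open>H(\<mu>\<^sup>j) \<ge> j h\<close>.
\<close>

lemma window_entropy_increment:
  assumes n: "n > 0" and e: "e > 0"
  obtains j where "asymptotic_entropy G \<mu> - e \<le> pmf_entropy (convolution_pmf G \<mu> (window n j)) - pmf_entropy (window n j)"
proof (rule ccontr)
  assume "\<not> thesis"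
  then have *: "pmf_entropy (window n (Suc j)) - pmf_entropy (window n j) < asymptotic_entropy G \<mu> - e" for j
    using that[of j] unfolding window_Suc by (meson not_le)
  let ?h = "asymptotic_entropy G \<mu>"
  have up: "pmf_entropy (window n j) \<le> pmf_entropy (window n 0) + real j * (?h - e)" for j
  proof (induction j)
    case (Suc j)
    then show ?case using *[of j] by (simp add: algebra_simps)
  qed simp
  obtain j :: nat where j: "pmf_entropy (window n 0) / e < real j"
    using reals_Archimedean2 by blast
  have "real j * ?h \<le> pmf_entropy (pow j)" by (rule asymptotic_entropy_le)
  also have "\<dots> \<le> pmf_entropy (window n j)"
    unfolding window_shift[of n j, symmetric]
    by (intro pmf_entropy_convolution_ge set_window fin_window n set_pow fin_pow)
  finally show False using up[of j] j e by (simp add: field_simps)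
qed

end

lemma (in group) pmf_entropy_convolution_power_tendsto:
  assumes lim: "\<And>x. (\<lambda>k. pmf (\<mu>s k) x) \<longlonglongrightarrow> pmf \<mu> x"
    and fin: "\<And>k. pmf_finite_entropy (\<mu>s k)" "pmf_finite_entropy \<mu>"
    and H: "(\<lambda>k. pmf_entropy (\<mu>s k)) \<longlonglongrightarrow> pmf_entropy \<mu>"
    and fin_pow: "\<And>k n. pmf_finite_entropy (convolution_power G (\<mu>s k) n)" "\<And>n. pmf_finite_entropy (convolution_power G \<mu> n)"
  shows "(\<lambda>k. pmf (convolution_power G (\<mu>s k) n) x) \<longlonglongrightarrow> pmf (convolution_power G \<mu> n) x"
    and "(\<lambda>k. pmf_entropy (convolution_power G (\<mu>s k) n)) \<longlonglongrightarrow> pmf_entropy (convolution_power G \<mu> n)"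
proof (induction n arbitrary: x)
  case (Suc n)
  have pair: "(\<lambda>k. pmf (pair_pmf (convolution_power G (\<mu>s k) n) (\<mu>s k)) y) \<longlonglongrightarrow> pmf (pair_pmf (convolution_power G \<mu> n) \<mu>) y" for y
    by (cases y) (auto simp: pmf_pair intro!: tendsto_intros Suc(1) lim)
  have 1: "(\<lambda>k. pmf_entropy (pair_pmf (convolution_power G (\<mu>s k) n) (\<mu>s k))) \<longlonglongrightarrow> pmf_entropy (pair_pmf (convolution_power G \<mu> n) \<mu>)"
    by (simp add: pmf_entropy_pair fin fin_pow) (intro tendsto_intros Suc(2) H)
  { case 1 show ?case by (simp add: convolution_pmf_def) (intro pmf_map_tendsto pair) }
  { case 2 show ?case
      by (simp add: convolution_pmf_def)
        (intro pmf_entropy_map_tendsto pair pmf_finite_entropy_pair fin fin_pow \<open>(\<lambda>k. pmf_entropy (pair_pmf _ _)) \<longlonglongrightarrow> _\<close>) }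
qed simp_all


section \<open>The random walk and its path measure\<close>

lemma
  shows space_path_space: "space (path_space G) = UNIV \<rightarrow> carrier G"
    and measurable_path_coordinate [measurable]: "(\<lambda>w. w n) \<in> path_space G \<rightarrow>\<^sub>M count_space (carrier G)"
  by (auto simp: path_space_def space_PiM PiE_def)

lemma measurable_path_function [measurable]:
  fixes f :: "'g \<Rightarrow> 'b::topological_space"
  shows "(\<lambda>w. f (w n)) \<in> borel_measurable (path_space G)"
  by (rule measurable_compose[OF measurable_path_coordinate]) simp

context group_pmf
begin

definition increment_measure :: "'a measure" where
  "increment_measure = restrict_space (measure_pmf \<mu>) (carrier G)"

abbreviation path_prob :: "(nat \<Rightarrow> 'a) measure" where
  "path_prob \<equiv> path_measure G \<mu>"

lemma space_increment [simp]: "space increment_measure = carrier G"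
  by (simp add: increment_measure_def space_restrict_space)

lemma sets_increment [measurable_cong]: "sets increment_measure = sets (count_space (carrier G))"
  by (auto simp: increment_measure_def sets_restrict_space image_iff)

lemma prob_space_increment: "prob_space increment_measure"
  unfolding increment_measure_def
  using support by (intro prob_space_restrict_space measure_pmf.emeasure_eq_1_AE) (auto simp: AE_measure_pmf_iff)

lemma integral_increment: "(\<integral>h. f h \<partial>increment_measure) = expect \<mu> f" for f :: "'a \<Rightarrow> real"
  unfolding increment_measure_def
  using support by (subst integral_restrict_space) (auto intro!: integral_cong_AE simp: AE_measure_pmf_iff indicator_def)

lemma AE_increment: "(AE h in increment_measure. P h) \<longleftrightarrow> (\<forall>h\<in>set_pmf \<mu>. P h)"
  unfolding increment_measure_def
  using support by (subst AE_restrict_space_iff) (auto simp: AE_measure_pmf_iff)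

lemma measurable_mult [measurable (raw)]:
  assumes "f \<in> M \<rightarrow>\<^sub>M count_space (carrier G)" "g \<in> M \<rightarrow>\<^sub>M count_space (carrier G)"
  shows "(\<lambda>x. f x \<otimes> g x) \<in> M \<rightarrow>\<^sub>M count_space (carrier G)"
proof -
  have "(\<lambda>x. (f x, g x)) \<in> M \<rightarrow>\<^sub>M count_space (carrier G) \<Otimes>\<^sub>M count_space (carrier G)"
    using assms by simp
  then have pair: "(\<lambda>x. (f x, g x)) \<in> M \<rightarrow>\<^sub>M count_space (carrier G \<times> carrier G)"
    by (simp add: pair_measure_countable countable_carrier)
  have mult: "(\<lambda>(a, b). a \<otimes> b) \<in> count_space (carrier G \<times> carrier G) \<rightarrow>\<^sub>M count_space (carrier G)"
    by auto
  from measurable_compose[OF pair mult] show ?thesis by simp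
qed

interpretation increments: sequence_space increment_measure
  unfolding sequence_space_def by (intro product_prob_spaceI prob_space_increment)

lemma path_measure_alt: "path_prob = distr increments.S (path_space G) (walk G)"
  by (simp add: path_measure_def increment_measure_def)

lemma measurable_walk [measurable]: "walk G \<in> increments.S \<rightarrow>\<^sub>M path_space G"
proof -
  have "(\<lambda>x. walk G x n) \<in> increments.S \<rightarrow>\<^sub>M count_space (carrier G)" for n
  proof (induction n)
    case (Suc n)
    have [measurable]: "(\<lambda>x. x n) \<in> increments.S \<rightarrow>\<^sub>M count_space (carrier G)"
      using measurable_component_singleton[of n UNIV "\<lambda>_. increment_measure"]
      by (simp add: measurable_cong_sets[OF refl sets_increment])
    note Suc[measurable]
    show ?case by simp
  qed simp
  then show ?thesis
    unfolding path_space_def by (rule measurable_abs_UNIV)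
qed

lemma prob_space_path: "prob_space path_prob"
  unfolding path_measure_alt by (rule increments.P.prob_space_distr) measurable

lemma sets_path [simp, measurable_cong]: "sets path_prob = sets (path_space G)"
  by (simp add: path_measure_alt)

lemma space_path [simp]: "space path_prob = UNIV \<rightarrow> carrier G"
  by (simp add: path_measure_alt space_path_space)

text \<open>
  This path is equivalent to the translate of \<open>w\<close> by \<open>h\<close>, so invariant functions do not distinguish the two.
\<close>

definition prepend_step :: "'a \<Rightarrow> (nat \<Rightarrow> 'a) \<Rightarrow> nat \<Rightarrow> 'a" where
  "prepend_step h w = case_nat \<one> (\<lambda>k. h \<otimes> w k)"

lemma prepend_step_simps [simp]: "prepend_step h w 0 = \<one>" "prepend_step h w (Suc n) = h \<otimes> w n"
  by (simp_all add: prepend_step_def)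

lemma measurable_prepend_step [measurable]:
  "(\<lambda>(h, w). prepend_step h w) \<in> increment_measure \<Otimes>\<^sub>M path_space G \<rightarrow>\<^sub>M path_space G"
proof -
  have "(\<lambda>x. prepend_step (fst x) (snd x) n) \<in> increment_measure \<Otimes>\<^sub>M path_space G \<rightarrow>\<^sub>M count_space (carrier G)" for n
  proof (cases n)
    case (Suc k)
    have [measurable]: "fst \<in> increment_measure \<Otimes>\<^sub>M path_space G \<rightarrow>\<^sub>M count_space (carrier G)"
      by (simp add: measurable_cong_sets[OF refl sets_increment, symmetric])
    show ?thesis unfolding Suc by simp
  qed simp
  then show ?thesis
    unfolding path_space_def split_beta' by (rule measurable_abs_UNIV)
qed

lemma walk_case_nat:
  assumes "h \<in> carrier G" "x \<in> UNIV \<rightarrow> carrier G"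
  shows "walk G (case_nat h x) = prepend_step h (walk G x)"
proof
  have C: "walk G x k \<in> carrier G" for k
    using assms by (induction k) auto
  show "walk G (case_nat h x) n = prepend_step h (walk G x) n" for n
  proof (induction n)
    case (Suc n)
    then show ?case using assms C by (cases n) (auto simp: m_assoc Pi_iff)
  qed simp
qed

text \<open>
  The Markov property at time 1, from which the martingale property of harmonic functions and the stationarity of
  the law of the boundary point are derived by conditioning on the first step.
\<close>

lemma path_measure_prepend:
  "path_prob = distr (increment_measure \<Otimes>\<^sub>M path_prob) (path_space G) (\<lambda>(h, w). prepend_step h w)"
proof -
  let ?I = increment_measure and ?S = increments.S
  have "path_prob = distr (distr (?I \<Otimes>\<^sub>M ?S) ?S (\<lambda>(s, \<omega>). case_nat s \<omega>)) (path_space G) (walk G)"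
    unfolding path_measure_alt by (simp add: increments.PiM_iter)
  also have "\<dots> = distr (?I \<Otimes>\<^sub>M ?S) (path_space G) (\<lambda>(s, \<omega>). walk G (case_nat s \<omega>))"
    by (subst distr_distr) (auto simp: o_def split_beta')
  also have "\<dots> = distr (?I \<Otimes>\<^sub>M ?S) (path_space G) (\<lambda>(s, \<omega>). prepend_step s (walk G \<omega>))"
    by (intro distr_cong) (auto simp: walk_case_nat space_pair_measure space_PiM PiE_def)
  also have "\<dots> = distr (distr (?I \<Otimes>\<^sub>M ?S) (?I \<Otimes>\<^sub>M path_space G) (\<lambda>(s, \<omega>). (s, walk G \<omega>))) (path_space G) (\<lambda>(h, w). prepend_step h w)"
    by (subst distr_distr) (auto simp: o_def split_beta')
  also have "distr (?I \<Otimes>\<^sub>M ?S) (?I \<Otimes>\<^sub>M path_space G) (\<lambda>(s, \<omega>). (s, walk G \<omega>)) = distr ?I ?I (\<lambda>s. s) \<Otimes>\<^sub>M path_prob"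
    unfolding path_measure_alt
    by (rule pair_measure_distr[symmetric])
      (auto intro!: prob_space_imp_sigma_finite increments.P.prob_space_distr)
  also have "distr ?I ?I (\<lambda>s. s) = ?I" by (rule distr_id)
  finally show ?thesis .
qed

lemma AE_prepend:
  assumes "AE w in path_prob. Q w" and h: "h \<in> set_pmf \<mu>"
  shows "AE w in path_prob. Q (prepend_step h w)"
proof -
  interpret P: prob_space path_prob by (rule prob_space_path)
  interpret I: prob_space increment_measure by (rule prob_space_increment)
  interpret Q: pair_sigma_finite increment_measure path_prob ..
  have "AE x in increment_measure \<Otimes>\<^sub>M path_prob. Q (case x of (h, w) \<Rightarrow> prepend_step h w)"
  proof (rule AE_distrD[of _ _ "path_space G"])
    show "AE w in distr (increment_measure \<Otimes>\<^sub>M path_prob) (path_space G) (\<lambda>(h, w). prepend_step h w). Q w"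
      unfolding path_measure_prepend[symmetric] by (rule assms(1))
  qed measurable
  from Q.AE_pair[OF this] h show ?thesis by (auto simp: AE_increment)
qed

lemma expectation_prepend:
  fixes F :: "(nat \<Rightarrow> 'a) \<Rightarrow> real"
  assumes [measurable]: "F \<in> borel_measurable (path_space G)"
    and bound: "\<And>w. w \<in> UNIV \<rightarrow> carrier G \<Longrightarrow> \<bar>F w\<bar> \<le> B"
  shows "(\<integral>w. F w \<partial>path_prob) = expect \<mu> (\<lambda>h. \<integral>w. F (prepend_step h w) \<partial>path_prob)"
proof -
  interpret P: prob_space path_prob by (rule prob_space_path)
  interpret I: prob_space increment_measure by (rule prob_space_increment)
  interpret Q: pair_prob_space increment_measure path_prob ..
  have meas[measurable]: "(\<lambda>x. F (case x of (h, w) \<Rightarrow> prepend_step h w)) \<in> borel_measurable (increment_measure \<Otimes>\<^sub>M path_prob)"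
    by (rule measurable_compose[OF _ assms(1)]) measurable
  have pC: "prepend_step h w n \<in> carrier G" if "h \<in> carrier G" "w \<in> UNIV \<rightarrow> carrier G" for h w n
    using that by (auto simp: prepend_step_def Pi_iff split: nat.split)
  have "(\<integral>w. F w \<partial>path_prob) = (\<integral>x. F (case x of (h, w) \<Rightarrow> prepend_step h w) \<partial>(increment_measure \<Otimes>\<^sub>M path_prob))"
    by (subst path_measure_prepend, subst integral_distr) (auto simp: measurable_prepend_step)
  also have "\<dots> = (\<integral>h. (\<integral>w. F (case (h, w) of (h, w) \<Rightarrow> prepend_step h w) \<partial>path_prob) \<partial>increment_measure)"
    by (rule Q.integral_fst'[symmetric], rule Q.P.integrable_const_bound[where B=B])
      (auto intro!: AE_I2 bound pC simp: space_pair_measure Pi_iff)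
  also have "\<dots> = expect \<mu> (\<lambda>h. \<integral>w. F (prepend_step h w) \<partial>path_prob)"
    by (simp add: integral_increment)
  finally show ?thesis .
qed

lemma AE_path_start: "AE w in path_prob. w 0 = \<one>"
  unfolding path_measure_alt by (subst AE_distr_iff) auto

lemma integrable_path:
  fixes F :: "(nat \<Rightarrow> 'a) \<Rightarrow> real"
  assumes "F \<in> borel_measurable (path_space G)" "\<And>w. w \<in> UNIV \<rightarrow> carrier G \<Longrightarrow> \<bar>F w\<bar> \<le> B"
  shows "integrable path_prob F"
proof -
  interpret P: prob_space path_prob by (rule prob_space_path)
  show ?thesis using assms by (intro P.integrable_const_bound[where B=B]) (auto intro!: AE_I2)
qed

subsection \<open>Bounded harmonic functions along the walk\<close>

definition harmonic :: "('a \<Rightarrow> real) \<Rightarrow> bool" where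
  "harmonic u \<longleftrightarrow> (\<forall>g\<in>carrier G. u g = expect \<mu> (\<lambda>h. u (g \<otimes> h)))"

lemma harmonic_expectation_path:
  assumes u: "harmonic u" "\<And>g. g \<in> carrier G \<Longrightarrow> \<bar>u g\<bar> \<le> B" and g: "g \<in> carrier G"
  shows "(\<integral>w. u (g \<otimes> w l) \<partial>path_prob) = u g"
  using g
proof (induction l arbitrary: g)
  case 0
  interpret P: prob_space path_prob by (rule prob_space_path)
  have "(\<integral>w. u (g \<otimes> w 0) \<partial>path_prob) = (\<integral>w. u g \<partial>path_prob)"
    using AE_path_start 0 by (intro integral_cong_AE) auto
  then show ?case by (simp add: P.prob_space[unfolded space_path])
next
  case (Suc l)
  have "(\<integral>w. u (g \<otimes> w (Suc l)) \<partial>path_prob) = expect \<mu> (\<lambda>h. \<integral>w. u (g \<otimes> (h \<otimes> w l)) \<partial>path_prob)"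
    using Suc.prems by (subst expectation_prepend[where B=B]) (auto intro!: u Pi_I)
  also have "\<dots> = expect \<mu> (\<lambda>h. u (g \<otimes> h))"
  proof (intro integral_cong_AE)
    have "(\<integral>w. u (g \<otimes> (h \<otimes> w l)) \<partial>path_prob) = u (g \<otimes> h)" if "h \<in> set_pmf \<mu>" for h
    proof -
      have h: "h \<in> carrier G" using that support by auto
      have "(\<integral>w. u (g \<otimes> (h \<otimes> w l)) \<partial>path_prob) = (\<integral>w. u ((g \<otimes> h) \<otimes> w l) \<partial>path_prob)"
        using h Suc.prems by (intro Bochner_Integration.integral_cong) (auto simp: m_assoc Pi_iff)
      also have "\<dots> = u (g \<otimes> h)" using Suc h by auto
      finally show ?thesis .
    qed
    then show "AE h in measure_pmf \<mu>. (\<integral>w. u (g \<otimes> (h \<otimes> w l)) \<partial>path_prob) = u (g \<otimes> h)"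
      by (simp add: AE_measure_pmf_iff)
  qed simp_all
  also have "\<dots> = u g" using u(1) Suc.prems by (simp add: harmonic_def)
  finally show ?case .
qed

text \<open>
  \<open>u\<close> is a martingale along the walk from any starting point \<open>g\<close>.  Leaving \<open>g\<close> arbitrary turns
  conditioning on the first step into an induction on \<open>m\<close>.
\<close>

lemma harmonic_martingale:
  assumes u: "harmonic u" "\<And>g. g \<in> carrier G \<Longrightarrow> \<bar>u g\<bar> \<le> B"
    and f: "\<And>g. g \<in> carrier G \<Longrightarrow> \<bar>f g\<bar> \<le> B'" and g: "g \<in> carrier G"
  shows "(\<integral>w. f (g \<otimes> w m) * u (g \<otimes> w (m + l)) \<partial>path_prob) = (\<integral>w. f (g \<otimes> w m) * u (g \<otimes> w m) \<partial>path_prob)"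
  using g
proof (induction m arbitrary: g)
  case 0
  interpret P: prob_space path_prob by (rule prob_space_path)
  have "(\<integral>w. f (g \<otimes> w 0) * u (g \<otimes> w (0 + l)) \<partial>path_prob) = (\<integral>w. f g * u (g \<otimes> w l) \<partial>path_prob)"
    using AE_path_start 0 by (intro integral_cong_AE) auto
  also have "\<dots> = f g * u g" using harmonic_expectation_path[OF u 0] by simp
  also have "\<dots> = (\<integral>w. f g * u g \<partial>path_prob)" by (simp add: P.prob_space[unfolded space_path])
  also have "\<dots> = (\<integral>w. f (g \<otimes> w 0) * u (g \<otimes> w 0) \<partial>path_prob)"
    using AE_path_start 0 by (intro integral_cong_AE) auto
  finally show ?case .
next
  case (Suc m)
  have bound: "\<bar>f (g \<otimes> w i) * u (g \<otimes> w j)\<bar> \<le> B' * B" if "w \<in> UNIV \<rightarrow> carrier G" for w i j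
    using f[of "g \<otimes> w i"] u(2)[of "g \<otimes> w j"] that Suc.prems
    by (auto simp: abs_mult Pi_iff intro!: mult_mono order_trans[OF abs_ge_zero f[of g]])
  have step: "(\<integral>w. f (g \<otimes> w (Suc m)) * u (g \<otimes> w (Suc (m + k))) \<partial>path_prob)
      = expect \<mu> (\<lambda>h. \<integral>w. f ((g \<otimes> h) \<otimes> w m) * u ((g \<otimes> h) \<otimes> w (m + k)) \<partial>path_prob)" for k
  proof -
    have "(\<integral>w. f (g \<otimes> w (Suc m)) * u (g \<otimes> w (Suc (m + k))) \<partial>path_prob)
      = expect \<mu> (\<lambda>h. \<integral>w. f (g \<otimes> (h \<otimes> w m)) * u (g \<otimes> (h \<otimes> w (m + k))) \<partial>path_prob)"
      by (subst expectation_prepend[where B="B' * B"]) (use bound in auto)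
    also have "\<dots> = expect \<mu> (\<lambda>h. \<integral>w. f ((g \<otimes> h) \<otimes> w m) * u ((g \<otimes> h) \<otimes> w (m + k)) \<partial>path_prob)"
      using support Suc.prems
      by (intro integral_cong_AE) (auto simp: AE_measure_pmf_iff m_assoc Pi_iff subset_iff intro!: Bochner_Integration.integral_cong)
    finally show ?thesis .
  qed
  show ?case
    unfolding add_Suc step[of l] using step[of 0]
    by (simp, intro integral_cong_AE) (use Suc support in \<open>auto simp: AE_measure_pmf_iff\<close>)
qed

text \<open>
  Orthogonality of martingale increments.
\<close>

lemma harmonic_increment_L2:
  assumes u: "harmonic u" "\<And>g. g \<in> carrier G \<Longrightarrow> \<bar>u g\<bar> \<le> B"
  shows "(\<integral>w. (u (w (m + l)) - u (w m))\<^sup>2 \<partial>path_prob) = (\<integral>w. (u (w (m + l)))\<^sup>2 \<partial>path_prob) - (\<integral>w. (u (w m))\<^sup>2 \<partial>path_prob)"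
proof -
  have bound: "\<bar>u (w i) * u (w j)\<bar> \<le> B * B" if "w \<in> UNIV \<rightarrow> carrier G" for w i j
    using u(2)[of "w i"] u(2)[of "w j"] that
    by (auto simp: abs_mult Pi_iff intro!: mult_mono order_trans[OF abs_ge_zero u(2)[of "w i"]])
  have int: "integrable path_prob (\<lambda>w. u (w i) * u (w j))" for i j
    using bound by (intro integrable_path) auto
  have mart: "(\<integral>w. u (w m) * u (w (m + l)) \<partial>path_prob) = (\<integral>w. u (w m) * u (w m) \<partial>path_prob)"
  proof -
    have "(\<integral>w. u (w i) * u (w j) \<partial>path_prob) = (\<integral>w. u (\<one> \<otimes> w i) * u (\<one> \<otimes> w j) \<partial>path_prob)" for i j
      by (intro Bochner_Integration.integral_cong) (auto simp: Pi_iff)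
    then show ?thesis using harmonic_martingale[OF u u(2) one_closed, where m=m and l=l] by simp
  qed
  have "(\<integral>w. (u (w (m + l)) - u (w m))\<^sup>2 \<partial>path_prob)
      = (\<integral>w. u (w (m + l)) * u (w (m + l)) - 2 * (u (w m) * u (w (m + l))) + u (w m) * u (w m) \<partial>path_prob)"
    by (intro Bochner_Integration.integral_cong) (auto simp: power2_eq_square algebra_simps)
  also have "\<dots> = (\<integral>w. u (w (m + l)) * u (w (m + l)) \<partial>path_prob) - 2 * (\<integral>w. u (w m) * u (w (m + l)) \<partial>path_prob)
      + (\<integral>w. u (w m) * u (w m) \<partial>path_prob)"
    using int by simp
  finally show ?thesis unfolding mart power2_eq_square by simp
qed

end


section \<open>Stationarity and boundary values\<close>

lemma AE_summable_if_L1_summable: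
  fixes Y :: "nat \<Rightarrow> 'a \<Rightarrow> real"
  assumes int: "\<And>j. integrable M (Y j)" and small: "\<And>j. (\<integral>x. \<bar>Y j x\<bar> \<partial>M) \<le> b j" and b: "summable b"
  shows "AE x in M. summable (\<lambda>j. \<bar>Y j x\<bar>)"
proof -
  have [measurable]: "\<And>j. Y j \<in> borel_measurable M" using int by auto
  have b0: "0 \<le> b j" for j using small[of j] by (rule order_trans[rotated]) simp
  have "(\<integral>\<^sup>+x. (\<Sum>j. ennreal \<bar>Y j x\<bar>) \<partial>M) = (\<Sum>j. \<integral>\<^sup>+x. ennreal \<bar>Y j x\<bar> \<partial>M)"
    by (rule nn_integral_suminf) simp
  also have "\<dots> \<le> (\<Sum>j. ennreal (b j))"
    using small int by (intro suminf_le) (auto simp: nn_integral_eq_integral intro!: ennreal_leI)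
  also have "\<dots> < \<infinity>"
    using b b0 by (subst suminf_ennreal2) auto
  finally have "AE x in M. (\<Sum>j. ennreal \<bar>Y j x\<bar>) \<noteq> \<infinity>"
    by (intro nn_integral_noteq_infinite) auto
  then show ?thesis
    by eventually_elim (auto intro: summable_suminf_not_top)
qed

lemma (in prob_space) L1_le_sqrt_L2:
  fixes X :: "'a \<Rightarrow> real"
  assumes "integrable M X" "integrable M (\<lambda>x. (X x)\<^sup>2)"
  shows "expectation (\<lambda>x. \<bar>X x\<bar>) \<le> sqrt (expectation (\<lambda>x. (X x)\<^sup>2))"
proof -
  let ?c = "expectation (\<lambda>x. \<bar>X x\<bar>)"
  have "0 \<le> expectation (\<lambda>x. (\<bar>X x\<bar> - ?c)\<^sup>2)" by (intro integral_nonneg_AE) auto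
  also have "\<dots> = expectation (\<lambda>x. (X x)\<^sup>2 - 2 * ?c * \<bar>X x\<bar> + ?c\<^sup>2)"
    by (intro Bochner_Integration.integral_cong) (auto simp: power2_eq_square algebra_simps)
  also have "\<dots> = expectation (\<lambda>x. (X x)\<^sup>2) - ?c\<^sup>2"
    using assms by (simp add: prob_space power2_eq_square)
  finally show ?thesis by (simp add: real_le_rsqrt)
qed

lemma sparse_subsequence:
  fixes a :: "nat \<Rightarrow> real"
  assumes "a \<longlonglongrightarrow> L" and b: "\<And>j. 0 < b j"
  obtains r where "mono r" "\<And>j. j \<le> r j" "\<And>j. L - a (r j) \<le> b j"
proof -
  have "\<exists>N. \<forall>n\<ge>N. L - a n \<le> b j" for j
  proof -
    have "\<forall>\<^sub>F n in sequentially. L - b j < a n"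
      using assms(1) b[of j] by (intro order_tendstoD) auto
    then show ?thesis unfolding eventually_sequentially by (metis diff_le_eq diff_less_eq less_imp_le add.commute)
  qed
  then obtain N where N: "\<And>j n. n \<ge> N j \<Longrightarrow> L - a n \<le> b j" by metis
  define r where "r j = (\<Sum>i\<le>j. N i) + j" for j
  have "mono r" unfolding r_def by (intro monoI add_mono sum_mono2) auto
  moreover have "N j \<le> r j" for j
    using member_le_sum[of j "{..j}" N] by (auto simp: r_def trans_le_add1)
  then have "L - a (r j) \<le> b j" for j by (intro N)
  moreover have "j \<le> r j" for j by (simp add: r_def)
  ultimately show thesis using that by blast
qed

lemma continuous_action_compose:
  assumes "continuous_action G act" "g \<in> carrier G" "h \<in> carrier G"
  shows "act (g \<otimes>\<^bsub>G\<^esub> h) x = act g (act h x)"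
  using assms group_action.composition_rule[of G UNIV act x g h] by (simp add: continuous_action_def)

lemma continuous_action_one:
  assumes "continuous_action G act"
  shows "act \<one>\<^bsub>G\<^esub> x = x"
  using assms group_action.id_eq_one[of G UNIV act] by (auto simp: continuous_action_def fun_eq_iff)

lemma measurable_continuous_action:
  assumes "continuous_action G act" "g \<in> carrier G"
  shows "act g \<in> borel \<rightarrow>\<^sub>M borel"
  using assms by (auto simp: continuous_action_def intro: borel_measurable_continuous_onI)

text \<open>
  A Poisson boundary together with a chosen projection \<open>bnd\<close> from the path space.
\<close>

locale walk_boundary = group_pmf G \<mu> for G (structure) and \<mu> +
  fixes act :: "'a \<Rightarrow> 'x::polish_space \<Rightarrow> 'x" and \<nu> :: "'x measure" and bnd :: "(nat \<Rightarrow> 'a) \<Rightarrow> 'x"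
  assumes action: "continuous_action G act"
    and bnd_measurable [measurable]: "bnd \<in> path_space G \<rightarrow>\<^sub>M borel"
    and bnd_invariant: "\<And>w w'. w \<in> UNIV \<rightarrow> carrier G \<Longrightarrow> w' \<in> UNIV \<rightarrow> carrier G \<Longrightarrow> path_equiv w w' \<Longrightarrow> bnd w = bnd w'"
    and bnd_distr: "distr (path_measure G \<mu>) borel bnd = \<nu>"
    and bnd_sets: "\<And>A. A \<in> boundary_sets G \<mu> \<Longrightarrow> \<exists>B\<in>sets borel. AE w in path_measure G \<mu>. w \<in> A \<longleftrightarrow> bnd w \<in> B"
    and bnd_equivariant: "\<And>g. g \<in> carrier G \<Longrightarrow> AE w in path_measure G \<mu>. bnd (\<lambda>n. g \<otimes> w n) = act g (bnd w)"
begin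

lemmas act_measurable [measurable] = measurable_continuous_action[OF action]

lemma integral_boundary: "(\<integral>x. f x \<partial>\<nu>) = (\<integral>w. f (bnd w) \<partial>path_prob)" if [measurable]: "f \<in> borel_measurable borel"
  for f :: "'x \<Rightarrow> real"
  unfolding bnd_distr[symmetric] by (rule integral_distr) simp_all

lemma AE_bnd_prepend:
  assumes h: "h \<in> carrier G"
  shows "AE w in path_prob. bnd (prepend_step h w) = act h (bnd w)"
  using bnd_equivariant[OF h] AE_space
proof eventually_elim
  case (elim w)
  have "path_equiv (prepend_step h w) (\<lambda>n. h \<otimes> w n)"
    unfolding path_equiv_def by (intro disjI2 exI[of _ 1] exI[of _ 0]) simp
  then have "bnd (prepend_step h w) = bnd (\<lambda>n. h \<otimes> w n)"
    using elim h by (intro bnd_invariant) (auto simp: prepend_step_def Pi_iff split: nat.split)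
  with elim show ?case by simp
qed

lemma stationary_integral:
  fixes f :: "'x \<Rightarrow> real"
  assumes [measurable]: "f \<in> borel_measurable borel" and bound: "\<And>x. \<bar>f x\<bar> \<le> B"
  shows "(\<integral>x. f x \<partial>\<nu>) = expect \<mu> (\<lambda>h. \<integral>x. f (act h x) \<partial>\<nu>)"
proof -
  have "(\<integral>x. f x \<partial>\<nu>) = (\<integral>w. f (bnd w) \<partial>path_prob)"
    by (rule integral_boundary) simp
  also have "\<dots> = expect \<mu> (\<lambda>h. \<integral>w. f (bnd (prepend_step h w)) \<partial>path_prob)"
    using bound by (intro expectation_prepend[where B=B]) auto
  also have "\<dots> = expect \<mu> (\<lambda>h. \<integral>x. f (act h x) \<partial>\<nu>)"
  proof (intro integral_cong_AE, unfold AE_measure_pmf_iff, simp_all, intro ballI)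
    fix h assume "h \<in> set_pmf \<mu>"
    then have h: "h \<in> carrier G" using support by auto
    note [measurable] = act_measurable[OF h]
    have "(\<lambda>w. prepend_step h w) \<in> path_space G \<rightarrow>\<^sub>M path_space G"
      using measurable_compose[OF measurable_Pair1'[of h increment_measure "path_space G"] measurable_prepend_step] h by simp
    note [measurable] = this
    have "(\<integral>w. f (bnd (prepend_step h w)) \<partial>path_prob) = (\<integral>w. f (act h (bnd w)) \<partial>path_prob)"
    proof (rule integral_cong_AE)
      show "AE w in path_prob. f (bnd (prepend_step h w)) = f (act h (bnd w))"
        using AE_bnd_prepend[OF h] by eventually_elim simp
    qed simp_all
    also have "\<dots> = (\<integral>x. f (act h x) \<partial>\<nu>)"
      by (rule integral_boundary[symmetric]) simp
    finally show "(\<integral>w. f (bnd (prepend_step h w)) \<partial>path_prob) = (\<integral>x. f (act h x) \<partial>\<nu>)" .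
  qed
  finally show ?thesis .
qed

lemma prob_space_boundary: "prob_space \<nu>"
  unfolding bnd_distr[symmetric] using prob_space_path by (rule prob_space.prob_space_distr) simp

text \<open>
  The sublevel sets of \<open>Z\<close> at rational heights are invariant, so they are preimages of Borel sets \<open>C q\<close> up
  to null sets; \<open>\<Psi> x\<close> is the infimum of the heights \<open>q\<close> with \<open>x \<in> C q\<close>, clipped to the interval from \<open>-B\<close> to \<open>B\<close>.
\<close>

lemma boundary_function_factorization:
  fixes Z :: "(nat \<Rightarrow> 'a) \<Rightarrow> ereal"
  assumes [measurable]: "Z \<in> borel_measurable (path_space G)"
    and inv: "\<And>w w'. w \<in> UNIV \<rightarrow> carrier G \<Longrightarrow> w' \<in> UNIV \<rightarrow> carrier G \<Longrightarrow> path_equiv w w' \<Longrightarrow> Z w = Z w'"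
    and bound: "AE w in path_prob. \<bar>Z w\<bar> \<le> ereal B" and B: "0 \<le> B"
  obtains \<Psi> where "\<Psi> \<in> borel_measurable borel" "\<And>x. \<bar>\<Psi> x\<bar> \<le> B" "AE w in path_prob. Z w = ereal (\<Psi> (bnd w))"
proof -
  define A where "A q = {w \<in> space (path_space G). Z w < ereal (of_rat q)}" for q
  have "A q \<in> boundary_sets G \<mu>" for q
    unfolding boundary_sets_def
  proof (intro CollectI conjI bexI[of _ "A q"] ballI impI)
    show "A q \<in> sets (path_space G)" unfolding A_def by measurable
    then show "A q \<in> sets (path_space G)" .
    show "AE w in path_prob. (w \<in> A q) = (w \<in> A q)" by simp
    fix w w' assume "w \<in> A q" "w' \<in> space (path_space G)" "path_equiv w w'"
    then show "w' \<in> A q" using inv[of w w'] by (auto simp: A_def space_path_space)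
  qed
  then have "\<exists>B\<in>sets borel. AE w in path_prob. w \<in> A q \<longleftrightarrow> bnd w \<in> B" for q by (rule bnd_sets)
  then obtain C where C[measurable]: "\<And>q. C q \<in> sets borel" and AC: "\<And>q. AE w in path_prob. w \<in> A q \<longleftrightarrow> bnd w \<in> C q"
    by metis
  define J where "J x = (INF q. if x \<in> C q then ereal (of_rat q) else \<infinity>)" for x
  have [measurable]: "J \<in> borel_measurable borel"
    unfolding J_def by measurable
  define \<Psi> where "\<Psi> x = max (- B) (min B (real_of_ereal (J x)))" for x
  have "AE w in path_prob. \<forall>q. w \<in> A q \<longleftrightarrow> bnd w \<in> C q"
    using AC by (simp add: AE_all_countable)
  with bound AE_space have "AE w in path_prob. Z w = ereal (\<Psi> (bnd w))"
  proof eventually_elim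
    case (elim w)
    have C_iff: "bnd w \<in> C q \<longleftrightarrow> Z w < ereal (of_rat q)" for q
      using elim by (auto simp: A_def space_path_space)
    obtain z where z: "Z w = ereal z" "\<bar>z\<bar> \<le> B" using elim by (cases "Z w") auto
    have "J (bnd w) = ereal z"
    proof (rule antisym)
      show "ereal z \<le> J (bnd w)"
        unfolding J_def using z by (intro INF_greatest) (auto simp: C_iff)
      show "J (bnd w) \<le> ereal z"
      proof (rule ereal_le_epsilon2)
        fix e :: real assume "0 < e"
        then obtain q where q: "z < of_rat q" "of_rat q < z + e"
          using of_rat_dense[of z "z + e"] by auto
        have "J (bnd w) \<le> (if bnd w \<in> C q then ereal (of_rat q) else \<infinity>)"
          unfolding J_def by (rule INF_lower) simp
        also have "\<dots> = ereal (of_rat q)" using q z by (simp add: C_iff)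
        also have "\<dots> \<le> ereal z + ereal e" using q by simp
        finally show "J (bnd w) \<le> ereal z + ereal e" .
      qed
    qed
    with z show ?case by (auto simp: \<Psi>_def)
  qed
  moreover have "\<Psi> \<in> borel_measurable borel" unfolding \<Psi>_def by measurable
  moreover have "\<bar>\<Psi> x\<bar> \<le> B" for x using B by (auto simp: \<Psi>_def)
  ultimately show thesis using that by blast
qed

text \<open>
  Along a sparse sequence of times \<open>r j\<close> a single upper limit is not invariant under a time shift, but
  the outer upper limit over all shifts \<open>p\<close> makes it so.
\<close>

lemma tail_limsup_invariant:
  fixes u :: "'a \<Rightarrow> real" and r :: "nat \<Rightarrow> nat"
  assumes r: "\<And>j. j \<le> r j" and eq: "path_equiv w w'"
  shows "limsup (\<lambda>p. limsup (\<lambda>j. ereal (u (w (r j + p))))) = limsup (\<lambda>p. limsup (\<lambda>j. ereal (u (w' (r j + p)))))"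
proof -
  have shift: "limsup (\<lambda>p. limsup (\<lambda>j. ereal (u (w (r j + p))))) = limsup (\<lambda>p. limsup (\<lambda>j. ereal (u (w' (r j + p)))))"
    if ww': "\<forall>n>N. w n = w' (n + q)" for w w' :: "nat \<Rightarrow> 'a" and N q
  proof -
    have "limsup (\<lambda>j. ereal (u (w (r j + p)))) = limsup (\<lambda>j. ereal (u (w' (r j + (p + q)))))" for p
    proof (rule Limsup_eq)
      show "\<forall>\<^sub>F j in sequentially. ereal (u (w (r j + p))) = ereal (u (w' (r j + (p + q))))"
        using eventually_gt_at_top[of N]
      proof eventually_elim
        case (elim j)
        then have "r j + p > N" using r[of j] by simp
        with ww' have "w (r j + p) = w' (r j + p + q)" by blast
        then show ?case by (simp add: add.assoc)
      qed
    qed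
    then show ?thesis
      using limsup_shift_k[of "\<lambda>p. limsup (\<lambda>j. ereal (u (w' (r j + p))))" q] by simp
  qed
  from eq show ?thesis unfolding path_equiv_def using shift shift[symmetric] by blast
qed

text \<open>
  Convergence of a bounded harmonic function along the paths, at least along sparse times.  The increments
  of the martingale are small in \<open>L\<^sup>2\<close>, hence summable in \<open>L\<^sup>1\<close> along sparse times \<open>r j\<close>, also after any
  time shift \<open>p\<close>; the limit is therefore almost surely the same for all \<open>p\<close>, and it equals
  an exactly invariant function, which factors through the boundary.
\<close>

proposition harmonic_boundary_values:
  assumes u: "harmonic u" "\<And>g. g \<in> carrier G \<Longrightarrow> \<bar>u g\<bar> \<le> B"
  obtains \<Psi> r where "\<Psi> \<in> borel_measurable borel" "\<And>x. \<bar>\<Psi> x\<bar> \<le> B"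
    "AE w in path_prob. \<forall>p. (\<lambda>j. u (w (r j + p))) \<longlonglongrightarrow> \<Psi> (bnd w)"
proof -
  interpret P: prob_space path_prob by (rule prob_space_path)
  have B: "0 \<le> B" using u(2)[OF one_closed] by linarith
  define a where "a n = (\<integral>w. (u (w n))\<^sup>2 \<partial>path_prob)" for n
  have incr: "(\<integral>w. (u (w (m + l)) - u (w m))\<^sup>2 \<partial>path_prob) = a (m + l) - a m" for m l
    unfolding a_def by (rule harmonic_increment_L2[OF u])
  have a_mono: "a m \<le> a (m + l)" for m l
  proof -
    have "0 \<le> (\<integral>w. (u (w (m + l)) - u (w m))\<^sup>2 \<partial>path_prob)" by (intro integral_nonneg_AE) auto
    then show ?thesis unfolding incr by simp
  qed
  have u2: "(u (w n))\<^sup>2 \<le> B\<^sup>2" if "w \<in> UNIV \<rightarrow> carrier G" for w n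
    using u(2)[of "w n"] that B by (auto simp: Pi_iff abs_le_square_iff[symmetric])
  have a_le: "a n \<le> B\<^sup>2" for n
  proof -
    have "a n \<le> (\<integral>w. B\<^sup>2 \<partial>path_prob)"
      unfolding a_def using u2 by (intro integral_mono integrable_path[where B="B\<^sup>2"]) (auto simp: P.integrable_const)
    then show ?thesis using P.prob_space by simp
  qed
  have inc: "incseq a" using a_mono by (intro incseq_SucI) (metis Suc_eq_plus1)
  obtain L where L: "a \<longlonglongrightarrow> L" "\<And>n. a n \<le> L"
    using incseq_convergent[OF inc] a_le by metis
  obtain r where r: "mono r" "\<And>j. j \<le> r j" "\<And>j. L - a (r j) \<le> (1/4) ^ j"
    using sparse_subsequence[OF L(1), of "\<lambda>j. (1/4) ^ j"] by auto
  have diff_bound: "\<bar>u (w m) - u (w n)\<bar> \<le> 2 * B" if "w \<in> UNIV \<rightarrow> carrier G" for w m n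
    using u(2)[of "w n"] u(2)[of "w m"] that by (auto simp: Pi_iff abs_le_iff)
  have int: "integrable path_prob (\<lambda>w. u (w m) - u (w n))" for m n
    using diff_bound by (intro integrable_path) auto
  have int2: "integrable path_prob (\<lambda>w. (u (w m) - u (w n))\<^sup>2)" for m n
  proof (rule integrable_path[where B="(2 * B)\<^sup>2"])
    fix w :: "nat \<Rightarrow> 'a" assume w: "w \<in> UNIV \<rightarrow> carrier G"
    show "\<bar>(u (w m) - u (w n))\<^sup>2\<bar> \<le> (2 * B)\<^sup>2"
      using power_mono[OF diff_bound[OF w, of m n], of 2] by simp
  qed simp
  have L1: "(\<integral>w. \<bar>u (w (r j + l)) - u (w (r j))\<bar> \<partial>path_prob) \<le> (1/2) ^ j" for j l
  proof -
    have "(\<integral>w. \<bar>u (w (r j + l)) - u (w (r j))\<bar> \<partial>path_prob) \<le> sqrt (a (r j + l) - a (r j))"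
      using P.L1_le_sqrt_L2[OF int int2, of "r j + l" "r j"] by (simp add: incr)
    also have "\<dots> \<le> sqrt ((1/4) ^ j)"
      using r(3)[of j] L(2)[of "r j + l"] by (intro real_sqrt_le_mono) linarith
    also have "\<dots> = (1/2) ^ j"
      by (simp add: real_sqrt_power real_sqrt_divide)
    finally show ?thesis .
  qed
  have summ: "AE w in path_prob. summable (\<lambda>j. \<bar>u (w (r j + l j)) - u (w (r j))\<bar>)" for l
    by (rule AE_summable_if_L1_summable[where b="\<lambda>j. (1/2) ^ j"]) (auto intro: int L1 summable_geometric)
  have "AE w in path_prob. summable (\<lambda>j. \<bar>u (w (r j + (r (Suc j) - r j))) - u (w (r j))\<bar>)" by (rule summ)
  moreover have "r j + (r (Suc j) - r j) = r (Suc j)" for j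
    using monoD[OF r(1), of j "Suc j"] by simp
  ultimately have conv: "AE w in path_prob. summable (\<lambda>j. \<bar>u (w (r (Suc j))) - u (w (r j))\<bar>)" by simp
  have shift: "AE w in path_prob. \<forall>p. summable (\<lambda>j. \<bar>u (w (r j + p)) - u (w (r j))\<bar>)"
    unfolding AE_all_countable using summ[of "\<lambda>_. p" for p] by simp
  define Z where "Z w = limsup (\<lambda>p. limsup (\<lambda>j. ereal (u (w (r j + p)))))" for w
  have main: "AE w in path_prob. \<exists>l. \<bar>l\<bar> \<le> B \<and> (\<forall>p. (\<lambda>j. u (w (r j + p))) \<longlonglongrightarrow> l) \<and> Z w = ereal l"
    using conv shift AE_space
  proof eventually_elim
    case (elim w)
    have "summable (\<lambda>j. u (w (r (Suc j))) - u (w (r j)))"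
      using elim(1) by (rule summable_rabs_cancel)
    then have "(\<lambda>n. \<Sum>j<n. u (w (r (Suc j))) - u (w (r j))) \<longlonglongrightarrow> (\<Sum>j. u (w (r (Suc j))) - u (w (r j)))"
      by (rule summable_LIMSEQ)
    then have "(\<lambda>n. u (w (r n)) - u (w (r 0))) \<longlonglongrightarrow> (\<Sum>j. u (w (r (Suc j))) - u (w (r j)))"
      by (simp add: sum_lessThan_telescope[where f="\<lambda>j. u (w (r j))"])
    from tendsto_add[OF this tendsto_const[of "u (w (r 0))"]] obtain l where l: "(\<lambda>n. u (w (r n))) \<longlonglongrightarrow> l"
      by auto
    have lp: "(\<lambda>j. u (w (r j + p))) \<longlonglongrightarrow> l" for p
    proof -
      have "(\<lambda>j. \<bar>u (w (r j + p)) - u (w (r j))\<bar>) \<longlonglongrightarrow> 0"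
        using elim(2) by (intro summable_LIMSEQ_zero) blast
      then have "(\<lambda>j. u (w (r j + p)) - u (w (r j))) \<longlonglongrightarrow> 0" by (rule tendsto_rabs_zero_cancel)
      from tendsto_add[OF this l] show ?thesis by simp
    qed
    have "\<bar>l\<bar> \<le> B"
      using elim(3) u(2) by (intro LIMSEQ_le_const2[OF tendsto_rabs[OF l]]) (auto simp: Pi_iff)
    moreover have "limsup (\<lambda>j. ereal (u (w (r j + p)))) = ereal l" for p
      using lp[of p] by (intro lim_imp_Limsup) auto
    then have "Z w = ereal l" unfolding Z_def by (simp add: Limsup_const)
    ultimately show ?case using lp by blast
  qed
  have inv: "Z w = Z w'" if "path_equiv w w'" for w w'
    unfolding Z_def by (rule tail_limsup_invariant[OF r(2) that])
  have Z_meas: "Z \<in> borel_measurable (path_space G)" unfolding Z_def by measurable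
  have Z_bound: "AE w in path_prob. \<bar>Z w\<bar> \<le> ereal B"
    using main by eventually_elim auto
  obtain \<Psi> where \<Psi>: "\<Psi> \<in> borel_measurable borel" "\<And>x. \<bar>\<Psi> x\<bar> \<le> B" "AE w in path_prob. Z w = ereal (\<Psi> (bnd w))"
    by (rule boundary_function_factorization[OF Z_meas inv Z_bound B], assumption) (rule that, assumption+)
  have "AE w in path_prob. \<forall>p. (\<lambda>j. u (w (r j + p))) \<longlonglongrightarrow> \<Psi> (bnd w)"
    using main \<Psi>(3) by eventually_elim auto
  with \<Psi> show thesis using that by blast
qed

text \<open>
  The Poisson formula at the points \<open>g\<close> of the support.  For these the path \<open>prepend_step g w\<close> is typical
  whenever \<open>w\<close> is, so that the boundary values along \<open>g w\<close> are obtained from those along typical paths shifted by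
  one.  The inequality between \<open>exp \<circ> u\<close> and a second harmonic function survives in the limit.
\<close>

proposition harmonic_poisson_representation:
  assumes u: "harmonic u" "\<And>g. g \<in> carrier G \<Longrightarrow> \<bar>u g\<bar> \<le> B"
    and v: "harmonic v" "\<And>g. g \<in> carrier G \<Longrightarrow> \<bar>v g\<bar> \<le> B'"
    and uv: "\<And>g. g \<in> carrier G \<Longrightarrow> exp (u g) \<le> v g"
  obtains \<Psi> where "\<Psi> \<in> borel_measurable borel" "\<And>x. \<bar>\<Psi> x\<bar> \<le> B"
    "\<And>g. g \<in> set_pmf \<mu> \<Longrightarrow> (\<integral>x. \<Psi> (act g x) \<partial>\<nu>) = u g"
    "(\<integral>x. exp (\<Psi> x) \<partial>\<nu>) \<le> v \<one>"
proof -
  interpret P: prob_space path_prob by (rule prob_space_path)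
  obtain \<Psi> r where \<Psi>[measurable]: "\<Psi> \<in> borel_measurable borel" and bound: "\<And>x. \<bar>\<Psi> x\<bar> \<le> B"
    and lim: "AE w in path_prob. \<forall>p. (\<lambda>j. u (w (r j + p))) \<longlonglongrightarrow> \<Psi> (bnd w)"
    by (rule harmonic_boundary_values[OF u], assumption) (rule that, assumption+)
  have "(\<integral>x. \<Psi> (act g x) \<partial>\<nu>) = u g" if g: "g \<in> set_pmf \<mu>" for g
  proof -
    have gC: "g \<in> carrier G" using g support by auto
    note [measurable] = act_measurable[OF gC]
    have "AE w in path_prob. (\<lambda>j. u (g \<otimes> w (r j))) \<longlonglongrightarrow> \<Psi> (act g (bnd w))"
      using AE_prepend[OF lim g] AE_bnd_prepend[OF gC]
    proof eventually_elim
      case (elim w)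
      \<comment> \<open>Time \<open>r j + 1\<close> of the prepended path is time \<open>r j\<close> of the translated one.\<close>
      from elim(1)[rule_format, of 1] elim(2) show ?case by simp
    qed
    then have "(\<lambda>j. \<integral>w. u (g \<otimes> w (r j)) \<partial>path_prob) \<longlonglongrightarrow> (\<integral>w. \<Psi> (act g (bnd w)) \<partial>path_prob)"
      using u(2) gC by (intro integral_dominated_convergence[where w="\<lambda>_. B"]) (auto intro!: AE_I2 simp: Pi_iff)
    moreover have "(\<integral>w. u (g \<otimes> w n) \<partial>path_prob) = u g" for n
      by (rule harmonic_expectation_path[OF u gC])
    ultimately have "u g = (\<integral>w. \<Psi> (act g (bnd w)) \<partial>path_prob)"
      by (simp add: LIMSEQ_const_iff)
    then show ?thesis by (subst integral_boundary) auto
  qed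
  moreover have "(\<integral>x. exp (\<Psi> x) \<partial>\<nu>) \<le> v \<one>"
  proof -
    have "AE w in path_prob. (\<lambda>j. exp (u (w (r j)))) \<longlonglongrightarrow> exp (\<Psi> (bnd w))"
      using lim
    proof eventually_elim
      case (elim w)
      from elim[rule_format, of 0] show ?case by (auto intro: tendsto_exp)
    qed
    then have "(\<lambda>j. \<integral>w. exp (u (w (r j))) \<partial>path_prob) \<longlonglongrightarrow> (\<integral>w. exp (\<Psi> (bnd w)) \<partial>path_prob)"
      using u(2) by (intro integral_dominated_convergence[where w="\<lambda>_. exp B"]) (auto intro!: AE_I2 simp: Pi_iff abs_le_iff)
    moreover have "(\<integral>w. exp (u (w n)) \<partial>path_prob) \<le> v \<one>" for n
    proof -
      have "(\<integral>w. exp (u (w n)) \<partial>path_prob) \<le> (\<integral>w. v (w n) \<partial>path_prob)"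
        using u(2) v(2) uv
        by (intro integral_mono integrable_path[where B="exp B"] integrable_path[where B=B'])
          (auto simp: Pi_iff abs_le_iff)
      also have "\<dots> = (\<integral>w. v (\<one> \<otimes> w n) \<partial>path_prob)"
        by (intro Bochner_Integration.integral_cong) (auto simp: Pi_iff)
      also have "\<dots> = v \<one>" by (rule harmonic_expectation_path[OF v one_closed])
      finally show ?thesis .
    qed
    ultimately have "(\<integral>w. exp (\<Psi> (bnd w)) \<partial>path_prob) \<le> v \<one>"
      by (intro LIMSEQ_le_const2) auto
    then show ?thesis by (subst integral_boundary) auto
  qed
  ultimately show thesis using that \<Psi> bound by blast
qed

end


section \<open>Continuous test functions on Polish spaces\<close>

lemma closed_indicator_limit:
  fixes K :: "'a::metric_space set"
  assumes "closed K" "K \<noteq> {}"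
  shows "(\<lambda>n. max 0 (1 - real n * infdist x K)) \<longlonglongrightarrow> indicator K x"
proof (cases "x \<in> K")
  case True
  then show ?thesis by simp
next
  case False
  then have d: "0 < infdist x K"
    using assms by (intro infdist_pos_not_in_closed)
  obtain N :: nat where N: "1 / infdist x K < real N" using reals_Archimedean2 by blast
  have "\<forall>\<^sub>F n in sequentially. max 0 (1 - real n * infdist x K) = 0"
  proof (rule eventually_sequentiallyI[of N])
    fix n assume "N \<le> n"
    then have "1 / infdist x K < real n" using N by linarith
    then show "max 0 (1 - real n * infdist x K) = 0" using d by (simp add: field_simps)
  qed
  then show ?thesis using False by (simp add: tendsto_eventually)
qed

lemma closed_indicator_approximant_range: "0 \<le> max 0 (1 - real n * infdist x K)" "max 0 (1 - real n * infdist x K) \<le> 1"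
  by (auto simp: infdist_nonneg)

lemma continuous_closed_indicator_approximant:
  "continuous_on UNIV (\<lambda>x. max 0 (1 - real n * infdist x K))"
  by (intro continuous_intros)

text \<open>
  By inner regularity an indicator function is close to that of a closed set, which is a decreasing limit of
  continuous functions of the distance to that set.
\<close>

lemma continuous_dense_L1:
  fixes f :: "'a::polish_space \<Rightarrow> real"
  assumes M: "finite_measure M" "sets M = sets borel" and f: "integrable M f" and e: "0 < e"
  shows "\<exists>h. continuous_on UNIV h \<and> bounded (range h) \<and> (\<integral>x. \<bar>f x - h x\<bar> \<partial>M) < e"
proof -
  interpret finite_measure M by fact
  have space: "space M = UNIV" using sets_eq_imp_space_eq[OF M(2)] by simp
  have meas: "h \<in> borel_measurable M" if "continuous_on UNIV h" for h :: "'a \<Rightarrow> real"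
    using borel_measurable_continuous_onI[OF that] measurable_cong_sets[OF M(2) refl] by blast
  have int: "integrable M h" if h: "continuous_on UNIV h" "bounded (range h)" for h :: "'a \<Rightarrow> real"
  proof -
    obtain B where "\<And>x. \<bar>h x\<bar> \<le> B" using h(2) by (auto simp: bounded_iff)
    then show ?thesis by (intro integrable_const_bound[where B=B] meas h(1)) auto
  qed
  let ?P = "\<lambda>f. \<forall>e>0. \<exists>h. continuous_on UNIV h \<and> bounded (range h) \<and> (\<integral>x. \<bar>f x - h x\<bar> \<partial>M) < e"
  from f have "?P f"
  proof (induction rule: integrable_induct)
    case (base A c)
    show ?case
    proof (intro allI impI)
      fix e :: real assume e: "0 < e"
      define d where "d = e / (2 * (\<bar>c\<bar> + 1))"
      have d: "0 < d" using e by (simp add: d_def)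
      have A: "A \<in> sets borel" using base M(2) by simp
      have "emeasure M A - ennreal d < emeasure M A \<or> measure M A < d"
      proof (cases "measure M A < d")
        case False
        then show ?thesis using d by (simp add: emeasure_eq_measure ennreal_minus ennreal_less_iff)
      qed simp
      then obtain K where K: "K \<subseteq> A" "closed K" "measure M A < measure M K + d"
      proof
        assume "measure M A < d"
        then show thesis using that[of "{}"] by simp
      next
        assume "emeasure M A - ennreal d < emeasure M A"
        also have "emeasure M A = (SUP K \<in> {K. K \<subseteq> A \<and> compact K}. emeasure M K)"
          by (rule inner_regular[OF M(2) _ A]) (simp add: space emeasure_eq_measure)
        finally obtain K where K: "K \<subseteq> A" "compact K" "emeasure M A - ennreal d < emeasure M K"
          by (auto simp: less_SUP_iff)
        have "measure M A < measure M K + d"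
        proof (cases "measure M A < d")
          case True then show ?thesis using measure_nonneg[of M K] by linarith
        next
          case False
          then show ?thesis using K(3) d by (simp add: emeasure_eq_measure ennreal_minus ennreal_less_iff)
        qed
        with K show thesis using that[of K] compact_imp_closed by blast
      qed
      have Ks: "K \<in> sets M" using K(2) M(2) by simp
      have "measure M (A - K) < d"
        using finite_measure_Diff[OF base(1) Ks K(1)] K(3) by simp
      moreover have "(\<integral>x. \<bar>indicat_real A x - indicat_real K x\<bar> \<partial>M) = measure M (A - K)"
      proof -
        have "(\<integral>x. \<bar>indicat_real A x - indicat_real K x\<bar> \<partial>M) = (\<integral>x. indicator (A - K) x \<partial>M)"
          using K(1) by (intro Bochner_Integration.integral_cong) (auto simp: indicator_def)
        then show ?thesis using space by simp
      qed
      ultimately have AK: "(\<integral>x. \<bar>indicat_real A x - indicat_real K x\<bar> \<partial>M) < d" by simp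
      obtain h :: "'a \<Rightarrow> real" where h: "continuous_on UNIV h" "bounded (range h)" "(\<integral>x. \<bar>indicat_real K x - h x\<bar> \<partial>M) < d"
      proof (cases "K = {}")
        case True
        then show thesis using that[of "\<lambda>_. 0"] d by auto
      next
        case False
        define s where "s n x = max 0 (1 - real n * infdist x K)" for n x
        have s: "continuous_on UNIV (s n)" "0 \<le> s n x" "s n x \<le> 1" for n x
          unfolding s_def by (rule continuous_closed_indicator_approximant closed_indicator_approximant_range)+
        note [measurable] = meas[OF s(1)] Ks
        have s_lim: "(\<lambda>n. s n x) \<longlonglongrightarrow> indicator K x" for x
          unfolding s_def by (rule closed_indicator_limit[OF K(2) False])
        have "(\<lambda>n. \<integral>x. \<bar>indicat_real K x - s n x\<bar> \<partial>M) \<longlonglongrightarrow> (\<integral>x. 0 \<partial>M)"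
        proof (rule integral_dominated_convergence[where w="\<lambda>_. 1"])
          show "AE x in M. (\<lambda>n. \<bar>indicat_real K x - s n x\<bar>) \<longlonglongrightarrow> 0"
            using tendsto_rabs_zero[OF LIM_zero[OF s_lim]] by (simp add: abs_minus_commute)
          show "AE x in M. norm \<bar>indicat_real K x - s n x\<bar> \<le> 1" for n
            using s(2,3)[of n] by (auto simp: indicator_def)
        qed auto
        then have "\<forall>\<^sub>F n in sequentially. (\<integral>x. \<bar>indicat_real K x - s n x\<bar> \<partial>M) < d"
          using d by (intro order_tendstoD(2)) auto
        then obtain n where "(\<integral>x. \<bar>indicat_real K x - s n x\<bar> \<partial>M) < d"
          by (meson eventually_happens sequentially_bot)
        moreover have "bounded (range (s n))"
          using s(2,3)[of n] by (auto simp: bounded_iff intro!: exI[of _ 1])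
        ultimately show thesis using that s(1) by blast
      qed
      have i1: "integrable M (\<lambda>x. \<bar>indicat_real A x - indicat_real K x\<bar> :: real)" "integrable M (\<lambda>x. \<bar>indicat_real K x - h x\<bar>)"
        using base(1) Ks by (auto intro!: Bochner_Integration.integrable_diff int[OF h(1,2)] simp: emeasure_eq_measure)
      have "(\<integral>x. \<bar>indicator A x *\<^sub>R c - c * h x\<bar> \<partial>M) \<le> (\<integral>x. \<bar>c\<bar> * (\<bar>indicat_real A x - indicat_real K x\<bar> + \<bar>indicat_real K x - h x\<bar>) \<partial>M)"
      proof (rule integral_mono)
        show "integrable M (\<lambda>x. \<bar>indicator A x *\<^sub>R c - c * h x\<bar>)"
          using base(1) int[OF h(1,2)] by (auto intro!: Bochner_Integration.integrable_diff simp: emeasure_eq_measure)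
        show "\<bar>indicator A x *\<^sub>R c - c * h x\<bar> \<le> \<bar>c\<bar> * (\<bar>indicat_real A x - indicat_real K x\<bar> + \<bar>indicat_real K x - h x\<bar>)" for x
        proof -
          have "\<bar>indicator A x *\<^sub>R c - c * h x\<bar> = \<bar>c\<bar> * \<bar>indicat_real A x - h x\<bar>"
            by (simp add: abs_mult[symmetric] algebra_simps)
          also have "\<dots> \<le> \<bar>c\<bar> * (\<bar>indicat_real A x - indicat_real K x\<bar> + \<bar>indicat_real K x - h x\<bar>)"
            by (intro mult_left_mono) linarith+
          finally show ?thesis .
        qed
      qed (use i1 in auto)
      also have "\<dots> = \<bar>c\<bar> * ((\<integral>x. \<bar>indicat_real A x - indicat_real K x\<bar> \<partial>M) + (\<integral>x. \<bar>indicat_real K x - h x\<bar> \<partial>M))"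
        using i1 by simp
      also have "\<dots> \<le> \<bar>c\<bar> * (d + d)"
        using AK h(3) by (intro mult_left_mono) linarith+
      also have "\<dots> < (\<bar>c\<bar> + 1) * (d + d)" using d by (intro mult_strict_right_mono) auto
      also have "\<dots> = e"
      proof -
        define K where "K = \<bar>c\<bar> + 1"
        have "K \<noteq> 0" unfolding K_def by linarith
        then show ?thesis unfolding d_def K_def[symmetric] by simp
      qed
      finally show "\<exists>h. continuous_on UNIV h \<and> bounded (range h) \<and> (\<integral>x. \<bar>indicator A x *\<^sub>R c - h x\<bar> \<partial>M) < e"
        using h(1) bounded_scaling[OF h(2), of c]
        by (intro exI[of _ "\<lambda>x. c * h x"]) (auto intro!: continuous_intros simp: image_image)
    qed
  next
    case (add f g)
    show ?case
    proof (intro allI impI)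
      fix e :: real assume "0 < e"
      then have e: "0 < e / 2" by simp
      from add.IH(1)[rule_format, OF e] obtain h where h: "continuous_on UNIV h" "bounded (range h)" "(\<integral>x. \<bar>f x - h x\<bar> \<partial>M) < e / 2" by blast
      from add.IH(2)[rule_format, OF e] obtain k where k: "continuous_on UNIV k" "bounded (range k)" "(\<integral>x. \<bar>g x - k x\<bar> \<partial>M) < e / 2" by blast
      note i = add.hyps int[OF h(1,2)] int[OF k(1,2)]
      have "(\<integral>x. \<bar>f x + g x - (h x + k x)\<bar> \<partial>M) \<le> (\<integral>x. \<bar>f x - h x\<bar> + \<bar>g x - k x\<bar> \<partial>M)"
        using i by (intro integral_mono) auto
      also have "\<dots> < e" using h(3) k(3) i by simp
      finally show "\<exists>h. continuous_on UNIV h \<and> bounded (range h) \<and> (\<integral>x. \<bar>f x + g x - h x\<bar> \<partial>M) < e"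
        using h k by (intro exI[of _ "\<lambda>x. h x + k x"]) (auto intro!: continuous_intros bounded_plus_comp)
    qed
  next
    case (lim f s)
    show ?case
    proof (intro allI impI)
      fix e :: real assume "0 < e"
      then have e: "0 < e / 2" by simp
      have "(\<lambda>i. \<integral>x. \<bar>f x - s i x\<bar> \<partial>M) \<longlonglongrightarrow> (\<integral>x. 0 \<partial>M)"
      proof (rule integral_dominated_convergence[where w="\<lambda>x. 3 * \<bar>f x\<bar>"])
        show "AE x in M. (\<lambda>i. \<bar>f x - s i x\<bar>) \<longlonglongrightarrow> 0"
        proof (rule AE_I2)
          fix x assume x: "x \<in> space M"
          from tendsto_rabs_zero[OF LIM_zero[OF lim.hyps(2)[OF x]]]
          show "(\<lambda>i. \<bar>f x - s i x\<bar>) \<longlonglongrightarrow> 0" by (subst abs_minus_commute)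
        qed
        show "AE x in M. norm \<bar>f x - s i x\<bar> \<le> 3 * \<bar>f x\<bar>" for i
        proof (rule AE_I2)
          fix x assume "x \<in> space M"
          from lim.hyps(3)[OF this, of i] show "norm \<bar>f x - s i x\<bar> \<le> 3 * \<bar>f x\<bar>" by simp
        qed
      qed (use lim.hyps in auto)
      then have "\<forall>\<^sub>F i in sequentially. (\<integral>x. \<bar>f x - s i x\<bar> \<partial>M) < e / 2"
        using e by (intro order_tendstoD(2)) auto
      then obtain i where i: "(\<integral>x. \<bar>f x - s i x\<bar> \<partial>M) < e / 2"
        by (meson eventually_happens sequentially_bot)
      from lim.IH[of i, rule_format, OF e] obtain h where h: "continuous_on UNIV h" "bounded (range h)" "(\<integral>x. \<bar>s i x - h x\<bar> \<partial>M) < e / 2" by blast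
      have "(\<integral>x. \<bar>f x - h x\<bar> \<partial>M) \<le> (\<integral>x. \<bar>f x - s i x\<bar> + \<bar>s i x - h x\<bar> \<partial>M)"
        using lim.hyps(1,4) int[OF h(1,2)] by (intro integral_mono) auto
      also have "\<dots> < e" using h(3) i lim.hyps(1,4) int[OF h(1,2)] by simp
      finally show "\<exists>h. continuous_on UNIV h \<and> bounded (range h) \<and> (\<integral>x. \<bar>f x - h x\<bar> \<partial>M) < e"
        using h by blast
    qed
  qed
  with e show ?thesis by blast
qed

lemma continuous_approximation_bounded:
  fixes f :: "'a::polish_space \<Rightarrow> real"
  assumes M: "finite_measure M" "sets M = sets borel"
    and f: "f \<in> borel_measurable borel" "\<And>x. \<bar>f x\<bar> \<le> B" and e: "0 < e"
  obtains h where "continuous_on UNIV h" "\<And>x. \<bar>h x\<bar> \<le> B" "(\<integral>x. \<bar>f x - h x\<bar> \<partial>M) < e"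
proof -
  interpret finite_measure M by fact
  have B: "0 \<le> B" using f(2)[of undefined] by linarith
  have mb: "g \<in> borel_measurable M" if "g \<in> borel_measurable borel" for g :: "'a \<Rightarrow> real"
    using that measurable_cong_sets[OF M(2) refl] by blast
  have int: "integrable M f" by (intro integrable_const_bound[where B=B] mb f) (use f(2) in auto)
  obtain h where h: "continuous_on UNIV h" "bounded (range h)" "(\<integral>x. \<bar>f x - h x\<bar> \<partial>M) < e"
    using continuous_dense_L1[OF M int e] by blast
  obtain C where C: "\<And>x. \<bar>h x\<bar> \<le> C" using h(2) by (auto simp: bounded_iff)
  have int_h: "integrable M h"
    by (intro integrable_const_bound[where B=C] mb borel_measurable_continuous_onI h(1)) (use C in auto)
  let ?k = "\<lambda>x. max (- B) (min B (h x))"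
  have k: "continuous_on UNIV ?k" by (intro continuous_intros h(1))
  have kB: "\<bar>?k x\<bar> \<le> B" for x using B by auto
  have int_k: "integrable M ?k"
    by (intro integrable_const_bound[where B=B] mb borel_measurable_continuous_onI k) (use kB in auto)
  have "(\<integral>x. \<bar>f x - ?k x\<bar> \<partial>M) \<le> (\<integral>x. \<bar>f x - h x\<bar> \<partial>M)"
  proof (rule integral_mono)
    show "\<bar>f x - ?k x\<bar> \<le> \<bar>f x - h x\<bar>" for x using f(2)[of x] by (auto simp: max_def min_def abs_if split: if_splits)
  qed (use int int_h int_k in auto)
  with h(3) show thesis by (intro that[of ?k] k kB) linarith
qed

text \<open>
  Continuous functions determine the measure of closed sets, which form a generator stable under intersections.
\<close>

lemma finite_measure_eq_if_continuous_integrals_eq: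
  fixes M N :: "'a::metric_space measure"
  assumes M: "finite_measure M" "sets M = sets borel" and N: "finite_measure N" "sets N = sets borel"
    and eq: "\<And>f :: 'a \<Rightarrow> real. continuous_on UNIV f \<Longrightarrow> bounded (range f) \<Longrightarrow> (\<integral>x. f x \<partial>M) = (\<integral>x. f x \<partial>N)"
  shows "M = N"
proof -
  interpret M: finite_measure M by fact
  interpret N: finite_measure N by fact
  have closed_eq: "emeasure M K = emeasure N K" if K: "closed K" for K
  proof (cases "K = {}")
    case False
    define s where "s n x = max 0 (1 - real n * infdist x K)" for n x
    have s: "continuous_on UNIV (s n)" "0 \<le> s n x" "s n x \<le> 1" for n x
      unfolding s_def by (rule continuous_closed_indicator_approximant closed_indicator_approximant_range)+
    have s_lim: "(\<lambda>n. s n x) \<longlonglongrightarrow> indicator K x" for x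
      unfolding s_def by (rule closed_indicator_limit[OF K False])
    have lim: "(\<lambda>n. \<integral>x. s n x \<partial>L) \<longlonglongrightarrow> measure L K" if L: "finite_measure L" "sets L = sets borel" for L
    proof -
      interpret L: finite_measure L by fact
      have mL: "s n \<in> borel_measurable L" for n
        using borel_measurable_continuous_onI[OF s(1)] measurable_cong_sets[OF L(2) refl] by blast
      have KL: "K \<in> sets L" using K L(2) by simp
      have "(\<lambda>n. \<integral>x. s n x \<partial>L) \<longlonglongrightarrow> (\<integral>x. indicator K x \<partial>L)"
        by (rule integral_dominated_convergence[where w="\<lambda>_. 1"]) (use s s_lim mL KL in auto)
      then show ?thesis using KL sets_eq_imp_space_eq[OF L(2)] by simp
    qed
    have "bounded (range (s n))" for n
      using s(2,3)[of n] by (auto simp: bounded_iff intro!: exI[of _ 1])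
    then have "(\<integral>x. s n x \<partial>M) = (\<integral>x. s n x \<partial>N)" for n by (intro eq s(1))
    then have "measure M K = measure N K"
      using lim[OF M] lim[OF N] LIMSEQ_unique by simp
    then show ?thesis by (simp add: M.emeasure_eq_measure N.emeasure_eq_measure)
  qed simp
  show ?thesis
  proof (rule measure_eqI_generator_eq[where E="Collect closed" and \<Omega>=UNIV and A="\<lambda>_. UNIV"])
    show "Int_stable (Collect closed :: 'a set set)" by (auto simp: Int_stable_def)
    show "sets M = sigma_sets UNIV (Collect closed)" "sets N = sigma_sets UNIV (Collect closed)"
      using M(2) N(2) by (simp_all add: borel_eq_closed sets_measure_of)
  qed (use closed_eq M.emeasure_eq_measure in auto)
qed


section \<open>Entropy seen by a stationary measure\<close>

text \<open>
  The Donsker-Varadhan functional for the relative entropy of the translate \<open>g\<eta>\<close> with respect to \<open>\<eta>\<close>.  For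
  bounded continuous \<open>\<psi>\<close> and a continuous action it is weakly continuous in \<open>\<eta>\<close>.
\<close>

definition boundary_gain :: "('g \<Rightarrow> 'x \<Rightarrow> 'x) \<Rightarrow> 'x measure \<Rightarrow> 'g \<Rightarrow> ('x \<Rightarrow> real) \<Rightarrow> real" where
  "boundary_gain act \<eta> g \<psi> = (\<integral>x. \<psi> (act g x) \<partial>\<eta>) - (\<integral>x. exp (\<psi> x) \<partial>\<eta>) + 1"

lemma (in prob_space) exp_expectation_le:
  fixes X :: "'a \<Rightarrow> real"
  assumes X: "integrable M X" "integrable M (\<lambda>x. exp (X x))"
  shows "exp (expectation X) \<le> expectation (\<lambda>x. exp (X x))"
proof -
  let ?a = "expectation X"
  have "exp ?a = expectation (\<lambda>x. exp ?a * (1 + (X x - ?a)))"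
    using X by (simp add: prob_space algebra_simps)
  also have "\<dots> \<le> expectation (\<lambda>x. exp (X x))"
  proof (rule integral_mono)
    show "exp ?a * (1 + (X x - ?a)) \<le> exp (X x)" for x
    proof -
      have "exp ?a * (1 + (X x - ?a)) \<le> exp ?a * exp (X x - ?a)"
        by (intro mult_left_mono exp_ge_add_one_self) simp
      then show ?thesis by (simp add: exp_add[symmetric])
    qed
  qed (use X in auto)
  finally show ?thesis .
qed

locale stationary_measure = group_pmf G \<mu> for G (structure) and \<mu> +
  fixes act :: "'a \<Rightarrow> 'x::polish_space \<Rightarrow> 'x" and \<eta> :: "'x measure"
  assumes action: "continuous_action G act"
    and prob: "prob_space \<eta>" and sets_eta [measurable_cong]: "sets \<eta> = sets borel"
    and stationary: "\<And>(f :: 'x \<Rightarrow> real) B. f \<in> borel_measurable borel \<Longrightarrow> (\<And>x. \<bar>f x\<bar> \<le> B) \<Longrightarrow>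
       (\<integral>x. f x \<partial>\<eta>) = expect \<mu> (\<lambda>h. \<integral>x. f (act h x) \<partial>\<eta>)"
begin

lemmas act_measurable = measurable_continuous_action[OF action]

interpretation E: prob_space \<eta> by (rule prob)

lemma integral_bound:
  fixes f :: "'x \<Rightarrow> real"
  assumes f: "f \<in> borel_measurable borel" "\<And>x. \<bar>f x\<bar> \<le> B"
  shows "integrable \<eta> f" "\<bar>\<integral>x. f x \<partial>\<eta>\<bar> \<le> B"
proof -
  have B: "0 \<le> B" using f(2)[of undefined] by linarith
  show int: "integrable \<eta> f"
    using f by (intro E.integrable_const_bound[where B=B]) (auto simp: measurable_cong_sets[OF sets_eta refl])
  have "\<bar>\<integral>x. f x \<partial>\<eta>\<bar> \<le> (\<integral>x. \<bar>f x\<bar> \<partial>\<eta>)" by (rule integral_abs_bound)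
  also have "\<dots> \<le> (\<integral>x. B \<partial>\<eta>)" using int f(2) by (intro integral_mono) auto
  finally show "\<bar>\<integral>x. f x \<partial>\<eta>\<bar> \<le> B" by (simp add: E.prob_space)
qed

lemma stationary_pow:
  fixes f :: "'x \<Rightarrow> real"
  assumes f: "f \<in> borel_measurable borel" "\<And>x. \<bar>f x\<bar> \<le> B"
  shows "expect (pow n) (\<lambda>h. \<integral>x. f (act h x) \<partial>\<eta>) = (\<integral>x. f x \<partial>\<eta>)"
proof (induction n)
  case 0
  then show ?case by (simp add: continuous_action_one[OF action])
next
  case (Suc n)
  have bound: "\<bar>\<integral>x. f (act h x) \<partial>\<eta>\<bar> \<le> B" if "h \<in> carrier G" for h
    using f by (intro integral_bound measurable_compose[OF act_measurable[OF that]]) auto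
  have "expect (pow (Suc n)) (\<lambda>h. \<integral>x. f (act h x) \<partial>\<eta>)
      = expect (pow n) (\<lambda>k. expect \<mu> (\<lambda>h. \<integral>x. f (act (k \<otimes> h) x) \<partial>\<eta>))"
    by (rule expectation_pow_Suc[where B=B]) (rule bound)
  also have "\<dots> = expect (pow n) (\<lambda>k. \<integral>x. f (act k x) \<partial>\<eta>)"
  proof (intro integral_cong_AE, unfold AE_measure_pmf_iff, simp_all, intro ballI)
    fix k assume "k \<in> set_pmf (pow n)"
    then have k: "k \<in> carrier G" using set_pow by auto
    have "(\<integral>x. f (act k x) \<partial>\<eta>) = expect \<mu> (\<lambda>h. \<integral>x. f (act k (act h x)) \<partial>\<eta>)"
      using f by (intro stationary[where B=B] measurable_compose[OF act_measurable[OF k]]) auto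
    also have "\<dots> = expect \<mu> (\<lambda>h. \<integral>x. f (act (k \<otimes> h) x) \<partial>\<eta>)"
      using support k by (intro integral_cong_AE) (auto simp: AE_measure_pmf_iff continuous_action_compose[OF action] subset_iff)
    finally show "expect \<mu> (\<lambda>h. \<integral>x. f (act (k \<otimes> h) x) \<partial>\<eta>) = (\<integral>x. f (act k x) \<partial>\<eta>)" by simp
  qed
  finally show ?case using Suc by simp
qed

text \<open>
  Data processing for the kernel \<open>y \<mapsto> y\<eta>\<close>: the test function \<open>\<psi>\<close> on the space is averaged to
  \<open>T y = \<integral>\<psi> d(y\<eta>)\<close> on the group.  Stationarity identifies the first integrals, and Jensen's inequality
  compares the exponential ones.
\<close>

lemma boundary_gain_le_relative_entropy:
  fixes \<psi> :: "'x \<Rightarrow> real"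
  assumes \<psi>: "\<psi> \<in> borel_measurable borel" "\<And>x. \<bar>\<psi> x\<bar> \<le> B" and g: "g \<in> set_pmf \<mu>"
  shows "boundary_gain act \<eta> g \<psi> \<le> relative_entropy (map_pmf (\<lambda>h. g \<otimes> h) (pow n)) (convolution_pmf G \<mu> (pow n))"
proof -
  have gC: "g \<in> carrier G" using g support by auto
  define T where "T y = (if y \<in> carrier G then \<integral>x. \<psi> (act y x) \<partial>\<eta> else 0)" for y
  have B: "0 \<le> B" using \<psi>(2)[of undefined] by linarith
  have comp: "(\<lambda>x. \<psi> (act y x)) \<in> borel_measurable borel" if "y \<in> carrier G" for y
    by (rule measurable_compose[OF act_measurable[OF that] \<psi>(1)])
  have T_bound: "\<bar>T y\<bar> \<le> B" for y
    using integral_bound[OF comp \<psi>(2)] B by (auto simp: T_def)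
  have e\<psi>: "(\<lambda>x. exp (\<psi> x)) \<in> borel_measurable borel" "\<And>x. \<bar>exp (\<psi> x)\<bar> \<le> exp B"
    using \<psi> by (auto simp: abs_le_iff)
  have "expect (map_pmf (\<lambda>h. g \<otimes> h) (pow n)) T = expect (pow n) (\<lambda>h. \<integral>x. \<psi> (act g (act h x)) \<partial>\<eta>)"
    unfolding integral_map_pmf using set_pow[of n] gC
    by (intro integral_cong_AE) (auto simp: AE_measure_pmf_iff T_def continuous_action_compose[OF action] subset_iff)
  also have "\<dots> = (\<integral>x. \<psi> (act g x) \<partial>\<eta>)"
    by (rule stationary_pow[OF comp[OF gC] \<psi>(2)])
  finally have 1: "expect (map_pmf (\<lambda>h. g \<otimes> h) (pow n)) T = (\<integral>x. \<psi> (act g x) \<partial>\<eta>)" .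
  have "expect (pow (Suc n)) (\<lambda>y. exp (T y)) \<le> expect (pow (Suc n)) (\<lambda>y. \<integral>x. exp (\<psi> (act y x)) \<partial>\<eta>)"
  proof (rule expectation_pmf_mono)
    have bb: "\<bar>\<integral>x. exp (\<psi> (act y x)) \<partial>\<eta>\<bar> \<le> exp B" "integrable \<eta> (\<lambda>x. exp (\<psi> (act y x)))" if "y \<in> carrier G" for y
      using integral_bound[OF measurable_compose[OF act_measurable[OF that] e\<psi>(1)] e\<psi>(2)] by auto
    show "integrable (measure_pmf (pow (Suc n))) (\<lambda>y. exp (T y))"
      using T_bound by (intro integrable_pmf_bounded[where B="exp B"]) (auto simp: abs_le_iff)
    show "integrable (measure_pmf (pow (Suc n))) (\<lambda>y. \<integral>x. exp (\<psi> (act y x)) \<partial>\<eta>)"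
      using bb set_pow[of "Suc n"] by (intro integrable_pmf_bounded[where B="exp B"]) blast
    fix y assume "y \<in> set_pmf (pow (Suc n))"
    then have y: "y \<in> carrier G" using set_pow by blast
    show "exp (T y) \<le> (\<integral>x. exp (\<psi> (act y x)) \<partial>\<eta>)"
      using y E.exp_expectation_le[OF integral_bound(1)[OF comp[OF y] \<psi>(2)] bb(2)[OF y]] by (simp add: T_def)
  qed
  also have "\<dots> = (\<integral>x. exp (\<psi> x) \<partial>\<eta>)" by (rule stationary_pow[OF e\<psi>])
  finally have 2: "expect (convolution_pmf G \<mu> (pow n)) (\<lambda>y. exp (T y)) \<le> (\<integral>x. exp (\<psi> x) \<partial>\<eta>)"
    unfolding pow_Suc_left .
  interpret dominated_pmf "map_pmf (\<lambda>h. g \<otimes> h) (pow n)" "convolution_pmf G \<mu> (pow n)" "pmf \<mu> g"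
    by (rule dominated_convolution[OF g])
  show ?thesis
    using relative_entropy_ge[of T B, OF T_bound] 1 2 unfolding boundary_gain_def by linarith
qed

proposition sum_boundary_gain_le_asymptotic_entropy:
  assumes fin: "pmf_finite_entropy \<mu>"
    and S: "finite S" and \<psi>: "\<And>g. g \<in> S \<Longrightarrow> \<psi> g \<in> borel_measurable borel" "\<And>g x. g \<in> S \<Longrightarrow> \<bar>\<psi> g x\<bar> \<le> B g"
  shows "(\<Sum>g\<in>S. pmf \<mu> g * boundary_gain act \<eta> g (\<psi> g)) \<le> asymptotic_entropy G \<mu>"
proof -
  interpret group_pmf_finite_entropy G \<mu> by standard (rule fin)
  show ?thesis
  proof (rule asymptotic_entropy_ge)
    fix n
    let ?D = "\<lambda>g. relative_entropy (map_pmf (\<lambda>h. g \<otimes> h) (pow n)) (convolution_pmf G \<mu> (pow n))"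
    have D: "0 \<le> ?D g" if "g \<in> set_pmf \<mu>" for g
      by (rule dominated_pmf.relative_entropy_nonneg[OF dominated_convolution[OF that]])
    have int: "integrable (measure_pmf \<mu>) ?D"
      by (rule integrable_relative_entropy_convolution[OF support fin set_pow fin_pow])
    have "(\<Sum>g\<in>S. pmf \<mu> g * boundary_gain act \<eta> g (\<psi> g)) \<le> (\<Sum>g\<in>S. indicator S g * ?D g * pmf \<mu> g)"
    proof (rule sum_mono)
      fix g assume g: "g \<in> S"
      show "pmf \<mu> g * boundary_gain act \<eta> g (\<psi> g) \<le> indicator S g * ?D g * pmf \<mu> g"
      proof (cases "g \<in> set_pmf \<mu>")
        case True
        then show ?thesis
          using boundary_gain_le_relative_entropy[OF \<psi>(1)[OF g] \<psi>(2)[OF g] True, of n] g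
          by (simp add: mult.commute mult_left_mono)
      qed (simp add: set_pmf_iff)
    qed
    also have "\<dots> = expect \<mu> (\<lambda>g. indicator S g * ?D g)"
      by (rule integral_measure_pmf_real[symmetric, OF S]) (auto simp: indicator_def split: if_splits)
    also have "\<dots> \<le> expect \<mu> ?D"
    proof (rule expectation_pmf_mono[OF _ int])
      show "integrable (measure_pmf \<mu>) (\<lambda>g. indicator S g * ?D g)"
        by (rule Bochner_Integration.integrable_bound[OF int]) (auto simp: indicator_def)
    qed (use D in \<open>auto simp: indicator_def\<close>)
    also have "\<dots> = pmf_entropy (pow (Suc n)) - pmf_entropy (pow n)"
      using pmf_entropy_convolution[OF support fin set_pow fin_pow, of n] unfolding pow_Suc_left by linarith
    finally show "(\<Sum>g\<in>S. pmf \<mu> g * boundary_gain act \<eta> g (\<psi> g)) \<le> pmf_entropy (pow (Suc n)) - pmf_entropy (pow n)" .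
  qed
qed

end


section \<open>The Poisson boundary carries the whole asymptotic entropy\<close>

lemma exp_lipschitz:
  fixes a b :: real
  assumes "a \<le> B" "b \<le> B"
  shows "\<bar>exp a - exp b\<bar> \<le> exp B * \<bar>a - b\<bar>"
proof -
  have *: "exp y - exp x \<le> exp B * (y - x)" if "x \<le> y" "y \<le> B" for x y :: real
  proof -
    have "exp y * (1 + (x - y)) \<le> exp y * exp (x - y)"
      by (intro mult_left_mono exp_ge_add_one_self) simp
    then have "exp y - exp x \<le> exp y * (y - x)" by (simp add: exp_add[symmetric] algebra_simps)
    also have "\<dots> \<le> exp B * (y - x)" using that by (intro mult_right_mono) auto
    finally show ?thesis .
  qed
  show ?thesis using *[of a b] *[of b a] assms by (cases "a \<le> b") auto
qed

lemma (in group_pmf) harmonic_limit: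
  assumes lim: "\<And>g. g \<in> carrier G \<Longrightarrow> (\<lambda>n. u n g) \<longlonglongrightarrow> u' g"
    and bound: "\<And>n g. g \<in> carrier G \<Longrightarrow> \<bar>u n g\<bar> \<le> K"
    and near: "\<And>n g. g \<in> carrier G \<Longrightarrow> \<bar>expect \<mu> (\<lambda>h. u n (g \<otimes> h)) - u n g\<bar> \<le> d n"
    and d: "d \<longlonglongrightarrow> 0"
  shows "harmonic u'"
  unfolding harmonic_def
proof
  fix g assume g: "g \<in> carrier G"
  have "(\<lambda>n. expect \<mu> (\<lambda>h. u n (g \<otimes> h))) \<longlonglongrightarrow> expect \<mu> (\<lambda>h. u' (g \<otimes> h))"
    using support g lim bound
    by (intro integral_dominated_convergence[where w="\<lambda>_. K"]) (auto simp: AE_measure_pmf_iff subset_iff)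
  from tendsto_diff[OF this lim[OF g]]
  have "(\<lambda>n. expect \<mu> (\<lambda>h. u n (g \<otimes> h)) - u n g) \<longlonglongrightarrow> expect \<mu> (\<lambda>h. u' (g \<otimes> h)) - u' g" .
  moreover have "(\<lambda>n. expect \<mu> (\<lambda>h. u n (g \<otimes> h)) - u n g) \<longlonglongrightarrow> 0"
    by (rule Lim_null_comparison[OF _ d]) (use near[OF g] in auto)
  ultimately show "u' g = expect \<mu> (\<lambda>h. u' (g \<otimes> h))"
    using LIMSEQ_unique by fastforce
qed

text \<open>
  For \<open>m\<close> on the group this bounds the total variation norm of \<open>\<mu> * m - m\<close> by \<open>\<delta>\<close>.
\<close>

definition (in group_pmf) almost_invariant :: "real \<Rightarrow> 'a pmf \<Rightarrow> bool" where
  "almost_invariant \<delta> m \<longleftrightarrow> (\<forall>f B. (\<forall>g\<in>carrier G. \<bar>f g\<bar> \<le> B) \<longrightarrow>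
     \<bar>expect (convolution_pmf G \<mu> m) f - expect m f\<bar> \<le> \<delta> * (B :: real))"

lemma (in group_pmf) almost_invariantD:
  assumes "almost_invariant \<delta> m" "\<And>g. g \<in> carrier G \<Longrightarrow> \<bar>f g\<bar> \<le> B"
  shows "\<bar>expect (convolution_pmf G \<mu> m) f - expect m f\<bar> \<le> \<delta> * B"
  using assms by (auto simp: almost_invariant_def)

sublocale walk_boundary \<subseteq> stationary_measure G \<mu> act \<nu>
proof (intro stationary_measure.intro stationary_measure_axioms.intro group_pmf_axioms action prob_space_boundary)
  show "sets \<nu> = sets borel" unfolding bnd_distr[symmetric] by simp
qed (rule stationary_integral)

context walk_boundary
begin

text \<open>
  A stationary measure dominates \<open>\<mu>(g)\<close> times its translate by \<open>g\<close>, so approximation in \<open>L\<^sup>1(\<nu>)\<close> implies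
  approximation with respect to the translate.
\<close>

lemma integral_act_le:
  fixes f :: "'x \<Rightarrow> real"
  assumes f: "f \<in> borel_measurable borel" "\<And>x. 0 \<le> f x" "\<And>x. f x \<le> B" and g: "g \<in> carrier G"
  shows "pmf \<mu> g * (\<integral>x. f (act g x) \<partial>\<nu>) \<le> (\<integral>x. f x \<partial>\<nu>)"
proof -
  have fB: "\<bar>f x\<bar> \<le> B" for x using f(2)[of x] f(3)[of x] by simp
  have bound: "\<bar>\<integral>x. f (act h x) \<partial>\<nu>\<bar> \<le> B" if "h \<in> carrier G" for h
    using integral_bound[OF measurable_compose[OF act_measurable[OF that] f(1)] fB] by simp
  have "pmf \<mu> g * (\<integral>x. f (act g x) \<partial>\<nu>) = expect \<mu> (\<lambda>h. indicator {g} h * (\<integral>x. f (act h x) \<partial>\<nu>))"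
    by (subst integral_measure_pmf_real[where A="{g}"]) (auto simp: indicator_def)
  also have "\<dots> \<le> expect \<mu> (\<lambda>h. \<integral>x. f (act h x) \<partial>\<nu>)"
    using bound support f(2)
    by (intro expectation_pmf_mono integrable_pmf_bounded[where B=B])
      (auto simp: indicator_def subset_iff intro!: integral_nonneg_AE order_trans[OF abs_ge_zero bound[OF g]])
  also have "\<dots> = (\<integral>x. f x \<partial>\<nu>)" by (rule stationary[OF f(1) fB, symmetric])
  finally show ?thesis .
qed

lemma boundary_gain_continuous_approximation:
  fixes \<Psi> :: "'x \<Rightarrow> real"
  assumes \<Psi>: "\<Psi> \<in> borel_measurable borel" "\<And>x. \<bar>\<Psi> x\<bar> \<le> B" and g: "g \<in> set_pmf \<mu>" and e: "0 < e"
  obtains \<psi> where "continuous_on UNIV \<psi>" "\<And>x. \<bar>\<psi> x\<bar> \<le> B" "boundary_gain act \<nu> g \<Psi> \<le> boundary_gain act \<nu> g \<psi> + e"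
proof -
  have gC: "g \<in> carrier G" using g support by auto
  have p: "0 < pmf \<mu> g" using g by (rule pmf_positive)
  \<comment> \<open>The Lipschitz constant of the gain with respect to the \<open>L\<^sup>1(\<nu>)\<close> norm, on functions bounded by \<open>B\<close>.\<close>
  define c where "c = 1 / pmf \<mu> g + exp B"
  have c: "0 < c" using p by (simp add: c_def add_pos_pos)
  interpret prob_space \<nu> by (rule prob)
  obtain \<psi> where \<psi>: "continuous_on UNIV \<psi>" "\<And>x. \<bar>\<psi> x\<bar> \<le> B" "(\<integral>x. \<bar>\<Psi> x - \<psi> x\<bar> \<partial>\<nu>) < e / c"
    by (rule continuous_approximation_bounded[OF finite_measure_axioms sets_eta \<Psi>, of "e / c"]) (use e c in auto)
  have m\<psi>: "\<psi> \<in> borel_measurable borel" by (rule borel_measurable_continuous_onI[OF \<psi>(1)])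
  define I where "I = (\<integral>x. \<bar>\<Psi> x - \<psi> x\<bar> \<partial>\<nu>)"
  have mI: "(\<lambda>x. \<bar>\<Psi> x - \<psi> x\<bar>) \<in> borel_measurable borel" using \<Psi> m\<psi> by measurable
  have bI: "\<bar>\<Psi> x - \<psi> x\<bar> \<le> 2 * B" for x using \<Psi>(2)[of x] \<psi>(2)[of x] by linarith
  note ia = act_measurable[OF gC]
  note int = integral_bound(1)[OF measurable_compose[OF ia \<Psi>(1)] \<Psi>(2)] integral_bound(1)[OF measurable_compose[OF ia m\<psi>] \<psi>(2)]
  have "(\<integral>x. \<Psi> (act g x) \<partial>\<nu>) - (\<integral>x. \<psi> (act g x) \<partial>\<nu>) = (\<integral>x. \<Psi> (act g x) - \<psi> (act g x) \<partial>\<nu>)"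
    using int by simp
  also have "\<dots> \<le> (\<integral>x. \<bar>\<Psi> (act g x) - \<psi> (act g x)\<bar> \<partial>\<nu>)" using int by (intro integral_mono) auto
  also have "\<dots> \<le> (1 / pmf \<mu> g) * I"
    using integral_act_le[OF mI _ bI gC] p by (simp add: I_def field_simps)
  finally have 1: "(\<integral>x. \<Psi> (act g x) \<partial>\<nu>) \<le> (\<integral>x. \<psi> (act g x) \<partial>\<nu>) + (1 / pmf \<mu> g) * I" by simp
  have eint: "integrable \<nu> (\<lambda>x. exp (\<Psi> x))" "integrable \<nu> (\<lambda>x. exp (\<psi> x))"
    using \<Psi> \<psi> m\<psi> by (intro integral_bound(1)[where B="exp B"]; auto simp: abs_le_iff)+
  have "(\<integral>x. exp (\<psi> x) \<partial>\<nu>) - (\<integral>x. exp (\<Psi> x) \<partial>\<nu>) = (\<integral>x. exp (\<psi> x) - exp (\<Psi> x) \<partial>\<nu>)"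
    using eint by simp
  also have "\<dots> \<le> (\<integral>x. exp B * \<bar>\<Psi> x - \<psi> x\<bar> \<partial>\<nu>)"
  proof (rule integral_mono)
    show "exp (\<psi> x) - exp (\<Psi> x) \<le> exp B * \<bar>\<Psi> x - \<psi> x\<bar>" for x
      using exp_lipschitz[of "\<Psi> x" B "\<psi> x"] \<Psi>(2)[of x] \<psi>(2)[of x] by (simp add: abs_le_iff)
  qed (use eint integral_bound(1)[OF mI] bI in auto)
  also have "\<dots> = exp B * I" by (simp add: I_def)
  finally have 2: "(\<integral>x. exp (\<psi> x) \<partial>\<nu>) \<le> (\<integral>x. exp (\<Psi> x) \<partial>\<nu>) + exp B * I" by simp
  have "(1 / pmf \<mu> g) * I + exp B * I = c * I" by (simp add: c_def algebra_simps)
  also have "\<dots> \<le> e" using \<psi>(3) c by (simp add: I_def field_simps)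
  finally have "boundary_gain act \<nu> g \<Psi> \<le> boundary_gain act \<nu> g \<psi> + e"
    using 1 2 unfolding boundary_gain_def by linarith
  with \<psi> that show thesis by blast
qed

text \<open>
  This is where the Poisson boundary is shown to retain all the information: relative entropies of almost invariant
  measures on the group are turned into gains on the boundary.  The truncated logarithmic densities \<open>T n\<close> need not
  have a limit on the group that carries this information, but their averages \<open>u n\<close> and those of their exponentials, \<open>v n\<close>, converge along a subsequence to harmonic functions,
  and \<open>exp u \<le> v\<close> by Jensen's inequality.
\<close>

lemma almost_invariant_relative_entropy_le_gain:
  assumes m: "\<And>n. set_pmf (m n) \<subseteq> carrier G" and inv: "\<And>n. almost_invariant (\<delta> n) (m n)" and \<delta>: "\<delta> \<longlonglongrightarrow> 0"
    and g: "g \<in> set_pmf \<mu>" and e: "0 < e"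
  obtains \<psi> B n where "continuous_on UNIV \<psi>" "\<And>x. \<bar>\<psi> x\<bar> \<le> B"
    "relative_entropy (map_pmf (\<lambda>h. g \<otimes> h) (m n)) (convolution_pmf G \<mu> (m n)) \<le> boundary_gain act \<nu> g \<psi> + e"
proof -
  have gC: "g \<in> carrier G" using g support by auto
  \<comment> \<open>The truncation level, chosen such that the truncation error is at most \<open>e / 4\<close>.\<close>
  define M where "M = max 0 (- ln (e / 4))"
  have M: "0 \<le> M" "exp (- M) \<le> e / 4"
  proof -
    show "0 \<le> M" by (simp add: M_def)
    have "exp (- M) \<le> exp (ln (e / 4))" unfolding M_def by (subst exp_le_cancel_iff) auto
    then show "exp (- M) \<le> e / 4" using e by simp
  qed
  define K where "K = max M (- ln (pmf \<mu> g))"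
  let ?q = "\<lambda>n. map_pmf (\<lambda>h. g \<otimes> h) (m n)" and ?\<mu>m = "\<lambda>n. convolution_pmf G \<mu> (m n)"
  define T where "T n = (\<lambda>x. if x \<in> set_pmf (?q n) then max (-M) (ln (pmf (?q n) x) - ln (pmf (?\<mu>m n) x)) else - M)" for n
  have T: "\<bar>T n x\<bar> \<le> K"
    "relative_entropy (?q n) (?\<mu>m n) \<le> expect (?q n) (T n) - expect (?\<mu>m n) (\<lambda>x. exp (T n x)) + 1 + exp (-M)" for n x
    unfolding T_def K_def
    by (rule dominated_pmf.relative_entropy_le_truncation[OF dominated_convolution[OF g] M(1)])+
  have eT: "0 \<le> exp (T n x)" "exp (T n x) \<le> exp K" "\<bar>exp (T n x)\<bar> \<le> exp K" for n x
    using T(1)[of n x] by (auto simp: abs_le_iff)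
  define u where "u n \<gamma> = expect (m n) (\<lambda>h. T n (\<gamma> \<otimes> h))" for n \<gamma>
  define v where "v n \<gamma> = expect (m n) (\<lambda>h. exp (T n (\<gamma> \<otimes> h)))" for n \<gamma>
  have u_bound: "\<bar>u n \<gamma>\<bar> \<le> K" for n \<gamma> unfolding u_def by (intro abs_expectation_pmf_le T)
  have v_bound: "\<bar>v n \<gamma>\<bar> \<le> exp K" for n \<gamma> unfolding v_def by (intro abs_expectation_pmf_le eT)
  have near: "\<bar>expect \<mu> (\<lambda>h. expect (m n) (\<lambda>k. f ((\<gamma> \<otimes> h) \<otimes> k))) - expect (m n) (\<lambda>h. f (\<gamma> \<otimes> h))\<bar> \<le> \<delta> n * C"
    if f: "\<And>x. \<bar>f x\<bar> \<le> C" and \<gamma>: "\<gamma> \<in> carrier G" for f :: "'a \<Rightarrow> real" and C \<gamma> n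
  proof -
    have "expect (?\<mu>m n) (\<lambda>y. f (\<gamma> \<otimes> y)) = expect \<mu> (\<lambda>h. expect (m n) (\<lambda>k. f (\<gamma> \<otimes> (h \<otimes> k))))"
      by (rule expectation_convolution[OF support m[of n], where B=C]) (rule f)
    also have "\<dots> = expect \<mu> (\<lambda>h. expect (m n) (\<lambda>k. f ((\<gamma> \<otimes> h) \<otimes> k)))"
      using support m[of n] \<gamma>
      by (intro integral_cong_AE) (auto simp: AE_measure_pmf_iff m_assoc subset_iff intro!: integral_cong_AE)
    finally show ?thesis
      using almost_invariantD[OF inv[of n], of "\<lambda>y. f (\<gamma> \<otimes> y)" C] f by simp
  qed
  obtain r1 where r1: "strict_mono r1" "\<And>x. x \<in> carrier G \<Longrightarrow> \<exists>l. (\<lambda>n. u (r1 n) x) \<longlonglongrightarrow> l"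
    using function_convergent_subsequence[OF countable_carrier, of u K] u_bound by auto
  obtain r2 where r2: "strict_mono r2" "\<And>x. x \<in> carrier G \<Longrightarrow> \<exists>l. (\<lambda>n. v (r1 (r2 n)) x) \<longlonglongrightarrow> l"
    using function_convergent_subsequence[OF countable_carrier, of "\<lambda>n. v (r1 n)" "exp K"] v_bound by auto
  define r where "r n = r1 (r2 n)" for n
  have r: "strict_mono r" unfolding r_def using strict_mono_o[OF r1(1) r2(1)] by (simp add: o_def)
  define u' where "u' x = lim (\<lambda>n. u (r n) x)" for x
  define v' where "v' x = lim (\<lambda>n. v (r n) x)" for x
  have u': "(\<lambda>n. u (r n) x) \<longlonglongrightarrow> u' x" if "x \<in> carrier G" for x
  proof -
    obtain l where "(\<lambda>n. u (r1 n) x) \<longlonglongrightarrow> l" using r1(2) \<open>x \<in> carrier G\<close> by blast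
    from LIMSEQ_subseq_LIMSEQ[OF this r2(1)] have "convergent (\<lambda>n. u (r n) x)"
      by (auto simp: r_def o_def convergent_def)
    then show ?thesis unfolding u'_def by (simp add: convergent_LIMSEQ_iff)
  qed
  have v': "(\<lambda>n. v (r n) x) \<longlonglongrightarrow> v' x" if "x \<in> carrier G" for x
  proof -
    have "convergent (\<lambda>n. v (r n) x)" using r2(2)[OF that] by (auto simp: r_def convergent_def)
    then show ?thesis unfolding v'_def by (simp add: convergent_LIMSEQ_iff)
  qed
  have \<delta>r: "(\<lambda>n. \<delta> (r n) * C) \<longlonglongrightarrow> 0" for C
    using tendsto_mult_right[OF LIMSEQ_subseq_LIMSEQ[OF \<delta> r], of C] by (simp add: o_def)
  have hu: "harmonic u'"
    by (rule harmonic_limit[OF u' u_bound _ \<delta>r[of K]]) (auto simp: u_def intro: near T)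
  have hv: "harmonic v'"
    by (rule harmonic_limit[OF v' v_bound _ \<delta>r[of "exp K"]]) (auto simp: v_def intro: near eT)
  have u'_bound: "\<bar>u' x\<bar> \<le> K" if "x \<in> carrier G" for x
    using u_bound by (intro LIMSEQ_le_const2[OF tendsto_rabs[OF u'[OF that]]]) auto
  have v'_bound: "\<bar>v' x\<bar> \<le> exp K" if "x \<in> carrier G" for x
    using v_bound by (intro LIMSEQ_le_const2[OF tendsto_rabs[OF v'[OF that]]]) auto
  have uv: "exp (u n x) \<le> v n x" for n x
    unfolding u_def v_def using T(1)[of n] eT[of n]
    by (intro measure_pmf.exp_expectation_le integrable_pmf_bounded) auto
  have uv': "exp (u' x) \<le> v' x" if "x \<in> carrier G" for x
    using uv by (intro LIMSEQ_le[OF tendsto_exp[OF u'[OF that]] v'[OF that]]) auto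
  obtain \<Psi> where \<Psi>: "\<Psi> \<in> borel_measurable borel" "\<And>x. \<bar>\<Psi> x\<bar> \<le> K"
    "\<And>g. g \<in> set_pmf \<mu> \<Longrightarrow> (\<integral>x. \<Psi> (act g x) \<partial>\<nu>) = u' g" "(\<integral>x. exp (\<Psi> x) \<partial>\<nu>) \<le> v' \<one>"
    by (rule harmonic_poisson_representation[OF hu u'_bound hv v'_bound uv']) (assumption | rule that)+
  have gain: "u' g - v' \<one> + 1 \<le> boundary_gain act \<nu> g \<Psi>"
    using \<Psi>(3)[OF g] \<Psi>(4) by (simp add: boundary_gain_def)
  have D: "relative_entropy (?q n) (?\<mu>m n) \<le> u n g - v n \<one> + \<delta> n * exp K + 1 + e / 4" for n
  proof -
    have "expect (?q n) (T n) = u n g" by (simp add: u_def)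
    moreover have "v n \<one> = expect (m n) (\<lambda>x. exp (T n x))"
      unfolding v_def using m[of n] by (intro integral_cong_AE) (auto simp: AE_measure_pmf_iff subset_iff)
    moreover have "\<bar>expect (?\<mu>m n) (\<lambda>x. exp (T n x)) - expect (m n) (\<lambda>x. exp (T n x))\<bar> \<le> \<delta> n * exp K"
      by (rule almost_invariantD[OF inv]) (rule eT)
    ultimately show ?thesis using T(2)[of n] M(2) by linarith
  qed
  have "(\<lambda>n. u (r n) g - v (r n) \<one> + \<delta> (r n) * exp K + 1 + e / 4) \<longlonglongrightarrow> u' g - v' \<one> + 0 + 1 + e / 4"
    by (intro tendsto_intros u' v' \<delta>r gC one_closed)
  then have "\<forall>\<^sub>F n in sequentially. u (r n) g - v (r n) \<one> + \<delta> (r n) * exp K + 1 + e / 4 < u' g - v' \<one> + 1 + e / 2"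
    using e by (intro order_tendstoD(2)) auto
  then obtain n where n: "u (r n) g - v (r n) \<one> + \<delta> (r n) * exp K + 1 + e / 4 < u' g - v' \<one> + 1 + e / 2"
    by (meson eventually_happens sequentially_bot)
  have "0 < e / 2" using e by simp
  then obtain \<psi> where \<psi>: "continuous_on UNIV \<psi>" "\<And>x. \<bar>\<psi> x\<bar> \<le> K" "boundary_gain act \<nu> g \<Psi> \<le> boundary_gain act \<nu> g \<psi> + e / 2"
    by (rule boundary_gain_continuous_approximation[OF \<Psi>(1,2) g]) (assumption | rule that)+
  have "relative_entropy (?q (r n)) (?\<mu>m (r n)) \<le> boundary_gain act \<nu> g \<psi> + e"
    using D[of "r n"] n gain \<psi>(3) by linarith
  with \<psi>(1,2) show thesis by (rule that)
qed

text \<open>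
  A family of group elements needs a common index \<open>n\<close>, so the previous bound is upgraded to all large \<open>n\<close> with one
  test function: take a nearly optimal one, and apply the previous bound to a subsequence of exceptions.
\<close>

lemma eventually_relative_entropy_le_gain:
  assumes m: "\<And>n. set_pmf (m n) \<subseteq> carrier G" and inv: "\<And>n. almost_invariant (\<delta> n) (m n)" and \<delta>: "\<delta> \<longlonglongrightarrow> 0"
    and g: "g \<in> set_pmf \<mu>" and e: "0 < e"
  shows "\<exists>\<psi> B. continuous_on UNIV \<psi> \<and> (\<forall>x. \<bar>\<psi> x\<bar> \<le> B) \<and>
    (\<forall>\<^sub>F n in sequentially. relative_entropy (map_pmf (\<lambda>h. g \<otimes> h) (m n)) (convolution_pmf G \<mu> (m n)) \<le> boundary_gain act \<nu> g \<psi> + e)"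
proof -
  let ?D = "\<lambda>n. relative_entropy (map_pmf (\<lambda>h. g \<otimes> h) (m n)) (convolution_pmf G \<mu> (m n))"
  \<comment> \<open>If some gain reaches the universal bound \<open>- ln (\<mu> g)\<close> nothing is left to prove; otherwise the gains have a supremum.\<close>
  define J where "J = {boundary_gain act \<nu> g \<psi> | \<psi> B. continuous_on UNIV \<psi> \<and> (\<forall>x. \<bar>\<psi> x\<bar> \<le> (B::real))}"
  have D_le: "?D n \<le> - ln (pmf \<mu> g)" for n
    by (rule dominated_pmf.relative_entropy_le_ln[OF dominated_convolution[OF g]])
  show ?thesis
  proof (cases "\<exists>j\<in>J. - ln (pmf \<mu> g) \<le> j")
    case True
    then obtain \<psi> B where \<psi>: "continuous_on UNIV \<psi>" "\<forall>x. \<bar>\<psi> x\<bar> \<le> B" "- ln (pmf \<mu> g) \<le> boundary_gain act \<nu> g \<psi>"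
      by (auto simp: J_def)
    have "?D n \<le> boundary_gain act \<nu> g \<psi> + e" for n using D_le[of n] \<psi>(3) e by linarith
    with \<psi> show ?thesis by (intro exI[of _ \<psi>] exI[of _ B]) auto
  next
    case False
    have bdd: "bdd_above J" using False by (intro bdd_aboveI[of _ "- ln (pmf \<mu> g)"]) force
    have "boundary_gain act \<nu> g (\<lambda>_. 0) \<in> J" unfolding J_def by (auto intro!: exI[of _ "\<lambda>_. 0"] exI[of _ 0])
    then have ne: "J \<noteq> {}" by blast
    obtain j where j: "j \<in> J" "Sup J - e / 2 < j"
      using less_cSupE[OF _ ne, of "Sup J - e / 2"] e by auto
    then obtain \<psi> B where \<psi>: "continuous_on UNIV \<psi>" "\<forall>x. \<bar>\<psi> x\<bar> \<le> B" "Sup J - e / 2 < boundary_gain act \<nu> g \<psi>"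
      by (auto simp: J_def)
    have "\<forall>\<^sub>F n in sequentially. ?D n \<le> boundary_gain act \<nu> g \<psi> + e"
    proof (rule ccontr)
      assume "\<not> ?thesis"
      then have inf: "\<exists>\<^sub>F n in sequentially. \<not> ?D n \<le> boundary_gain act \<nu> g \<psi> + e"
        by (simp add: frequently_def)
      then have "infinite {n. \<not> ?D n \<le> boundary_gain act \<nu> g \<psi> + e}"
        by (simp add: frequently_cofinite[symmetric] cofinite_eq_sequentially)
      then obtain r :: "nat \<Rightarrow> nat" where r: "strict_mono r" "\<And>n. \<not> ?D (r n) \<le> boundary_gain act \<nu> g \<psi> + e"
        using infinite_enumerate by blast
      have "(\<lambda>n. \<delta> (r n)) \<longlonglongrightarrow> 0" using LIMSEQ_subseq_LIMSEQ[OF \<delta> r(1)] by (simp add: o_def)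
      moreover have "0 < e / 2" using e by simp
      ultimately obtain \<psi>' B' n where \<psi>': "continuous_on UNIV \<psi>'" "\<And>x. \<bar>\<psi>' x\<bar> \<le> B'"
          "?D (r n) \<le> boundary_gain act \<nu> g \<psi>' + e / 2"
        by (rule almost_invariant_relative_entropy_le_gain[where m="\<lambda>n. m (r n)" and \<delta>="\<lambda>n. \<delta> (r n)", OF m inv _ g])
          (assumption | rule that)+
      have "boundary_gain act \<nu> g \<psi>' \<in> J" using \<psi>' by (auto simp: J_def)
      then have "boundary_gain act \<nu> g \<psi>' \<le> Sup J" using bdd by (rule cSup_upper)
      with \<psi>'(3) \<psi>(3) r(2)[of n] show False by linarith
    qed
    with \<psi> show ?thesis by blast
  qed
qed

text \<open>
  The relative entropy at \<open>g\<close> is at most \<open>- ln (\<mu> g)\<close>, whose \<open>\<mu>\<close>-mean \<open>H(\<mu>)\<close> is finite; hence finitely many \<open>g\<close> carry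
  all but an arbitrarily small part of the entropy increment of a window.
\<close>

proposition asymptotic_entropy_le_sum_boundary_gain:
  assumes fin: "pmf_finite_entropy \<mu>" and e: "0 < e"
  obtains S \<psi> B where "finite S" "S \<subseteq> set_pmf \<mu>" "\<And>g. g \<in> S \<Longrightarrow> continuous_on UNIV (\<psi> g)"
    "\<And>g x. g \<in> S \<Longrightarrow> \<bar>\<psi> g x\<bar> \<le> B g"
    "asymptotic_entropy G \<mu> - e \<le> (\<Sum>g\<in>S. pmf \<mu> g * boundary_gain act \<nu> g (\<psi> g))"
proof -
  interpret group_pmf_finite_entropy G \<mu> by standard (rule fin)
  let ?f = "\<lambda>g. - (pmf \<mu> g * ln (pmf \<mu> g))"
  have "?f summable_on carrier G"
    using fin finite_entropy_iff[OF support] by (simp add: finite_entropy_def)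
  moreover have "(\<Sum>\<^sub>\<infinity>g\<in>carrier G. ?f g) = pmf_entropy \<mu>"
    using shannon_entropy_eq[OF support] by (simp add: shannon_entropy_def)
  ultimately have "(?f has_sum pmf_entropy \<mu>) (carrier G)" by (simp add: has_sum_infsum flip: \<open>_ = pmf_entropy \<mu>\<close>)
  then have "\<exists>F. finite F \<and> F \<subseteq> carrier G \<and> dist (sum ?f F) (pmf_entropy \<mu>) \<le> e / 4"
    using e by (intro has_sum_finite_approximation) auto
  then obtain F where F: "finite F" "F \<subseteq> carrier G" "dist (sum ?f F) (pmf_entropy \<mu>) \<le> e / 4"
    by blast
  define S where "S = F \<inter> set_pmf \<mu>"
  have S: "finite S" "S \<subseteq> set_pmf \<mu>" using F by (auto simp: S_def)
  have "sum ?f F = sum ?f S"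
    using F(1) by (intro sum.mono_neutral_right) (auto simp: S_def set_pmf_iff)
  then have tail: "pmf_entropy \<mu> - sum ?f S \<le> e / 4" using F(3) unfolding dist_real_def by linarith
  have "\<exists>j. asymptotic_entropy G \<mu> - 1 / real (Suc n) \<le> pmf_entropy (convolution_pmf G \<mu> (window (Suc n) j)) - pmf_entropy (window (Suc n) j)" for n
    by (rule window_entropy_increment[of "Suc n" "1 / real (Suc n)"]) auto
  then obtain j where j: "\<And>n. asymptotic_entropy G \<mu> - 1 / real (Suc n) \<le> pmf_entropy (convolution_pmf G \<mu> (window (Suc n) (j n))) - pmf_entropy (window (Suc n) (j n))"
    by metis
  define m where "m n = window (Suc n) (j n)" for n
  have m: "set_pmf (m n) \<subseteq> carrier G" "pmf_finite_entropy (m n)" for n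
    unfolding m_def by (intro set_window fin_window; simp)+
  have inv: "almost_invariant (2 / real (Suc n)) (m n)" for n
    unfolding almost_invariant_def m_def
  proof (intro allI impI)
    fix f :: "'a \<Rightarrow> real" and B assume "\<forall>g\<in>carrier G. \<bar>f g\<bar> \<le> B"
    then show "\<bar>expect (convolution_pmf G \<mu> (window (Suc n) (j n))) f - expect (window (Suc n) (j n)) f\<bar> \<le> 2 / real (Suc n) * B"
      using window_almost_invariant[of "Suc n" f B "j n"] by simp
  qed
  have \<delta>: "(\<lambda>n. 2 / real (Suc n)) \<longlonglongrightarrow> 0"
    using tendsto_mult_left[OF LIMSEQ_inverse_real_of_nat, of 2] by (simp add: divide_inverse)
  let ?D = "\<lambda>n g. relative_entropy (map_pmf (\<lambda>h. g \<otimes> h) (m n)) (convolution_pmf G \<mu> (m n))"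
  have e4: "0 < e / 4" using e by simp
  have "\<forall>g\<in>S. \<exists>\<psi> B. continuous_on UNIV \<psi> \<and> (\<forall>x. \<bar>\<psi> x\<bar> \<le> B) \<and>
    (\<forall>\<^sub>F n in sequentially. ?D n g \<le> boundary_gain act \<nu> g \<psi> + e / 4)"
    using eventually_relative_entropy_le_gain[OF m(1) inv \<delta> _ e4] S(2) by blast
  from bchoice[OF this] obtain \<psi> where "\<forall>g\<in>S. \<exists>B. continuous_on UNIV (\<psi> g) \<and> (\<forall>x. \<bar>\<psi> g x\<bar> \<le> B) \<and>
    (\<forall>\<^sub>F n in sequentially. ?D n g \<le> boundary_gain act \<nu> g (\<psi> g) + e / 4)"
    by blast
  from bchoice[OF this] obtain B where "\<forall>g\<in>S. continuous_on UNIV (\<psi> g) \<and> (\<forall>x. \<bar>\<psi> g x\<bar> \<le> B g) \<and>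
    (\<forall>\<^sub>F n in sequentially. ?D n g \<le> boundary_gain act \<nu> g (\<psi> g) + e / 4)"
    by blast
  then have \<psi>: "\<And>g. g \<in> S \<Longrightarrow> continuous_on UNIV (\<psi> g)" "\<And>g x. g \<in> S \<Longrightarrow> \<bar>\<psi> g x\<bar> \<le> B g"
    "\<And>g. g \<in> S \<Longrightarrow> \<forall>\<^sub>F n in sequentially. ?D n g \<le> boundary_gain act \<nu> g (\<psi> g) + e / 4"
    by blast+
  have "\<forall>\<^sub>F n in sequentially. \<forall>g\<in>S. ?D n g \<le> boundary_gain act \<nu> g (\<psi> g) + e / 4"
    using \<psi>(3) S(1) by (intro eventually_ball_finite) auto
  moreover have "\<forall>\<^sub>F n in sequentially. 1 / real (Suc n) < e / 4"
    using order_tendstoD(2)[OF LIMSEQ_inverse_real_of_nat e4] by (simp add: inverse_eq_divide)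
  ultimately have "\<forall>\<^sub>F n in sequentially. (\<forall>g\<in>S. ?D n g \<le> boundary_gain act \<nu> g (\<psi> g) + e / 4) \<and> 1 / real (Suc n) < e / 4"
    by (rule eventually_conj)
  from eventually_happens'[OF sequentially_bot this]
  obtain n where n: "\<And>g. g \<in> S \<Longrightarrow> ?D n g \<le> boundary_gain act \<nu> g (\<psi> g) + e / 4" "1 / real (Suc n) < e / 4"
    by blast
  have intD: "integrable (measure_pmf \<mu>) (?D n)"
    by (rule integrable_relative_entropy_convolution[OF support fin m(1) m(2)])
  have int_ln: "integrable (measure_pmf \<mu>) (\<lambda>g. - ln (pmf \<mu> g))"
    using fin by (simp add: pmf_finite_entropy_def)
  have D_le: "?D n g \<le> - ln (pmf \<mu> g)" if "g \<in> set_pmf \<mu>" for g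
    by (rule dominated_pmf.relative_entropy_le_ln[OF dominated_convolution[OF that]])
  \<comment> \<open>\<open>- ln \<mu> + ?t\<close> equals the relative entropy on \<open>S\<close> and its upper bound elsewhere.\<close>
  let ?t = "\<lambda>g. if g \<in> S then ?D n g + ln (pmf \<mu> g) else 0"
  have int_t: "integrable (measure_pmf \<mu>) ?t"
    by (rule Bochner_Integration.integrable_bound[OF Bochner_Integration.integrable_diff[OF intD int_ln]]) auto
  have "asymptotic_entropy G \<mu> - 1 / real (Suc n) \<le> expect \<mu> (?D n)"
    using j[of n] pmf_entropy_convolution[OF support fin m(1) m(2), of n] by (simp add: m_def)
  also have "\<dots> \<le> expect \<mu> (\<lambda>g. - ln (pmf \<mu> g) + ?t g)"
    using intD int_ln int_t D_le by (intro expectation_pmf_mono Bochner_Integration.integrable_add) auto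
  also have "\<dots> = pmf_entropy \<mu> + expect \<mu> ?t"
    unfolding pmf_entropy_def by (rule Bochner_Integration.integral_add[OF int_ln int_t])
  also have "expect \<mu> ?t = (\<Sum>g\<in>S. ?t g * pmf \<mu> g)"
    by (rule integral_measure_pmf_real[OF S(1)]) (auto split: if_splits)
  also have "\<dots> = (\<Sum>g\<in>S. pmf \<mu> g * ?D n g) - sum ?f S"
    unfolding sum_subtractf[symmetric] by (intro sum.cong) (auto simp: algebra_simps)
  also have "pmf_entropy \<mu> + ((\<Sum>g\<in>S. pmf \<mu> g * ?D n g) - sum ?f S) \<le> (\<Sum>g\<in>S. pmf \<mu> g * ?D n g) + e / 4"
    using tail by simp
  also have "(\<Sum>g\<in>S. pmf \<mu> g * ?D n g) \<le> (\<Sum>g\<in>S. pmf \<mu> g * (boundary_gain act \<nu> g (\<psi> g) + e / 4))"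
    using n(1) by (intro sum_mono mult_left_mono) auto
  also have "\<dots> = (\<Sum>g\<in>S. pmf \<mu> g * boundary_gain act \<nu> g (\<psi> g)) + (\<Sum>g\<in>S. pmf \<mu> g) * (e / 4)"
    by (simp add: distrib_left sum.distrib sum_distrib_right)
  also have "(\<Sum>g\<in>S. pmf \<mu> g) * (e / 4) \<le> 1 * (e / 4)"
    using e measure_measure_pmf_finite[OF S(1), of \<mu>] measure_pmf.prob_le_1[of \<mu> S] by (intro mult_right_mono) auto
  finally have "asymptotic_entropy G \<mu> - e \<le> (\<Sum>g\<in>S. pmf \<mu> g * boundary_gain act \<nu> g (\<psi> g))"
    using n(2) e by linarith
  with S \<psi>(1,2) show thesis by (rule that)
qed

end


section \<open>Weak compactness of probability measures on a compact space\<close>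

text \<open>
  Ternary expansions with digits 0 and 2: two codes that are close have many digits in common.
\<close>

definition cantor_code :: "(nat \<Rightarrow> bool) \<Rightarrow> real" where
  "cantor_code a = (\<Sum>i. 2 * of_bool (a i) / 3 ^ Suc i)"

lemma summable_cantor: "summable (\<lambda>i. 2 * of_bool (a i) / 3 ^ Suc i :: real)"
proof (rule summable_comparison_test')
  show "summable (\<lambda>i. 2 / 3 * (1/3) ^ i :: real)" by (intro summable_mult summable_geometric) simp
  show "norm (2 * of_bool (a n) / 3 ^ Suc n :: real) \<le> 2 / 3 * (1/3) ^ n" for n
    by (simp add: power_divide)
qed

lemma cantor_code_bounds: "0 \<le> cantor_code a" "cantor_code a \<le> 1"
proof -
  show "0 \<le> cantor_code a"
    unfolding cantor_code_def by (intro suminf_nonneg summable_cantor) auto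
  have "cantor_code a \<le> (\<Sum>i. 2 / 3 * (1/3) ^ i)"
    unfolding cantor_code_def
    by (intro suminf_le summable_cantor summable_mult summable_geometric) (auto simp: power_divide)
  also have "\<dots> = 2 / 3 * (1 / (1 - 1/3))"
    by (subst suminf_mult) (auto simp: suminf_geometric intro: summable_geometric)
  finally show "cantor_code a \<le> 1" by simp
qed

lemma cantor_code_Suc: "cantor_code a = 2 * of_bool (a 0) / 3 + cantor_code (\<lambda>i. a (Suc i)) / 3"
proof -
  have "cantor_code a = (\<Sum>i. 2 * of_bool (a (Suc i)) / 3 ^ Suc (Suc i)) + 2 * of_bool (a 0) / 3"
    unfolding cantor_code_def using suminf_split_head[OF summable_cantor[of a]] by simp
  also have "(\<Sum>i. 2 * of_bool (a (Suc i)) / 3 ^ Suc (Suc i) :: real) = cantor_code (\<lambda>i. a (Suc i)) / 3"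
    unfolding cantor_code_def by (subst suminf_divide[OF summable_cantor, symmetric]) (simp add: field_simps)
  finally show ?thesis by simp
qed

lemma cantor_code_close:
  assumes "\<bar>cantor_code a - cantor_code b\<bar> < (1/3) ^ n" "i < n"
  shows "a i = b i"
  using assms
proof (induction n arbitrary: a b i)
  case (Suc n)
  let ?a = "\<lambda>i. a (Suc i)" and ?b = "\<lambda>i. b (Suc i)"
  have le: "(1/3) ^ Suc n \<le> (1/3 :: real)" by (simp add: power_le_one)
  have 0: "a 0 = b 0"
  proof (rule ccontr)
    assume "a 0 \<noteq> b 0"
    then show False
      using Suc.prems(1) le cantor_code_bounds[of ?a] cantor_code_bounds[of ?b]
      unfolding cantor_code_Suc[of a] cantor_code_Suc[of b] by (cases "a 0"; cases "b 0") auto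
  qed
  have "\<bar>cantor_code ?a - cantor_code ?b\<bar> < (1/3) ^ n"
    using Suc.prems(1) unfolding cantor_code_Suc[of a] cantor_code_Suc[of b] 0 by (simp add: field_simps abs_less_iff)
  from Suc.IH[OF this] 0 Suc.prems(2) show ?case by (cases i) auto
qed simp

text \<open>
  Each point is coded by the members of a countable base that contain it.  The coding is in general not continuous,
  but its inverse is uniformly continuous: by compactness finitely many small base sets
  cover the space, and points with close codes lie in the same ones among these.
\<close>

lemma compact_space_cantor_code:
  assumes compact: "compact (UNIV :: 'x::polish_space set)"
  obtains s :: "'x::polish_space \<Rightarrow> real" where "s \<in> borel_measurable borel" "\<And>x. 0 \<le> s x" "\<And>x. s x \<le> 1"
    "\<And>e. 0 < e \<Longrightarrow> \<exists>d>0. \<forall>x y. \<bar>s x - s y\<bar> < d \<longrightarrow> dist x y < e"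
proof -
  obtain \<B> :: "'x set set" where \<B>: "countable \<B>" "topological_basis \<B>"
    using ex_countable_basis by blast
  obtain U :: "nat \<Rightarrow> 'x set" where U: "\<B> \<subseteq> range U" "\<And>i. open (U i)"
  proof -
    have "range (from_nat_into (insert UNIV \<B>)) = insert UNIV \<B>"
      using \<B>(1) by (intro range_from_nat_into) auto
    moreover have "open V" if "V \<in> insert UNIV \<B>" for V
      using that topological_basis_open[OF \<B>(2)] by auto
    ultimately show thesis using that[of "from_nat_into (insert UNIV \<B>)"] by (metis range_eqI subset_insertI)
  qed
  define s where "s x = cantor_code (\<lambda>i. x \<in> U i)" for x
  have [measurable]: "U i \<in> sets borel" for i using U(2) by simp
  have "s \<in> borel_measurable borel"
    unfolding s_def cantor_code_def by (intro borel_measurable_suminf) (simp add: of_bool_def)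
  moreover have "\<exists>d>0. \<forall>x y. \<bar>s x - s y\<bar> < d \<longrightarrow> dist x y < e" if e: "0 < e" for e
  proof -
    have "\<exists>i. x \<in> U i \<and> U i \<subseteq> ball x (e / 2)" for x
    proof (rule topological_basisE[OF \<B>(2) open_ball[of x "e / 2"], of x])
      fix V assume "V \<in> \<B>" "x \<in> V" "V \<subseteq> ball x (e / 2)"
      moreover obtain i where "V = U i" using \<open>V \<in> \<B>\<close> U(1) by blast
      ultimately show ?thesis by blast
    qed (use e in simp)
    then obtain c where c: "\<And>x. x \<in> U (c x)" "\<And>x. U (c x) \<subseteq> ball x (e / 2)" by metis
    obtain F where F: "finite F" "UNIV \<subseteq> (\<Union>x\<in>F. U (c x))"
    proof (rule compactE_image[OF compact, of UNIV "\<lambda>x. U (c x)"])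
      show "UNIV \<subseteq> (\<Union>x. U (c x))" using c(1) by blast
    qed (use U(2) in blast)+
    define n where "n = Suc (Max (c ` F))"
    have n: "c z < n" if "z \<in> F" for z
      unfolding n_def using F(1) that by (simp add: less_Suc_eq_le)
    have "dist x y < e" if xy: "\<bar>s x - s y\<bar> < (1/3) ^ n" for x y
    proof -
      obtain z where z: "z \<in> F" "x \<in> U (c z)" using F(2) by blast
      then have "y \<in> U (c z)"
        using cantor_code_close[OF xy[unfolded s_def] n[OF z(1)]] by simp
      then have "dist z x < e / 2" "dist z y < e / 2" using c(2)[of z] z(2) by auto
      then show ?thesis using dist_triangle_half_r[of z x e y] by simp
    qed
    then show ?thesis by (intro exI[of _ "(1/3) ^ n"]) auto
  qed
  ultimately show thesis using that[of s] cantor_code_bounds by (auto simp: s_def)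
qed

text \<open>
  The images of the measures under the coding \<open>s\<close> live on the unit interval, where Helly's theorem applies.  The
  inverse of \<open>s\<close> extends continuously to the closure \<open>K\<close> of the set of codes, and \<open>K\<close> carries the limit measure, which
  can therefore be transported back to the space.
\<close>

theorem compact_weak_subsequence:
  fixes N :: "nat \<Rightarrow> 'x::polish_space measure"
  assumes compact: "compact (UNIV :: 'x set)" and N: "\<And>k. borel_probability (N k)"
  obtains r \<eta> where "strict_mono r" "borel_probability \<eta>"
    "\<And>f :: 'x \<Rightarrow> real. continuous_on UNIV f \<Longrightarrow> (\<lambda>k. \<integral>x. f x \<partial>N (r k)) \<longlonglongrightarrow> (\<integral>x. f x \<partial>\<eta>)"
proof -
  obtain s :: "'x \<Rightarrow> real" where s[measurable]: "s \<in> borel_measurable borel" and s01: "\<And>x. 0 \<le> s x" "\<And>x. s x \<le> 1"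
    and s_close: "\<And>e. 0 < e \<Longrightarrow> \<exists>d>0. \<forall>x y. \<bar>s x - s y\<bar> < d \<longrightarrow> dist x y < e"
    using compact_space_cantor_code[OF compact] by blast
  have inj: "x = y" if "s x = s y" for x y
  proof (rule ccontr)
    assume "x \<noteq> y"
    then obtain d where "d > 0" "\<forall>x' y'. \<bar>s x' - s y'\<bar> < d \<longrightarrow> dist x' y' < dist x y"
      using s_close[of "dist x y"] by auto
    with that show False by (metis abs_zero diff_self less_irrefl)
  qed
  define K where "K = closure (range s)"
  have K: "closed K" "K \<noteq> {}" by (auto simp: K_def)
  have "uniformly_continuous_on (range s) (inv_into UNIV s)"
    unfolding uniformly_continuous_on_def
  proof (intro allI impI)
    fix e :: real assume "0 < e"
    then obtain d where "d > 0" "\<And>x y. \<bar>s x - s y\<bar> < d \<Longrightarrow> dist x y < e" using s_close by blast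
    then show "\<exists>d>0. \<forall>x\<in>range s. \<forall>x'\<in>range s. dist x' x < d \<longrightarrow> dist (inv_into UNIV s x') (inv_into UNIV s x) < e"
      using inj by (intro exI[of _ d]) (auto simp: dist_real_def inv_f_f inj_def)
  qed
  then obtain \<pi> where \<pi>: "uniformly_continuous_on K \<pi>" "\<And>y. y \<in> range s \<Longrightarrow> inv_into UNIV s y = \<pi> y"
    unfolding K_def by (rule uniformly_continuous_on_extension_on_closure) blast
  have \<pi>s: "\<pi> (s x) = x" for x using \<pi>(2)[of "s x"] inj by (simp add: inv_f_f inj_def)
  have sK: "s x \<in> K" for x unfolding K_def by (rule subsetD[OF closure_subset]) simp
  define p where "p y = (if y \<in> K then \<pi> y else undefined)" for y
  have p[measurable]: "p \<in> borel_measurable borel"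
    unfolding p_def using K(1) uniformly_continuous_imp_continuous[OF \<pi>(1)]
    by (intro borel_measurable_continuous_on_if) auto
  have Np: "prob_space (N k)" and Ns[measurable_cong]: "sets (N k) = sets borel" for k
    using N by (auto simp: borel_probability_def)
  have sN: "s \<in> borel_measurable (N k)" for k
    using s by (simp add: measurable_cong_sets[OF Ns refl])
  define L where "L k = distr (N k) borel s" for k
  have L: "real_distribution (L k)" for k
    unfolding L_def by (rule prob_space.real_distribution_distr[OF Np sN])
  have L_int: "(\<integral>y. F y \<partial>L k) = (\<integral>x. F (s x) \<partial>N k)" if "F \<in> borel_measurable borel" for F :: "real \<Rightarrow> real" and k
    unfolding L_def by (rule integral_distr[OF sN that])
  have "tight L"
    unfolding tight_def
  proof (intro conjI allI impI)
    fix e :: real assume e: "0 < e"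
    have "measure (L k) {-1<..1} = 1" for k
    proof -
      have "measure (L k) {-1<..1} = measure (N k) (s -` {-1<..1} \<inter> space (N k))"
        unfolding L_def by (rule measure_distr[OF sN]) simp
      also have "s -` {-1<..1} \<inter> space (N k) = space (N k)"
      proof -
        have "- 1 < s x" for x using s01(1)[of x] by linarith
        then show ?thesis using s01(2) by auto
      qed
      finally show ?thesis using prob_space.prob_space[OF Np] by simp
    qed
    then show "\<exists>a b. a < b \<and> (\<forall>k. 1 - e < measure (L k) {a<..b})"
      using e by (intro exI[of _ "-1"] exI[of _ 1]) simp
  qed (rule L)
  from tight_imp_convergent_subsubsequence[OF this strict_mono_id]
  obtain r M where r: "strict_mono r" and M: "real_distribution M" and wc: "weak_conv_m (L \<circ> id \<circ> r) M"
    by blast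
  interpret M: real_distribution M by (rule M)
  have conv: "(\<lambda>k. \<integral>x. F (s x) \<partial>N (r k)) \<longlonglongrightarrow> (\<integral>y. F y \<partial>M)"
    if F: "continuous_on UNIV F" "\<And>y. \<bar>F y\<bar> \<le> B" for F :: "real \<Rightarrow> real" and B
  proof -
    have "(\<lambda>k. \<integral>y. F y \<partial>(L \<circ> id \<circ> r) k) \<longlonglongrightarrow> (\<integral>y. F y \<partial>M)"
    proof (rule weak_conv_imp_integral_bdd_continuous_conv[OF _ M wc, where B=B])
      show "real_distribution ((L \<circ> id \<circ> r) n)" for n by (simp add: L)
      show "isCont F y" for y using F(1) by (simp add: continuous_on_eq_continuous_at)
    qed (use F(2) in simp)
    then show ?thesis using L_int[OF borel_measurable_continuous_onI[OF F(1)]] by (simp add: o_def)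
  qed
  have AE_K: "AE y in M. y \<in> K"
  proof -
    define F where "F y = min 1 (infdist y K)" for y
    have F: "continuous_on UNIV F" "\<And>y. \<bar>F y\<bar> \<le> 1" "\<And>y. 0 \<le> F y"
      unfolding F_def by (auto intro!: continuous_intros simp: infdist_nonneg)
    have Fm[measurable]: "F \<in> borel_measurable borel" by (rule borel_measurable_continuous_onI[OF F(1)])
    have "F (s x) = 0" for x using sK[of x] by (simp add: F_def)
    with conv[OF F(1,2)] have "(\<integral>y. F y \<partial>M) = 0" by (simp add: LIMSEQ_const_iff)
    moreover have "integrable M F" by (rule M.integrable_const_bound[where B=1]) (use F in auto)
    ultimately have "AE y in M. F y = 0" using F(3) by (subst (asm) integral_nonneg_eq_0_iff_AE) auto
    then show ?thesis
    proof eventually_elim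
      case (elim y)
      then have "infdist y K = 0" by (auto simp: F_def min_def split: if_splits)
      then show ?case using K in_closed_iff_infdist_zero by blast
    qed
  qed
  define \<eta> where "\<eta> = distr M borel p"
  have "borel_probability \<eta>"
    unfolding borel_probability_def \<eta>_def by (auto intro!: M.prob_space_distr)
  moreover have "(\<lambda>k. \<integral>x. f x \<partial>N (r k)) \<longlonglongrightarrow> (\<integral>x. f x \<partial>\<eta>)" if f: "continuous_on UNIV f" for f :: "'x \<Rightarrow> real"
  proof -
    have "bounded (range f)" using compact_imp_bounded[OF compact_continuous_image[OF f compact]] .
    then obtain B where B: "\<And>x. \<bar>f x\<bar> \<le> B" by (auto simp: bounded_iff)
    have B0: "0 \<le> B" using B[of undefined] by linarith
    have "continuous_on K (\<lambda>y. f (\<pi> y))"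
      using uniformly_continuous_imp_continuous[OF \<pi>(1)] by (rule continuous_on_compose2[OF f]) auto
    then obtain F :: "real \<Rightarrow> real" where F: "continuous_on UNIV F" "\<And>y. y \<in> K \<Longrightarrow> F y = f (\<pi> y)" "\<And>y. norm (F y) \<le> B"
      using Tietze[of K "\<lambda>y. f (\<pi> y)" UNIV B] K(1) B B0 by auto
    have Fm[measurable]: "F \<in> borel_measurable borel" by (rule borel_measurable_continuous_onI[OF F(1)])
    have fm[measurable]: "f \<in> borel_measurable borel" by (rule borel_measurable_continuous_onI[OF f])
    have "(\<lambda>k. \<integral>x. F (s x) \<partial>N (r k)) \<longlonglongrightarrow> (\<integral>y. F y \<partial>M)"
      by (rule conv[OF F(1)]) (use F(3) in simp)
    moreover have "F (s x) = f x" for x using F(2)[OF sK] \<pi>s by simp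
    moreover have "(\<integral>y. F y \<partial>M) = (\<integral>y. f (p y) \<partial>M)"
    proof (rule integral_cong_AE)
      show "AE y in M. F y = f (p y)" using AE_K by eventually_elim (simp add: p_def F(2))
    qed simp_all
    moreover have "(\<integral>y. f (p y) \<partial>M) = (\<integral>x. f x \<partial>\<eta>)"
      unfolding \<eta>_def by (rule integral_distr[symmetric]) simp_all
    ultimately show ?thesis by simp
  qed
  ultimately show thesis using r that by blast
qed


section \<open>Continuity of asymptotic entropy\<close>

lemma (in group_pmf) expectation_eq_infsum:
  fixes F :: "'a \<Rightarrow> real"
  assumes F: "\<And>g. g \<in> carrier G \<Longrightarrow> \<bar>F g\<bar> \<le> B"
  shows "expect \<mu> F = (\<Sum>\<^sub>\<infinity>g\<in>carrier G. pmf \<mu> g * F g)"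
proof -
  have "integrable (measure_pmf \<mu>) F"
    using F support by (intro integrable_pmf_bounded[where B=B]) auto
  then have "Infinite_Set_Sum.abs_summable_on (\<lambda>g. pmf \<mu> g * F g) UNIV"
    unfolding abs_summable_on_def integrable_pmf_count_space .
  then have "infsetsum (\<lambda>g. pmf \<mu> g * F g) UNIV = (\<Sum>\<^sub>\<infinity>g. pmf \<mu> g * F g)" by (rule infsetsum_infsum)
  also have "\<dots> = (\<Sum>\<^sub>\<infinity>g\<in>carrier G. pmf \<mu> g * F g)"
    using support by (intro infsum_cong_neutral) (auto simp: set_pmf_iff subset_iff)
  finally show ?thesis by (simp add: expectation_pmf_count_space infsetsum_def)
qed

text \<open>
  The convolution \<open>\<mu> * \<eta>\<close> is a Borel measure with the same integrals of continuous functions as \<open>\<eta>\<close>.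
\<close>

lemma (in group_pmf) stationaryI:
  fixes act :: "'a \<Rightarrow> 'x::polish_space \<Rightarrow> 'x"
  assumes action: "continuous_action G act" and \<eta>: "borel_probability \<eta>"
    and eq: "\<And>f :: 'x \<Rightarrow> real. continuous_on UNIV f \<Longrightarrow> bounded (range f) \<Longrightarrow>
      (\<integral>x. f x \<partial>\<eta>) = expect \<mu> (\<lambda>h. \<integral>x. f (act h x) \<partial>\<eta>)"
  shows "stationary G act \<mu> \<eta>"
proof -
  have sets_eta[measurable_cong]: "sets \<eta> = sets borel" using \<eta> by (simp add: borel_probability_def)
  interpret E: prob_space \<eta> using \<eta> by (simp add: borel_probability_def)
  interpret I: prob_space increment_measure by (rule prob_space_increment)
  interpret Q: pair_prob_space increment_measure \<eta> ..
  note act_measurable = measurable_continuous_action[OF action]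
  have "(\<lambda>(h, x). act h x) \<in> count_space (carrier G) \<Otimes>\<^sub>M borel \<rightarrow>\<^sub>M borel"
    using act_measurable by (intro measurable_pair_measure_countable1 countable_carrier) auto
  then have act_pair[measurable]: "(\<lambda>(h, x). act h x) \<in> increment_measure \<Otimes>\<^sub>M \<eta> \<rightarrow>\<^sub>M borel"
    by (simp add: measurable_cong_sets[OF sets_pair_measure_cong[OF sets_increment sets_eta] refl])
  define \<eta>' where "\<eta>' = distr (increment_measure \<Otimes>\<^sub>M \<eta>) borel (\<lambda>(h, x). act h x)"
  have \<eta>'_int: "(\<integral>x. f x \<partial>\<eta>') = expect \<mu> (\<lambda>h. \<integral>x. f (act h x) \<partial>\<eta>)"
    if f[measurable]: "f \<in> borel_measurable borel" and B: "\<And>x. \<bar>f x\<bar> \<le> B" for f :: "'x \<Rightarrow> real" and B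
  proof -
    have m: "(\<lambda>z. f (case z of (h, x) \<Rightarrow> act h x)) \<in> borel_measurable (increment_measure \<Otimes>\<^sub>M \<eta>)"
      by (rule measurable_compose[OF act_pair f])
    have "(\<integral>x. f x \<partial>\<eta>') = (\<integral>z. f (case z of (h, x) \<Rightarrow> act h x) \<partial>(increment_measure \<Otimes>\<^sub>M \<eta>))"
      unfolding \<eta>'_def by (rule integral_distr) simp_all
    also have "\<dots> = (\<integral>h. \<integral>x. f (case (h, x) of (h, x) \<Rightarrow> act h x) \<partial>\<eta> \<partial>increment_measure)"
      by (rule Q.integral_fst'[symmetric], rule Q.P.integrable_const_bound[where B=B]) (use m B in auto)
    finally show ?thesis by (simp add: integral_increment)
  qed
  have "\<eta> = \<eta>'"
  proof (rule finite_measure_eq_if_continuous_integrals_eq)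
    show "finite_measure \<eta>" by unfold_locales
    show "finite_measure \<eta>'"
      unfolding \<eta>'_def by (intro prob_space.finite_measure Q.P.prob_space_distr) simp
    fix f :: "'x \<Rightarrow> real" assume f: "continuous_on UNIV f" "bounded (range f)"
    then obtain B where "\<And>x. \<bar>f x\<bar> \<le> B" by (auto simp: bounded_iff)
    then show "(\<integral>x. f x \<partial>\<eta>) = (\<integral>x. f x \<partial>\<eta>')"
      unfolding eq[OF f] by (rule \<eta>'_int[OF borel_measurable_continuous_onI[OF f(1)], symmetric])
  qed (simp_all add: sets_eta \<eta>'_def)
  show ?thesis
    unfolding stationary_def
  proof
    fix A :: "'x set" assume A[measurable]: "A \<in> sets borel"
    have "measure \<eta> A = (\<integral>x. indicator A x \<partial>\<eta>)" using sets_eta A sets_eq_imp_space_eq[OF sets_eta] by simp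
    also have "\<dots> = (\<integral>x. indicator A x \<partial>\<eta>')" using \<open>\<eta> = \<eta>'\<close> by simp
    also have "\<dots> = expect \<mu> (\<lambda>h. \<integral>x. indicator A (act h x) \<partial>\<eta>)"
      by (rule \<eta>'_int[of "indicator A" 1]) (auto simp: indicator_def)
    also have "\<dots> = expect \<mu> (\<lambda>h. measure (distr \<eta> borel (act h)) A)"
    proof (intro integral_cong_AE, unfold AE_measure_pmf_iff, simp_all, intro ballI)
      fix h assume "h \<in> set_pmf \<mu>"
      then have h: "h \<in> carrier G" using support by auto
      have m[measurable]: "act h \<in> \<eta> \<rightarrow>\<^sub>M borel"
        using act_measurable[OF h] by (simp add: measurable_cong_sets[OF sets_eta refl])
      have "(\<integral>x. indicator A (act h x) \<partial>\<eta>) = (\<integral>x. indicat_real A x \<partial>distr \<eta> borel (act h))"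
        by (rule integral_distr[symmetric, OF m]) simp
      then show "(\<integral>x. indicat_real A (act h x) \<partial>\<eta>) = measure (distr \<eta> borel (act h)) A" by simp
    qed
    also have "\<dots> = (\<Sum>\<^sub>\<infinity>g\<in>carrier G. pmf \<mu> g * measure (distr \<eta> borel (act g)) A)"
    proof (rule expectation_eq_infsum)
      fix h assume h: "h \<in> carrier G"
      have m: "act h \<in> \<eta> \<rightarrow>\<^sub>M borel"
        using act_measurable[OF h] by (simp add: measurable_cong_sets[OF sets_eta refl])
      show "\<bar>measure (distr \<eta> borel (act h)) A\<bar> \<le> 1"
        using prob_space.prob_le_1[OF E.prob_space_distr[OF m]] by simp
    qed
    finally show "measure \<eta> A = (\<Sum>\<^sub>\<infinity>g\<in>carrier G. pmf \<mu> g * measure (distr \<eta> borel (act g)) A)" .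
  qed
qed

lemma (in stationary_measure) stationary_borel_probability:
  "borel_probability \<eta>" "stationary G act \<mu> \<eta>"
proof -
  show \<eta>: "borel_probability \<eta>" using prob sets_eta by (simp add: borel_probability_def)
  show "stationary G act \<mu> \<eta>"
  proof (rule stationaryI[OF action \<eta>])
    fix f :: "'x \<Rightarrow> real" assume f: "continuous_on UNIV f" "bounded (range f)"
    then obtain B where "\<And>x. \<bar>f x\<bar> \<le> B" by (auto simp: bounded_iff)
    then show "(\<integral>x. f x \<partial>\<eta>) = expect \<mu> (\<lambda>h. \<integral>x. f (act h x) \<partial>\<eta>)"
      by (rule stationary[OF borel_measurable_continuous_onI[OF f(1)]])
  qed
qed

lemma poisson_boundary_walk_boundary:
  fixes act :: "'g \<Rightarrow> 'x::polish_space \<Rightarrow> 'x"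
  assumes "group G" "countable (carrier G)" "set_pmf \<mu> \<subseteq> carrier G" "continuous_action G act" "poisson_boundary G act \<mu> \<nu>"
  obtains bnd where "walk_boundary G \<mu> act \<nu> bnd"
proof -
  interpret group_pmf G \<mu> using assms by (simp add: group_pmf_def group_pmf_axioms_def)
  obtain bnd where "bnd \<in> path_space G \<rightarrow>\<^sub>M borel"
    "\<forall>w\<in>space (path_space G). \<forall>w'\<in>space (path_space G). path_equiv w w' \<longrightarrow> bnd w = bnd w'"
    "distr (path_measure G \<mu>) borel bnd = \<nu>"
    "\<forall>A\<in>boundary_sets G \<mu>. \<exists>B\<in>sets borel. AE w in path_measure G \<mu>. w \<in> A \<longleftrightarrow> bnd w \<in> B"
    "\<forall>g\<in>carrier G. AE w in path_measure G \<mu>. bnd (\<lambda>n. g \<otimes>\<^bsub>G\<^esub> w n) = act g (bnd w)"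
    using assms(5) unfolding poisson_boundary_def by blast
  then have "walk_boundary G \<mu> act \<nu> bnd"
    using assms(4) group_pmf_axioms unfolding walk_boundary_def walk_boundary_axioms_def space_path_space by blast
  then show thesis by (rule that)
qed

text \<open>
  For the upper bound a single convolution power of \<open>\<mu>\<close> is chosen, for the lower bound a single finite family of
  test functions on the boundary of \<open>\<mu>\<close>; both are then evaluated along the sequence.
\<close>

proposition asymptotic_entropy_continuous:
  fixes act :: "'g \<Rightarrow> 'x::polish_space \<Rightarrow> 'x" and \<nu> :: "'x measure" and \<nu>s :: "nat \<Rightarrow> 'x measure"
  assumes bnd: "walk_boundary G \<mu> act \<nu> bnd" and stat: "\<And>k. stationary_measure G (\<mu>s k) act (\<nu>s k)"
    and finite: "pmf_finite_entropy \<mu>" "\<And>k. pmf_finite_entropy (\<mu>s k)"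
    and lim: "\<And>g. (\<lambda>k. pmf (\<mu>s k) g) \<longlonglongrightarrow> pmf \<mu> g"
    and H: "(\<lambda>k. pmf_entropy (\<mu>s k)) \<longlonglongrightarrow> pmf_entropy \<mu>"
    and weak: "weakly_converges \<nu>s \<nu>"
  shows "(\<lambda>k. asymptotic_entropy G (\<mu>s k)) \<longlonglongrightarrow> asymptotic_entropy G \<mu>"
proof -
  interpret walk_boundary G \<mu> act \<nu> bnd by (rule bnd)
  interpret group_pmf_finite_entropy G \<mu> by standard (rule finite)
  have sf: "group_pmf_finite_entropy G (\<mu>s k)" for k
    using stat[of k] finite(2)[of k]
    by (simp add: stationary_measure_def group_pmf_finite_entropy_def group_pmf_finite_entropy_axioms_def)
  show ?thesis
  proof (rule order_tendstoI)
    fix a assume a: "asymptotic_entropy G \<mu> < a"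
    have "\<forall>\<^sub>F n in sequentially. pmf_entropy (convolution_power G \<mu> n) / real n < a"
      by (rule order_tendstoD(2)[OF asymptotic_entropy_tendsto a])
    then have "\<forall>\<^sub>F n in sequentially. pmf_entropy (convolution_power G \<mu> n) / real n < a \<and> 1 \<le> n"
      using eventually_ge_at_top[of 1] by (rule eventually_conj)
    from eventually_happens'[OF sequentially_bot this]
    obtain n where n: "pmf_entropy (convolution_power G \<mu> n) < a * real n" "1 \<le> n"
      by (auto simp: field_simps)
    have "(\<lambda>k. pmf_entropy (convolution_power G (\<mu>s k) n)) \<longlonglongrightarrow> pmf_entropy (convolution_power G \<mu> n)"
      by (intro pmf_entropy_convolution_power_tendsto lim finite H fin_pow group_pmf_finite_entropy.fin_pow[OF sf])
    from order_tendstoD(2)[OF this n(1)]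
    show "\<forall>\<^sub>F k in sequentially. asymptotic_entropy G (\<mu>s k) < a"
    proof eventually_elim
      case (elim k)
      have "real n * asymptotic_entropy G (\<mu>s k) < real n * a"
        using group_pmf_finite_entropy.asymptotic_entropy_le[OF sf, of n k] elim by (simp add: mult.commute)
      then show ?case using n(2) by simp
    qed
  next
    fix a assume a: "a < asymptotic_entropy G \<mu>"
    define e where "e = (asymptotic_entropy G \<mu> - a) / 2"
    have e: "0 < e" using a by (simp add: e_def)
    obtain S \<psi> B where S: "finite S" "S \<subseteq> set_pmf \<mu>" and \<psi>: "\<And>g. g \<in> S \<Longrightarrow> continuous_on UNIV (\<psi> g)"
        "\<And>g x. g \<in> S \<Longrightarrow> \<bar>\<psi> g x\<bar> \<le> B g"
      and gain: "asymptotic_entropy G \<mu> - e \<le> (\<Sum>g\<in>S. pmf \<mu> g * boundary_gain act \<nu> g (\<psi> g))"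
      by (rule asymptotic_entropy_le_sum_boundary_gain[OF finite(1) e]) (rule that, assumption+)
    have "(\<lambda>k. \<Sum>g\<in>S. pmf (\<mu>s k) g * boundary_gain act (\<nu>s k) g (\<psi> g)) \<longlonglongrightarrow> (\<Sum>g\<in>S. pmf \<mu> g * boundary_gain act \<nu> g (\<psi> g))"
    proof (intro tendsto_sum tendsto_mult lim)
      fix g assume g: "g \<in> S"
      have gC: "g \<in> carrier G" using g S support by auto
      have cont_act: "continuous_on UNIV (act g)" using action gC by (simp add: continuous_action_def)
      have "continuous_on UNIV (\<lambda>x. \<psi> g (act g x))"
        by (rule continuous_on_compose2[OF \<psi>(1)[OF g] cont_act]) auto
      moreover have "bounded (range (\<lambda>x. \<psi> g (act g x)))"
        using \<psi>(2)[OF g] by (auto simp: bounded_iff intro!: exI[of _ "B g"])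
      ultimately have 1: "(\<lambda>k. \<integral>x. \<psi> g (act g x) \<partial>\<nu>s k) \<longlonglongrightarrow> (\<integral>x. \<psi> g (act g x) \<partial>\<nu>)"
        using weak unfolding weakly_converges_def by blast
      have "continuous_on UNIV (\<lambda>x. exp (\<psi> g x))" using \<psi>(1)[OF g] by (intro continuous_intros)
      moreover have "\<psi> g x \<le> B g" for x using \<psi>(2)[OF g, of x] by simp
      then have "bounded (range (\<lambda>x. exp (\<psi> g x)))"
        by (auto simp: bounded_iff intro!: exI[of _ "exp (B g)"])
      ultimately have 2: "(\<lambda>k. \<integral>x. exp (\<psi> g x) \<partial>\<nu>s k) \<longlonglongrightarrow> (\<integral>x. exp (\<psi> g x) \<partial>\<nu>)"
        using weak unfolding weakly_converges_def by blast
      show "(\<lambda>k. boundary_gain act (\<nu>s k) g (\<psi> g)) \<longlonglongrightarrow> boundary_gain act \<nu> g (\<psi> g)"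
        unfolding boundary_gain_def by (intro tendsto_intros 1 2)
    qed
    moreover have "a < (\<Sum>g\<in>S. pmf \<mu> g * boundary_gain act \<nu> g (\<psi> g))"
      using gain a unfolding e_def by argo
    ultimately have "\<forall>\<^sub>F k in sequentially. a < (\<Sum>g\<in>S. pmf (\<mu>s k) g * boundary_gain act (\<nu>s k) g (\<psi> g))"
      by (rule order_tendstoD(1))
    then show "\<forall>\<^sub>F k in sequentially. a < asymptotic_entropy G (\<mu>s k)"
    proof eventually_elim
      case (elim k)
      have "(\<Sum>g\<in>S. pmf (\<mu>s k) g * boundary_gain act (\<nu>s k) g (\<psi> g)) \<le> asymptotic_entropy G (\<mu>s k)"
        using \<psi> by (intro stationary_measure.sum_boundary_gain_le_asymptotic_entropy[OF stat finite(2) S(1)])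
          (auto intro: borel_measurable_continuous_onI)
      with elim show ?case by simp
    qed
  qed
qed

text \<open>
  A subsequence staying away from \<open>\<nu>\<close> would have a weak limit point.  The stationarity equations for continuous
  functions pass to the limit, since the weights \<open>\<mu>s k\<close> converge in total variation, so this limit point would be \<open>\<nu>\<close>.
\<close>

proposition weakly_converges_if_unique_stationary:
  fixes act :: "'g \<Rightarrow> 'x::polish_space \<Rightarrow> 'x" and \<nu> :: "'x measure" and \<nu>s :: "nat \<Rightarrow> 'x measure"
  assumes \<mu>: "stationary_measure G \<mu> act \<nu>" and stat: "\<And>k. stationary_measure G (\<mu>s k) act (\<nu>s k)"
    and lim: "\<And>g. (\<lambda>k. pmf (\<mu>s k) g) \<longlonglongrightarrow> pmf \<mu> g"
    and compact: "compact (UNIV :: 'x set)"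
    and unique: "\<exists>!\<eta>. borel_probability \<eta> \<and> stationary G act \<mu> \<eta>"
  shows "weakly_converges \<nu>s \<nu>"
  unfolding weakly_converges_def
proof (intro allI impI, elim conjE, rule ccontr)
  fix f :: "'x \<Rightarrow> real"
  assume f: "continuous_on UNIV f" "bounded (range f)"
    and not: "\<not> (\<lambda>k. \<integral>x. f x \<partial>\<nu>s k) \<longlonglongrightarrow> (\<integral>x. f x \<partial>\<nu>)"
  interpret stationary_measure G \<mu> act \<nu> by (rule \<mu>)
  obtain e where e: "0 < e" and "\<not> (\<forall>\<^sub>F k in sequentially. dist (\<integral>x. f x \<partial>\<nu>s k) (\<integral>x. f x \<partial>\<nu>) < e)"
    using not unfolding tendsto_iff by blast
  then have "\<exists>\<^sub>F k in sequentially. \<not> dist (\<integral>x. f x \<partial>\<nu>s k) (\<integral>x. f x \<partial>\<nu>) < e"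
    by (simp add: frequently_def)
  then have "infinite {k. \<not> dist (\<integral>x. f x \<partial>\<nu>s k) (\<integral>x. f x \<partial>\<nu>) < e}"
    by (simp add: frequently_cofinite[symmetric] cofinite_eq_sequentially)
  then obtain r :: "nat \<Rightarrow> nat" where r: "strict_mono r" "\<And>k. \<not> dist (\<integral>x. f x \<partial>\<nu>s (r k)) (\<integral>x. f x \<partial>\<nu>) < e"
    using infinite_enumerate by blast
  have bp: "borel_probability (\<nu>s k)" for k
    by (rule stationary_measure.stationary_borel_probability(1)[OF stat])
  obtain q \<eta> where q: "strict_mono q" and \<eta>: "borel_probability \<eta>"
    and conv: "\<And>h :: 'x \<Rightarrow> real. continuous_on UNIV h \<Longrightarrow> (\<lambda>k. \<integral>x. h x \<partial>\<nu>s (r (q k))) \<longlonglongrightarrow> (\<integral>x. h x \<partial>\<eta>)"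
    by (rule compact_weak_subsequence[OF compact, of "\<lambda>k. \<nu>s (r k)"]) (rule bp, rule that, assumption+)
  have rq: "strict_mono (\<lambda>k. r (q k))" using strict_mono_o[OF r(1) q] by (simp add: o_def)
  have "stationary G act \<mu> \<eta>"
  proof (rule stationaryI[OF action \<eta>])
    fix h :: "'x \<Rightarrow> real" assume h: "continuous_on UNIV h" "bounded (range h)"
    then obtain B where B: "\<And>x. \<bar>h x\<bar> \<le> B" by (auto simp: bounded_iff)
    have B0: "0 \<le> B" using B[of undefined] by linarith
    let ?F = "\<lambda>L g. if g \<in> carrier G then \<integral>x. h (act g x) \<partial>L else 0"
    have cont: "continuous_on UNIV (\<lambda>x. h (act g x))" if "g \<in> carrier G" for g
      using action that by (intro continuous_on_compose2[OF h(1)]) (auto simp: continuous_action_def)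
    have "(\<lambda>k. expect (\<mu>s (r (q k))) (?F (\<nu>s (r (q k))))) \<longlonglongrightarrow> expect \<mu> (?F \<eta>)"
    proof (rule expectation_pmf_tendsto)
      show "(\<lambda>k. pmf (\<mu>s (r (q k))) x) \<longlonglongrightarrow> pmf \<mu> x" for x
        using LIMSEQ_subseq_LIMSEQ[OF lim rq] by (simp add: o_def)
      show "(\<lambda>k. ?F (\<nu>s (r (q k))) x) \<longlonglongrightarrow> ?F \<eta> x" for x
        using conv[OF cont] by simp
      show "\<bar>?F (\<nu>s (r (q k))) x\<bar> \<le> B" for k x
        using stationary_measure.integral_bound(2)[OF stat borel_measurable_continuous_onI[OF cont] B, of x] B0 by simp
    qed
    moreover have "expect (\<mu>s k) (?F (\<nu>s k)) = (\<integral>x. h x \<partial>\<nu>s k)" for k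
    proof -
      interpret K: stationary_measure G "\<mu>s k" act "\<nu>s k" by (rule stat)
      have "(\<integral>x. h x \<partial>\<nu>s k) = expect (\<mu>s k) (\<lambda>g. \<integral>x. h (act g x) \<partial>\<nu>s k)"
        by (rule K.stationary[OF borel_measurable_continuous_onI[OF h(1)] B])
      also have "\<dots> = expect (\<mu>s k) (?F (\<nu>s k))"
        using K.support by (intro integral_cong_AE) (auto simp: AE_measure_pmf_iff)
      finally show ?thesis by simp
    qed
    moreover have "expect \<mu> (?F \<eta>) = expect \<mu> (\<lambda>g. \<integral>x. h (act g x) \<partial>\<eta>)"
      using support by (intro integral_cong_AE) (auto simp: AE_measure_pmf_iff)
    ultimately have "(\<lambda>k. \<integral>x. h x \<partial>\<nu>s (r (q k))) \<longlonglongrightarrow> expect \<mu> (\<lambda>g. \<integral>x. h (act g x) \<partial>\<eta>)" by simp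
    with conv[OF h(1)] show "(\<integral>x. h x \<partial>\<eta>) = expect \<mu> (\<lambda>g. \<integral>x. h (act g x) \<partial>\<eta>)"
      by (rule LIMSEQ_unique)
  qed
  then have "\<eta> = \<nu>" using unique \<eta> stationary_borel_probability by blast
  then have "\<forall>\<^sub>F k in sequentially. dist (\<integral>x. f x \<partial>\<nu>s (r (q k))) (\<integral>x. f x \<partial>\<nu>) < e"
    using conv[OF f(1)] e unfolding tendsto_iff by blast
  from eventually_happens'[OF sequentially_bot this] r(2) show False by blast
qed

theorem theorem1p5:
  fixes G :: "('g, 'b) monoid_scheme"
    and \<mu> :: "'g pmf" and \<mu>s :: "nat \<Rightarrow> 'g pmf"
    and act :: "'g \<Rightarrow> 'x::polish_space \<Rightarrow> 'x"
    and \<nu> :: "'x measure" and \<nu>s :: "nat \<Rightarrow> 'x measure"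
  assumes "group G" and "countable (carrier G)"
    and "set_pmf \<mu> \<subseteq> carrier G" and "nondegenerate G \<mu>" and "finite_entropy G \<mu>"
    and "\<And>k. k \<ge> 1 \<Longrightarrow> set_pmf (\<mu>s k) \<subseteq> carrier G"
    and "\<And>k. k \<ge> 1 \<Longrightarrow> nondegenerate G (\<mu>s k)"
    and "\<And>k. k \<ge> 1 \<Longrightarrow> finite_entropy G (\<mu>s k)"
    and "\<And>g. g \<in> carrier G \<Longrightarrow> (\<lambda>k. pmf (\<mu>s k) g) \<longlonglongrightarrow> pmf \<mu> g"
    and "(\<lambda>k. shannon_entropy G (\<mu>s k)) \<longlonglongrightarrow> shannon_entropy G \<mu>"
    and "continuous_action G act"
    and "borel_probability \<nu>" and "\<And>k. k \<ge> 1 \<Longrightarrow> borel_probability (\<nu>s k)"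
    and "poisson_boundary G act \<mu> \<nu>"
    and "\<And>k. k \<ge> 1 \<Longrightarrow> poisson_boundary G act (\<mu>s k) (\<nu>s k)"
  shows "(weakly_converges \<nu>s \<nu> \<longrightarrow>
            (\<lambda>k. asymptotic_entropy G (\<mu>s k)) \<longlonglongrightarrow> asymptotic_entropy G \<mu>) \<and>
         (compact (UNIV :: 'x set) \<and> (\<exists>!\<eta>. borel_probability \<eta> \<and> stationary G act \<mu> \<eta>) \<longrightarrow>
            (\<lambda>k. asymptotic_entropy G (\<mu>s k)) \<longlonglongrightarrow> asymptotic_entropy G \<mu>)"
proof -
  \<comment> \<open>The hypotheses speak of indices \<open>k \<ge> 1\<close>, so the sequences are shifted by one.\<close>
  let ?\<mu>s = "\<lambda>k. \<mu>s (Suc k)" and ?\<nu>s = "\<lambda>k. \<nu>s (Suc k)"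
  have supp: "set_pmf (?\<mu>s k) \<subseteq> carrier G" for k using assms(6) by simp
  obtain bnd where bnd: "walk_boundary G \<mu> act \<nu> bnd"
    by (rule poisson_boundary_walk_boundary[OF assms(1,2,3,11,14)])
  interpret walk_boundary G \<mu> act \<nu> bnd by (rule bnd)
  have stat: "stationary_measure G (?\<mu>s k) act (?\<nu>s k)" for k
  proof -
    have pb: "poisson_boundary G act (?\<mu>s k) (?\<nu>s k)" using assms(15) by simp
    obtain b where "walk_boundary G (?\<mu>s k) act (?\<nu>s k) b"
      by (rule poisson_boundary_walk_boundary[OF assms(1,2) supp assms(11) pb])
    then interpret K: walk_boundary G "?\<mu>s k" act "?\<nu>s k" b .
    show ?thesis by (rule K.stationary_measure_axioms)
  qed
  have fin: "pmf_finite_entropy \<mu>" "\<And>k. pmf_finite_entropy (?\<mu>s k)"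
    using assms(5,8) finite_entropy_iff[OF assms(3)] finite_entropy_iff[OF supp] by auto
  have lim: "(\<lambda>k. pmf (?\<mu>s k) g) \<longlonglongrightarrow> pmf \<mu> g" for g
  proof (cases "g \<in> carrier G")
    case True
    then show ?thesis using assms(9) by (intro LIMSEQ_Suc)
  next
    case False
    then have "pmf \<mu> g = 0" "pmf (?\<mu>s k) g = 0" for k
      using supp[of k] assms(3) by (auto simp: pmf_eq_0_set_pmf)
    then show ?thesis by simp
  qed
  have H: "(\<lambda>k. pmf_entropy (?\<mu>s k)) \<longlonglongrightarrow> pmf_entropy \<mu>"
    using LIMSEQ_Suc[OF assms(10)] by (simp add: shannon_entropy_eq[OF supp] shannon_entropy_eq[OF assms(3)])
  have main: "(\<lambda>k. asymptotic_entropy G (\<mu>s k)) \<longlonglongrightarrow> asymptotic_entropy G \<mu>" if "weakly_converges ?\<nu>s \<nu>"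
    by (rule LIMSEQ_imp_Suc, rule asymptotic_entropy_continuous[OF bnd stat fin lim H that])
  have "weakly_converges ?\<nu>s \<nu>" if "weakly_converges \<nu>s \<nu>"
    unfolding weakly_converges_def
  proof (intro allI impI)
    fix f :: "'x \<Rightarrow> real" assume "continuous_on UNIV f \<and> bounded (range f)"
    with that have "(\<lambda>k. \<integral>x. f x \<partial>\<nu>s k) \<longlonglongrightarrow> (\<integral>x. f x \<partial>\<nu>)"
      by (simp add: weakly_converges_def)
    then show "(\<lambda>k. \<integral>x. f x \<partial>?\<nu>s k) \<longlonglongrightarrow> (\<integral>x. f x \<partial>\<nu>)" by (rule LIMSEQ_Suc)
  qed
  moreover have "weakly_converges ?\<nu>s \<nu>"
    if "compact (UNIV :: 'x set) \<and> (\<exists>!\<eta>. borel_probability \<eta> \<and> stationary G act \<mu> \<eta>)"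
    using that by (intro weakly_converges_if_unique_stationary[OF stationary_measure_axioms stat lim]) auto
  ultimately show ?thesis using main by blast
qed

end
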